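(* Let $d \ge 1$, $p \geq 2$, $q, r \in [1,\infty]$ and $s \in \mathbb{R}$. (i) If there is a constant $C$ such that $\| Uf \|_{L^p([-1,1] \times \mathbb{R}^d)} \le C \| f \|_{M^s_{p,q}(\mathbb{R}^d)}$ for all $f \in M^s_{p,q}(\mathbb{R}^d)$, then $$ s \geq \max\Big(0, d - \frac{d+2}{p} - \frac{d}{q}\Big).$$ (ii) If there is a constant $C$ such that $\| Uf \|_{L_t^p([-1,1];L_x^q(\mathbb{R}^d))} \le C \| f \|_{L^r_s(\mathbb{R}^d)}$ for all $f \in L^r_s(\mathbb{R}^d)$, then $$ s \geq \max\Big(0, d - \frac{d}{q} - \frac{2}{p} - \frac{d}{r}\Big) \quad \text{and} \quad q \geq r.$$ (iii) If there is a constant $C$ such that $\| Uf \|_{L_t^p(\mathbb{R};L_x^q(\mathbb{R}^d))} \le C \| f \|_{L^r_s(\mathbb{R}^d)}$ for all $f \in L^r_s(\mathbb{R}^d)$, then, in addition to the conditions in (ii), $$ \frac{2}{p} + \frac{d}{q} \leq \frac{d}{r}.$$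
   Context: $U(t) = e^{it\Delta}$ is the free Schrödinger propagator on $\mathbb{R}^d$, and $Uf$ denotes the function $(t,x) \mapsto (U(t)f)(x)$ for $f \in \mathcal{S}'(\mathbb{R}^d)$. $L^r_s(\mathbb{R}^d) = \langle D \rangle^{-s} L^r(\mathbb{R}^d)$ with norm $\|f\|_{L^r_s} = \|\langle D \rangle^s f\|_{L^r}$, where $\langle D\rangle^s$ is the Fourier multiplier with symbol $(1+|\xi|^2)^{s/2}$. Modulation spaces: let $\sigma_0 \in C_c^\infty(\mathbb{R}^d)$ be such that $\sigma_k(\xi) := \sigma_0(\xi - k)$, $k \in \mathbb{Z}^d$, is a smooth partition of unity on $\mathbb{R}^d$ adapted to the unit cubes $Q_k = k + [-\frac12,\frac12)^d$. Set $\widehat{\Box_k f} = \sigma_k \hat f$ and, with $\langle k \rangle = (1+|k|^2)^{1/2}$, $$\|f\|_{M^s_{p,q}(\mathbb{R}^d)} = \Big( \sum_{k \in \mathbb{Z}^d} \langle k \rangle^{qs} \|\Box_k f\|_{L^p(\mathbb{R}^d)}^q \Big)^{1/q}$$ (supremum over $k$ if $q = \infty$); $M^s_{p,q}(\mathbb{R}^d)$ is the space of tempered distributions with finite norm. Different choices of $\sigma_0$ give equivalent norms. *)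

theory Defs
  imports "HOL-Analysis.Analysis" "HOL-Probability.Essential_Supremum"
begin

subsection \<open>Extended Lebesgue norms\<close>

text \<open>Powers of extended nonnegative reals, only meant for exponents \<open>a > 0\<close>.\<close>

definition ennpowr :: "ennreal \<Rightarrow> real \<Rightarrow> ennreal" where
  "ennpowr x a = (if x = \<infinity> then \<infinity> else ennreal (enn2real x powr a))"

text \<open>Exponents range over \<open>[1, \<infinity>]\<close>, encoded as \<^typ>\<open>ennreal\<close>. The reciprocal of an exponent
  is a real number, with \<open>1 / \<infinity> = 0\<close>.\<close>

definition recip :: "ennreal \<Rightarrow> real" where
  "recip p = enn2real (1 / p)"

text \<open>The norm takes \<^typ>\<open>ennreal\<close>-valued integrands, so that it can be iterated for mixed norms;
  a complex-valued \<open>g\<close> enters through \<open>\<lambda>x. ennreal (norm (g x))\<close>.\<close>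

definition Lp_norm :: "ennreal \<Rightarrow> 'a measure \<Rightarrow> ('a \<Rightarrow> ennreal) \<Rightarrow> ennreal" where
  "Lp_norm p M g =
     (if p = \<infinity> then esssup M g
      else ennpowr (\<integral>\<^sup>+x. ennpowr (g x) (enn2real p) \<partial>M) (1 / enn2real p))"


subsection \<open>Schwartz functions and tempered distributions\<close>

definition partial :: "'n \<Rightarrow> (real^'n \<Rightarrow> 'b::real_normed_vector) \<Rightarrow> real^'n \<Rightarrow> 'b" where
  "partial i f x = frechet_derivative f (at x) (axis i 1)"

fun iter_partial :: "'n list \<Rightarrow> (real^'n \<Rightarrow> 'b::real_normed_vector) \<Rightarrow> real^'n \<Rightarrow> 'b" where
  "iter_partial [] f = f"
| "iter_partial (i # is) f = partial i (iter_partial is f)"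

text \<open>\<open>C\<^sup>\<infinity>\<close>: all iterated partial derivatives exist and are (totally) differentiable.\<close>

definition smooth :: "(real^'n \<Rightarrow> 'b::real_normed_vector) \<Rightarrow> bool" where
  "smooth f \<longleftrightarrow> (\<forall>is x. iter_partial is f differentiable (at x))"

definition schwartz :: "(real^'n \<Rightarrow> complex) set" where
  "schwartz = {\<phi>. smooth \<phi> \<and>
     (\<forall>N is. bounded (range (\<lambda>x. (1 + norm x) ^ N *\<^sub>R iter_partial is \<phi> x)))}"

definition schwartz_norm :: "nat \<Rightarrow> (real^'n \<Rightarrow> complex) \<Rightarrow> real" where
  "schwartz_norm N \<phi> =
     (\<Sum>is | length is \<le> N. SUP x. (1 + norm x) ^ N * norm (iter_partial is \<phi> x))"

text \<open>A distribution is a functional on all functions, of which only the values on \<open>schwartz\<close>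
  matter. Since the norms \<open>schwartz_norm N\<close> increase with \<open>N\<close> and generate the topology of the
  Schwartz space, the estimate below is continuity of the linear functional.\<close>

type_synonym 'n distr = "(real^'n \<Rightarrow> complex) \<Rightarrow> complex"

definition tempered :: "'n::finite distr \<Rightarrow> bool" where
  "tempered f \<longleftrightarrow>
     (\<forall>\<phi>\<in>schwartz. \<forall>\<psi>\<in>schwartz. f (\<lambda>x. \<phi> x + \<psi> x) = f \<phi> + f \<psi>) \<and>
     (\<forall>\<phi>\<in>schwartz. \<forall>c. f (\<lambda>x. c * \<phi> x) = c * f \<phi>) \<and>
     (\<exists>N C. \<forall>\<phi>\<in>schwartz. norm (f \<phi>) \<le> C * schwartz_norm N \<phi>)"

text \<open>The function \<open>g\<close> and the distribution \<open>f\<close> are identified.\<close>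

definition represents :: "(real^'n \<Rightarrow> complex) \<Rightarrow> 'n distr \<Rightarrow> bool" where
  "represents g f \<longleftrightarrow> g \<in> borel_measurable lborel \<and>
     (\<forall>\<phi>\<in>schwartz. integrable lborel (\<lambda>x. g x * \<phi> x) \<and> f \<phi> = (LINT x|lborel. g x * \<phi> x))"

text \<open>Representing functions agree almost everywhere, so the infimum is over at most one value; it
  is \<open>\<infinity>\<close> if the distribution is not given by a function.\<close>

definition distr_Lp_norm :: "ennreal \<Rightarrow> 'n::finite distr \<Rightarrow> ennreal" where
  "distr_Lp_norm p f =
     (INF g\<in>{g. represents g f}. Lp_norm p lborel (\<lambda>x. ennreal (norm (g x))))"


subsection \<open>Fourier multipliers\<close>

definition fourier :: "(real^'n \<Rightarrow> complex) \<Rightarrow> real^'n \<Rightarrow> complex" where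
  "fourier \<phi> \<xi> =
     (2 * pi) powr (- real CARD('n) / 2) *\<^sub>R (LINT x|lborel. cis (- (x \<bullet> \<xi>)) * \<phi> x)"

definition inv_fourier :: "(real^'n \<Rightarrow> complex) \<Rightarrow> real^'n \<Rightarrow> complex" where
  "inv_fourier \<phi> x =
     (2 * pi) powr (- real CARD('n) / 2) *\<^sub>R (LINT \<xi>|lborel. cis (x \<bullet> \<xi>) * \<phi> \<xi>)"

definition distr_fourier :: "'n::finite distr \<Rightarrow> 'n distr" where
  "distr_fourier f \<phi> = f (fourier \<phi>)"

definition distr_inv_fourier :: "'n::finite distr \<Rightarrow> 'n distr" where
  "distr_inv_fourier f \<phi> = f (inv_fourier \<phi>)"

definition distr_mult :: "(real^'n \<Rightarrow> complex) \<Rightarrow> 'n distr \<Rightarrow> 'n distr" where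
  "distr_mult m f \<phi> = f (\<lambda>\<xi>. m \<xi> * \<phi> \<xi>)"

definition fourier_multiplier :: "(real^'n \<Rightarrow> complex) \<Rightarrow> 'n::finite distr \<Rightarrow> 'n distr" where
  "fourier_multiplier m f = distr_inv_fourier (distr_mult m (distr_fourier f))"

definition bessel :: "real \<Rightarrow> 'n::finite distr \<Rightarrow> 'n distr" where
  "bessel s = fourier_multiplier (\<lambda>\<xi>. complex_of_real ((1 + (norm \<xi>)\<^sup>2) powr (s / 2)))"

text \<open>\<open>U(t) = exp (i t \<Delta>)\<close> has the symbol \<open>exp (- i t |\<xi>|\<^sup>2)\<close>.\<close>

definition schroedinger :: "real \<Rightarrow> 'n::finite distr \<Rightarrow> 'n distr" where
  "schroedinger t = fourier_multiplier (\<lambda>\<xi>. cis (- (t * (norm \<xi>)\<^sup>2)))"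


subsection \<open>Bessel potential spaces and modulation spaces\<close>

definition bessel_norm :: "real \<Rightarrow> ennreal \<Rightarrow> 'n::finite distr \<Rightarrow> ennreal" where
  "bessel_norm s r f = distr_Lp_norm r (bessel s f)"

definition bessel_space :: "real \<Rightarrow> ennreal \<Rightarrow> 'n::finite distr set" where
  "bessel_space s r = {f. tempered f \<and> bessel_norm s r f < \<infinity>}"

definition int_lattice :: "(real^'n) set" where
  "int_lattice = {k. \<forall>i. k $ i \<in> \<int>}"

definition unit_cube :: "real^'n \<Rightarrow> (real^'n) set" where
  "unit_cube k = {\<xi>. \<forall>i. k $ i - 1/2 \<le> \<xi> $ i \<and> \<xi> $ i < k $ i + 1/2}"

text \<open>Smooth partitions of unity \<open>\<sigma>\<^sub>k(\<xi>) = \<sigma>(\<xi> - k)\<close> adapted to the unit cubes: each \<open>\<sigma>\<^sub>k\<close> lives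
  on a dilate of the cube centred at \<open>k\<close>, with a ratio \<open>R\<close> independent of \<open>k\<close>. As \<open>R\<close> is arbitrary,
  this says that the support of \<open>\<sigma>\<close> is compact.\<close>

definition cube_partition :: "(real^'n \<Rightarrow> real) \<Rightarrow> bool" where
  "cube_partition \<sigma> \<longleftrightarrow> smooth \<sigma> \<and> (\<forall>\<xi>. 0 \<le> \<sigma> \<xi>) \<and>
     (\<exists>R. {\<xi>. \<sigma> \<xi> \<noteq> 0} \<subseteq> (*\<^sub>R) R ` unit_cube 0) \<and>
     (\<forall>\<xi>. ((\<lambda>k. \<sigma> (\<xi> - k)) has_sum 1) int_lattice)"

definition box :: "(real^'n \<Rightarrow> real) \<Rightarrow> real^'n \<Rightarrow> 'n::finite distr \<Rightarrow> 'n distr" where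
  "box \<sigma> k = fourier_multiplier (\<lambda>\<xi>. complex_of_real (\<sigma> (\<xi> - k)))"

definition japanese :: "real^'n \<Rightarrow> real" where
  "japanese k = sqrt (1 + (norm k)\<^sup>2)"

definition modulation_norm ::
    "(real^'n \<Rightarrow> real) \<Rightarrow> real \<Rightarrow> ennreal \<Rightarrow> ennreal \<Rightarrow> 'n::finite distr \<Rightarrow> ennreal" where
  "modulation_norm \<sigma> s p q f =
     (if q = \<infinity> then SUP k\<in>int_lattice. ennreal (japanese k powr s) * distr_Lp_norm p (box \<sigma> k f)
      else ennpowr (\<integral>\<^sup>+k. ennreal (japanese k powr (enn2real q * s)) *
                          ennpowr (distr_Lp_norm p (box \<sigma> k f)) (enn2real q) \<partial>count_space int_lattice)
             (1 / enn2real q))"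

definition modulation_space ::
    "(real^'n \<Rightarrow> real) \<Rightarrow> real \<Rightarrow> ennreal \<Rightarrow> ennreal \<Rightarrow> 'n::finite distr set" where
  "modulation_space \<sigma> s p q = {f. tempered f \<and> modulation_norm \<sigma> s p q f < \<infinity>}"


subsection \<open>Space-time norms of the free evolution\<close>

text \<open>\<open>F\<close> is the function \<open>Uf\<close> on \<open>I \<times> \<real>\<^sup>d\<close>. As for \<open>distr_Lp_norm\<close>, the norms below are \<open>\<infinity>\<close> if
  there is no such function.\<close>

definition represents_U ::
    "real set \<Rightarrow> (real \<times> (real^'n) \<Rightarrow> complex) \<Rightarrow> 'n::finite distr \<Rightarrow> bool" where
  "represents_U I F f \<longleftrightarrow> F \<in> borel_measurable lborel \<and>
     (AE t in lborel. t \<in> I \<longrightarrow> represents (\<lambda>x. F (t, x)) (schroedinger t f))"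

definition U_Lp_norm :: "ennreal \<Rightarrow> real set \<Rightarrow> 'n::finite distr \<Rightarrow> ennreal" where
  "U_Lp_norm p I f =
     (INF F\<in>{F. represents_U I F f}.
        Lp_norm p (restrict_space lborel (I \<times> UNIV)) (\<lambda>z. ennreal (norm (F z))))"

definition U_mixed_norm :: "ennreal \<Rightarrow> real set \<Rightarrow> ennreal \<Rightarrow> 'n::finite distr \<Rightarrow> ennreal" where
  "U_mixed_norm p I q f =
     (INF F\<in>{F. represents_U I F f}.
        Lp_norm p (restrict_space lborel I)
          (\<lambda>t. Lp_norm q lborel (\<lambda>x. ennreal (norm (F (t, x))))))"

end

theory Submission
  imports Defs "HOL-Complex_Analysis.Complex_Analysis" "HOL-Probability.Probability"
begin

text \<open>
  Each condition is the growth rate of an explicit family of test data. A datum \<open>f\<close> is given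
  through its Fourier transform \<open>A\<close>, a Schwartz function; it is the integrable function
  \<open>inv_fourier A\<close> (\<open>spectral\<close>), and by Fourier inversion a multiplier \<open>m\<close> acts on it as the
  multiplication of \<open>A\<close> by \<open>m\<close>. The transform of the solution at time \<open>t\<close> is thus
  \<open>exp (- i t |\<xi>|\<^sup>2) A(\<xi>)\<close>.

  Lower bounds for the solution. Let \<open>A(\<xi>) = exp (i t0 |\<xi>|\<^sup>2) B(\<xi>)\<close> with \<open>B \<ge> 0\<close>. The solution at
  time \<open>t\<close> is tested against the Schwartz function with transform
  \<open>exp (- (a - i (t - t0)) |\<xi> - \<eta>|\<^sup>2)\<close>, modulated such that all phases depending on \<open>\<xi>\<close> cancel: the
  pairing has modulus \<open>P = \<integral> B(\<xi>) exp (- a |\<xi> - \<eta>|\<^sup>2) d\<xi>\<close>, up to an explicit factor. The test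
  function is a complex Gaussian, so its modulus is a real Gaussian, of width about \<open>sqrt a\<close> as long
  as \<open>|t - t0| \<le> a\<close>. Hoelder's inequality shows that the \<open>L\<^sup>q\<close> norm at these times is at least
  \<open>c * P * a powr (d / (2 * q))\<close> with \<open>c\<close> depending only on \<open>d\<close> (\<open>evolution_slice_lower_bound\<close>). Only the action of the distribution on Schwartz functions enters,
  so that the bound holds for every function representing the solution.

  Bessel potential spaces. For \<open>B(\<xi>) = \<langle>\<xi>\<rangle>\<^sup>-\<^sup>s exp (- a |\<xi> - \<eta>|\<^sup>2)\<close> the function
  \<open>\<langle>D\<rangle>\<^sup>s f\<close> is an explicit Gaussian with known \<open>L\<^sup>r\<close> norm, and no bound for a Bessel potential is
  needed. With \<open>a = 1/2\<close>, \<open>t0 = 0\<close> and \<open>|\<eta>| \<rightarrow> \<infinity>\<close> this gives \<open>s \<ge> 0\<close>. With \<open>a = N\<^sup>-\<^sup>2/2\<close>, \<open>t0 = 1/2\<close>,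
  \<open>\<eta> = 0\<close> the solution focuses at the time \<open>1/2\<close>, and \<open>N \<rightarrow> \<infinity>\<close> gives
  \<open>s \<ge> d - d/q - 2/p - d/r\<close>. With \<open>a = N\<^sup>2/2\<close>, \<open>t0 = 0\<close>, \<open>\<eta> = 0\<close> the datum is a Gaussian of width
  \<open>N\<close>, which is almost stationary for \<open>|t| \<le> N\<^sup>2/2\<close>; a time interval of length \<open>1\<close> gives
  \<open>q \<ge> r\<close>, one of length \<open>N\<^sup>2\<close> gives \<open>2/p + d/q \<le> d/r\<close>.

  Modulation spaces. Here \<open>A = B\<close> is a sum of finitely many of the functions \<open>\<sigma>\<^sub>k\<close>. Only boundedly
  many products \<open>\<sigma>\<^sub>k \<sigma>\<^sub>j\<close> with fixed \<open>k\<close> do not vanish, and their inverse transforms are, up to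
  modulations, among finitely many rapidly decreasing functions, so that the norms of
  \<open>\<box>\<^sub>k f\<close> are uniformly bounded. A single block at frequency \<open>N\<close>, with \<open>a = 1/2\<close>, gives \<open>s \<ge> 0\<close>, and the sum of all
  blocks with \<open>|k\<^sub>i| \<le> N\<close>, with \<open>a = N\<^sup>-\<^sup>2\<close>, gives the other condition.

  The analytic tools are the Fourier transform of a Gaussian of complex width (by analytic
  continuation from the real case), the decay of the Fourier transform of a Schwartz
  function (by integration by parts), and the inversion formula.
\<close>


section \<open>The Fourier transform of complex Gaussians\<close>

lemma integrable_gaussian_real:
  assumes "0 < a"
  shows "integrable lborel (\<lambda>x::real. exp (- a * x\<^sup>2))"
proof -
  have "integrable lborel (\<lambda>x. sqrt (2 * pi * (1 / sqrt (2 * a))\<^sup>2) * normal_density 0 (1 / sqrt (2 * a)) x)"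
    using assms by (intro integrable_mult_right integrable_normal_density) simp
  also have "(\<lambda>x. sqrt (2 * pi * (1 / sqrt (2 * a))\<^sup>2) * normal_density 0 (1 / sqrt (2 * a)) x)
      = (\<lambda>x. exp (- a * x\<^sup>2))"
    using assms by (auto simp: normal_density_def fun_eq_iff power_divide)
  finally show ?thesis .
qed

lemma norm_exp_quadratic [simp]: "norm (exp (- (w * (complex_of_real x)\<^sup>2))) = exp (- (Re w * x\<^sup>2))"
proof -
  have "Re (w * (complex_of_real x)\<^sup>2) = Re w * x\<^sup>2" by (simp flip: of_real_power)
  then show ?thesis by (simp add: norm_exp_eq_Re)
qed

lemma integrable_gaussian_complex:
  assumes "0 < Re w"
  shows "integrable lborel (\<lambda>x::real. cis (x * \<xi>) * exp (- w * complex_of_real (x\<^sup>2)))"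
proof (rule Bochner_Integration.integrable_bound[OF integrable_gaussian_real[OF assms]])
  have "continuous_on UNIV (\<lambda>x::real. cis (x * \<xi>) * exp (- w * complex_of_real (x\<^sup>2)))"
    by (intro continuous_intros)
  then show "(\<lambda>x::real. cis (x * \<xi>) * exp (- w * complex_of_real (x\<^sup>2))) \<in> borel_measurable lborel"
    by (simp add: borel_measurable_continuous_onI)
qed (simp add: norm_mult)

lemma integral_gaussian_of_real_width:
  assumes "0 < (a::real)"
  shows "(LINT x|lborel. cis (x * \<xi>) * exp (- complex_of_real a * complex_of_real (x\<^sup>2)))
    = complex_of_real (sqrt pi) / csqrt (complex_of_real a) * exp (- complex_of_real (\<xi>\<^sup>2) / (4 * complex_of_real a))" (is "?I = _")
proof -
  define c where "c = sqrt (2 * a)"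
  have c: "c > 0" "c\<^sup>2 = 2 * a" using assms by (auto simp: c_def)
  have "complex_of_real (exp (- ((\<xi> / c)^2) / 2)) = char std_normal_distribution (\<xi> / c)"
    by (simp add: char_std_normal_distribution)
  also have "\<dots> = (LINT x|lborel. std_normal_density x *\<^sub>R cis ((\<xi> / c) * x))"
    unfolding char_def by (subst integral_density) (auto simp: cis_conv_exp)
  also have "\<dots> = \<bar>c\<bar> *\<^sub>R (LINT x|lborel. std_normal_density (0 + c * x) *\<^sub>R cis ((\<xi> / c) * (0 + c * x)))"
    using c by (intro lborel_integral_real_affine) auto
  also have "(\<lambda>x. std_normal_density (0 + c * x) *\<^sub>R cis ((\<xi> / c) * (0 + c * x))) =
     (\<lambda>x. complex_of_real (1 / sqrt (2 * pi)) * (cis (x * \<xi>) * exp (- complex_of_real a * complex_of_real (x\<^sup>2))))"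
    using c by (auto simp: std_normal_density_def scaleR_conv_of_real power_mult_distrib fun_eq_iff
        exp_of_real[symmetric] mult_ac)
  finally have "complex_of_real (exp (- ((\<xi> / c)^2) / 2)) =
     complex_of_real (c / sqrt (2 * pi)) * (LINT x|lborel. cis (x * \<xi>) * exp (- complex_of_real a * complex_of_real (x\<^sup>2)))"
    using c by (simp add: scaleR_conv_of_real)
  moreover have "c / sqrt (2 * pi) = sqrt a / sqrt pi"
    using assms by (simp add: c_def real_sqrt_mult)
  moreover have r: "csqrt (complex_of_real a) = complex_of_real (sqrt a)"
    using assms by (simp add: csqrt_of_real_nonneg)
  moreover have e: "exp (- complex_of_real (\<xi>\<^sup>2) / (4 * complex_of_real a)) = complex_of_real (exp (- ((\<xi> / c)^2) / 2))"
    using c by (simp add: exp_of_real[symmetric] power_divide)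
  ultimately have "complex_of_real (exp (- ((\<xi> / c)^2) / 2)) =
     complex_of_real (sqrt a) / complex_of_real (sqrt pi) * ?I"
    by (simp only: of_real_divide)
  then have "?I = complex_of_real (sqrt pi) / complex_of_real (sqrt a) * complex_of_real (exp (- ((\<xi> / c)^2) / 2))"
    using assms by (simp add: field_simps)
  then show ?thesis unfolding r e .
qed

text \<open>The integral is a locally uniform limit of integrals over \<open>[-n, n]\<close>.\<close>

lemma gaussian_integral_holomorphic:
  "(\<lambda>w. LINT x|lborel. cis (x * \<xi>) * exp (- w * complex_of_real (x\<^sup>2))) holomorphic_on {w. 0 < Re w}"
proof (rule holomorphic_uniform_sequence)
  let ?f = "\<lambda>w x. cis (x * \<xi>) * exp (- w * complex_of_real (x\<^sup>2))"
  show op: "open {w. 0 < Re w}" by (rule open_halfspace_Re_gt)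
  show "(\<lambda>w. integral (cbox (- real n) (real n)) (?f w)) holomorphic_on {w. 0 < Re w}" for n
  proof (rule leibniz_rule_holomorphic)
    show "((\<lambda>w. ?f w x) has_field_derivative (cis (x * \<xi>) * (- complex_of_real (x\<^sup>2) * exp (- w * complex_of_real (x\<^sup>2)))))
        (at w within {w. 0 < Re w})" for w x
      by (auto intro!: derivative_eq_intros)
    show "?f w integrable_on cbox (- real n) (real n)" for w
      by (intro integrable_continuous continuous_intros)
    show "continuous_on ({w. 0 < Re w} \<times> cbox (- real n) (real n))
       (\<lambda>(w, x). cis (x * \<xi>) * (- complex_of_real (x\<^sup>2) * exp (- w * complex_of_real (x\<^sup>2))))"
      by (auto simp: case_prod_unfold intro!: continuous_intros)
    show "convex {w. 0 < Re w}" by (rule convex_halfspace_Re_gt)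
  qed
  fix w assume w: "w \<in> {w. 0 < Re w}"
  then obtain d where d: "0 < d" "cball w d \<subseteq> {w. 0 < Re w}"
    using op open_contains_cball by blast
  define a where "a = Re w - d"
  have "w - of_real d \<in> cball w d" using d by (simp add: dist_norm)
  with d(2) have "w - of_real d \<in> {w. 0 < Re w}" by (rule subsetD)
  then have a: "0 < a" by (simp add: a_def)
  have re: "a \<le> Re v" if "v \<in> cball w d" for v
  proof -
    have "\<bar>Re (w - v)\<bar> \<le> d" using that abs_Re_le_cmod[of "w - v"] by (simp add: dist_norm)
    then show ?thesis by (simp add: a_def)
  qed
  define K where "K = (LINT x|lborel. exp (- (a/2) * (x::real)\<^sup>2))"
  have bound: "dist (integral (cbox (- real n) (real n)) (?f v)) (LINT x|lborel. ?f v x)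
      \<le> exp (- (a/2) * real n) * K" if v: "v \<in> cball w d" for n v
  proof -
    have rv: "0 < Re v" using re[OF v] a by simp
    have int: "integrable lborel (?f v)" by (rule integrable_gaussian_complex[OF rv])
    have sint: "set_integrable lborel S (?f v)" if "S \<in> sets borel" for S
      unfolding set_integrable_def by (rule integrable_mult_indicator) (use int that in auto)
    have "integral (cbox (- real n) (real n)) (?f v) = (LINT x:cbox (- real n) (real n)|lborel. ?f v x)"
      by (rule set_borel_integral_eq_integral(2)[symmetric, OF sint]) auto
    moreover have "(LINT x|lborel. ?f v x) =
       (LINT x:cbox (- real n) (real n)|lborel. ?f v x) + (LINT x:-cbox (- real n) (real n)|lborel. ?f v x)"
      using set_integral_Un[of "cbox (- real n) (real n)" "- cbox (- real n) (real n)" lborel "?f v"] sint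
      by (simp add: set_lebesgue_integral_def)
    ultimately have "dist (integral (cbox (- real n) (real n)) (?f v)) (LINT x|lborel. ?f v x)
       = norm (LINT x:-cbox (- real n) (real n)|lborel. ?f v x)"
      by (simp add: dist_norm)
    also have "\<dots> \<le> (LINT x|lborel. exp (- (a/2) * real n) * exp (- (a/2) * x\<^sup>2))"
      unfolding set_lebesgue_integral_def
    proof (rule Bochner_Integration.integral_norm_bound_integral)
      show "integrable lborel (\<lambda>x. indicat_real (- cbox (- real n) (real n)) x *\<^sub>R ?f v x)"
        using sint[of "- cbox (- real n) (real n)"] by (simp add: set_integrable_def)
      show "integrable lborel (\<lambda>x. exp (- (a/2) * real n) * exp (- (a/2) * x\<^sup>2))"
        using integrable_gaussian_real[of "a/2"] a by simp
      show "norm (indicat_real (- cbox (- real n) (real n)) x *\<^sub>R ?f v x)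
          \<le> exp (- (a/2) * real n) * exp (- (a/2) * x\<^sup>2)" for x
      proof (cases "x \<in> cbox (- real n) (real n)")
        case False
        then have "real n \<le> \<bar>x\<bar>" by auto
        then have "(real n)\<^sup>2 \<le> x\<^sup>2" using abs_le_square_iff[of "real n" x] by simp
        moreover have "real n \<le> (real n)\<^sup>2"
          by (cases n) (auto simp: power2_eq_square)
        ultimately have n: "real n \<le> x\<^sup>2" by linarith
        have "a * x\<^sup>2 \<le> Re v * x\<^sup>2" using re[OF v] by (intro mult_right_mono) auto
        moreover have "a * real n \<le> a * x\<^sup>2" using n a by simp
        ultimately have "- (Re v * x\<^sup>2) \<le> - (a/2) * real n + (- (a/2) * x\<^sup>2)"
          by (simp add: field_simps)
        then show ?thesis using False by (simp add: norm_mult flip: exp_add)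
      qed (auto simp: mult_nonneg_nonneg)
    qed
    finally show ?thesis by (simp add: K_def)
  qed
  have lim: "(\<lambda>n. exp (- (a/2) * real n) * K) \<longlonglongrightarrow> 0"
  proof -
    have "(\<lambda>n. exp (- (a/2)) ^ n) \<longlonglongrightarrow> 0" using a by (intro LIMSEQ_realpow_zero) auto
    then have "(\<lambda>n. exp (- (a/2) * real n)) \<longlonglongrightarrow> 0"
      by (simp only: exp_of_nat_mult[symmetric] mult.commute[of "- (a/2)"])
    then show ?thesis by (rule tendsto_mult_left_zero)
  qed
  have "uniform_limit (cball w d) (\<lambda>n v. integral (cbox (- real n) (real n)) (?f v))
     (\<lambda>v. LINT x|lborel. ?f v x) sequentially"
  proof (rule uniform_limitI)
    fix e :: real assume "0 < e"
    then have "\<forall>\<^sub>F n in sequentially. exp (- (a/2) * real n) * K < e"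
      using lim by (intro order_tendstoD(2)) auto
    then show "\<forall>\<^sub>F n in sequentially. \<forall>v\<in>cball w d.
         dist (integral (cbox (- real n) (real n)) (?f v)) (LINT x|lborel. ?f v x) < e"
      by eventually_elim (blast intro: le_less_trans bound)
  qed
  then show "\<exists>d>0. cball w d \<subseteq> {w. 0 < Re w} \<and>
     uniform_limit (cball w d) (\<lambda>n v. integral (cbox (- real n) (real n)) (?f v))
     (\<lambda>v. LINT x|lborel. ?f v x) sequentially"
    using d by (intro exI[of _ d] conjI)
qed

text \<open>Both sides are holomorphic in the half-plane and agree on the positive axis, where the
  formula is the characteristic function of a normal distribution.\<close>

lemma integral_gaussian_complex:
  assumes "0 < Re w"
  shows "(LINT x|lborel. cis (x * \<xi>) * exp (- w * complex_of_real (x\<^sup>2)))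
    = complex_of_real (sqrt pi) / csqrt w * exp (- complex_of_real (\<xi>\<^sup>2) / (4 * w))" (is "?F w = ?G w")
proof -
  let ?S = "{w. 0 < Re w}"
  have nn: "w \<notin> \<real>\<^sub>\<le>\<^sub>0" if "w \<in> ?S" for w
    using that by (auto simp: complex_nonpos_Reals_iff)
  have hol: "(\<lambda>w. ?F w - ?G w) holomorphic_on ?S"
    using nn by (intro holomorphic_intros gaussian_integral_holomorphic) auto
  have "(\<lambda>w. ?F w - ?G w) w = 0"
  proof (rule analytic_continuation[OF hol, of "complex_of_real ` {0<..}" 1])
    show "open ?S" by (rule open_halfspace_Re_gt)
    show "connected ?S" by (intro convex_connected convex_halfspace_Re_gt)
    show "complex_of_real ` {0<..} \<subseteq> ?S" by auto
    show "1 \<in> ?S" by simp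
    show "1 islimpt complex_of_real ` {0<..}"
      unfolding islimpt_approachable
    proof (intro allI impI)
      fix e :: real assume "0 < e"
      then have "complex_of_real (1 + e/2) \<in> complex_of_real ` {0<..}" "complex_of_real (1 + e/2) \<noteq> 1"
        "dist (complex_of_real (1 + e/2)) 1 < e"
        using norm_of_real[of "e/2", where 'a=complex] by (auto simp: dist_norm simp del: of_real_add) (simp add: norm_divide)
      then show "\<exists>x'\<in>complex_of_real ` {0<..}. x' \<noteq> 1 \<and> dist x' 1 < e" by blast
    qed
    show "?F z - ?G z = 0" if z: "z \<in> complex_of_real ` {0<..}" for z
    proof -
      obtain b where b: "0 < b" "z = complex_of_real b" using z by (auto simp: image_iff)
      show ?thesis unfolding b(2) integral_gaussian_of_real_width[OF b(1)] by (rule diff_self)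
    qed
    show "w \<in> ?S" using assms by simp
  qed
  then show ?thesis by simp
qed


subsection \<open>Integration over Cartesian space\<close>

lemma
  fixes f :: "'n::finite \<Rightarrow> real \<Rightarrow> 'b::{real_normed_field,banach,second_countable_topology}"
  assumes int: "\<And>i. integrable lborel (f i)"
  shows integrable_prod_vec: "integrable lborel (\<lambda>x::real^'n. \<Prod>i\<in>UNIV. f i (x $ i))"
    and integral_prod_vec: "(LINT x::real^'n|lborel. (\<Prod>i\<in>UNIV. f i (x $ i))) = (\<Prod>i\<in>UNIV. integral\<^sup>L lborel (f i))"
proof -
  interpret product_sigma_finite "\<lambda>_::real^'n. lborel :: real measure" ..
  have inj: "inj (\<lambda>i::'n. axis i (1::real))" by (auto simp: inj_on_def axis_eq_axis)
  have B: "(Basis :: (real^'n) set) = (\<lambda>i. axis i 1) ` UNIV" by (auto simp: Basis_vec_def)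
  define F where "F b = f (axis_index b)" for b :: "real^'n"
  have F: "F (axis i 1) = f i" for i by (simp add: F_def axis_index_axis)
  have meas [measurable]: "f i \<in> borel_measurable borel" for i
    using int[of i] by (simp add: borel_measurable_integrable)
  have eq: "(\<Prod>b\<in>Basis. F b (x b)) = (\<Prod>i\<in>UNIV. f i ((\<Sum>b\<in>Basis. x b *\<^sub>R b) $ i))" for x :: "real^'n \<Rightarrow> real"
  proof -
    have "(\<Sum>b\<in>Basis. x b *\<^sub>R b) $ i = x (axis i 1)" for i
    proof -
      have "(\<Sum>b\<in>Basis. x b *\<^sub>R b) $ i = (\<Sum>j\<in>UNIV. x (axis j 1) * (axis j 1 :: real^'n) $ i)"
        by (simp only: B sum.reindex[OF inj] sum_component o_def vector_scaleR_component real_scaleR_def)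
      also have "\<dots> = (\<Sum>j\<in>UNIV. if j = i then x (axis j 1) else 0)"
        by (intro sum.cong) (auto simp: axis_def)
      finally show ?thesis by simp
    qed
    then show ?thesis by (simp add: B prod.reindex[OF inj] F)
  qed
  have vi [measurable]: "(\<lambda>x::real^'n. x $ i) \<in> borel_measurable borel" for i
    by (intro borel_measurable_continuous_onI continuous_intros)
  have m [measurable]: "(\<lambda>x::real^'n. \<Prod>i\<in>UNIV. f i (x $ i)) \<in> borel_measurable borel"
    by measurable
  have T: "(\<lambda>f. \<Sum>b\<in>Basis. f b *\<^sub>R b) \<in> (\<Pi>\<^sub>M b\<in>Basis. lborel) \<rightarrow>\<^sub>M (borel :: (real^'n) measure)"
    by measurable
  show "integrable lborel (\<lambda>x::real^'n. \<Prod>i\<in>UNIV. f i (x $ i))"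
    unfolding lborel_eq[where 'a="real^'n"] integrable_distr_eq[OF T m] eq[symmetric]
    by (rule product_integrable_prod) (auto simp: F_def int)
  show "(LINT x::real^'n|lborel. (\<Prod>i\<in>UNIV. f i (x $ i))) = (\<Prod>i\<in>UNIV. integral\<^sup>L lborel (f i))"
    unfolding lborel_eq[where 'a="real^'n"] integral_distr[OF T m] eq[symmetric]
    by (subst product_integral_prod) (auto simp: F_def int B prod.reindex[OF inj] axis_index_axis)
qed

lemma integral_shift:
  fixes f :: "'a::euclidean_space \<Rightarrow> 'b::{banach,second_countable_topology}"
  assumes [measurable]: "f \<in> borel_measurable borel"
  shows "(LINT x|lborel. f (y + x)) = (LINT x|lborel. f x)"
  using integral_distr[of "(+) y" lborel borel f] by (simp add: lborel_distr_plus)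

lemma integrable_shift:
  fixes f :: "'a::euclidean_space \<Rightarrow> 'b::{banach,second_countable_topology}"
  assumes "integrable lborel f"
  shows "integrable lborel (\<lambda>x. f (y + x))"
  using integrable_distr_eq[of "(+) y" lborel borel f] assms by (simp add: lborel_distr_plus)

lemma integral_affine:
  fixes f :: "'a::euclidean_space \<Rightarrow> 'b::{banach,second_countable_topology}"
  assumes [measurable]: "f \<in> borel_measurable borel" and c: "c \<noteq> 0"
  shows "(LINT x|lborel. f x) = (LINT x|lborel. \<bar>c\<bar> ^ DIM('a) *\<^sub>R f (y + c *\<^sub>R x))"
  by (subst lborel_affine[OF c, of y])
     (simp add: integral_density integral_distr)

lemma cis_inner: "cis (x \<bullet> \<xi>) = (\<Prod>i\<in>UNIV. cis (x $ i * \<xi> $ i))" for x \<xi> :: "real^'n"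
  by (simp add: inner_vec_def cis_conv_exp exp_sum[symmetric] sum_distrib_left)

lemma norm_vec_squared: "(norm x)\<^sup>2 = (\<Sum>i\<in>UNIV. (x $ i)\<^sup>2)" for x :: "real^'n"
  by (simp only: power2_norm_eq_inner) (simp add: inner_vec_def power2_eq_square)

lemma exp_quadratic_vec:
  "exp (- w * complex_of_real ((norm x)\<^sup>2)) = (\<Prod>i\<in>UNIV. exp (- w * complex_of_real ((x $ i)\<^sup>2)))"
  for x :: "real^'n"
  unfolding norm_vec_squared of_real_sum sum_distrib_left by (simp add: exp_sum)

lemma
  fixes \<xi> :: "real^'n"
  assumes "0 < Re w"
  shows integrable_gaussian_vec:
      "integrable lborel (\<lambda>x. cis (x \<bullet> \<xi>) * exp (- w * complex_of_real ((norm x)\<^sup>2)))"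
    and integral_gaussian_vec:
      "(LINT x|lborel. cis (x \<bullet> \<xi>) * exp (- w * complex_of_real ((norm x)\<^sup>2)))
        = (complex_of_real (sqrt pi) / csqrt w) ^ CARD('n) * exp (- complex_of_real ((norm \<xi>)\<^sup>2) / (4 * w))"
proof -
  have eq: "cis (x \<bullet> \<xi>) * exp (- w * complex_of_real ((norm x)\<^sup>2))
     = (\<Prod>i\<in>UNIV. cis (x $ i * \<xi> $ i) * exp (- w * complex_of_real ((x $ i)\<^sup>2)))" for x :: "real^'n"
    by (simp only: cis_inner exp_quadratic_vec prod.distrib)
  show "integrable lborel (\<lambda>x. cis (x \<bullet> \<xi>) * exp (- w * complex_of_real ((norm x)\<^sup>2)))"
    unfolding eq by (rule integrable_prod_vec, rule integrable_gaussian_complex[OF assms])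
  have "(LINT x|lborel. cis (x \<bullet> \<xi>) * exp (- w * complex_of_real ((norm x)\<^sup>2)))
     = (\<Prod>i\<in>UNIV. complex_of_real (sqrt pi) / csqrt w * exp (- complex_of_real ((\<xi> $ i)\<^sup>2) / (4 * w)))"
    unfolding eq by (subst integral_prod_vec)
      (simp_all only: integrable_gaussian_complex[OF assms] integral_gaussian_complex[OF assms])
  also have "\<dots> = (complex_of_real (sqrt pi) / csqrt w) ^ CARD('n) *
      (\<Prod>i\<in>UNIV. exp (- (1 / (4 * w)) * complex_of_real ((\<xi> $ i)\<^sup>2)))"
    by (simp only: prod.distrib prod_constant) simp
  also have "\<dots> = (complex_of_real (sqrt pi) / csqrt w) ^ CARD('n) * exp (- complex_of_real ((norm \<xi>)\<^sup>2) / (4 * w))"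
    by (simp only: exp_quadratic_vec[symmetric]) simp
  finally show "(LINT x|lborel. cis (x \<bullet> \<xi>) * exp (- w * complex_of_real ((norm x)\<^sup>2)))
        = (complex_of_real (sqrt pi) / csqrt w) ^ CARD('n) * exp (- complex_of_real ((norm \<xi>)\<^sup>2) / (4 * w))" .
qed

lemma
  assumes "0 < a"
  shows integrable_gaussian_vec_real: "integrable lborel (\<lambda>x::real^'n. exp (- a * (norm x)\<^sup>2))"
    and integral_gaussian_vec_real: "(LINT x::real^'n|lborel. exp (- a * (norm x)\<^sup>2)) = (pi / a) powr (real CARD('n) / 2)"
proof -
  have eq: "(\<lambda>x::real^'n. cis (x \<bullet> 0) * exp (- complex_of_real a * complex_of_real ((norm x)\<^sup>2)))
     = (\<lambda>x. complex_of_real (exp (- a * (norm x)\<^sup>2)))"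
    by (simp add: exp_of_real[symmetric] fun_eq_iff)
  have i: "integrable lborel (\<lambda>x::real^'n. complex_of_real (exp (- a * (norm x)\<^sup>2)))"
    using integrable_gaussian_vec[of "complex_of_real a" "0::real^'n"] assms unfolding eq by simp
  show "integrable lborel (\<lambda>x::real^'n. exp (- a * (norm x)\<^sup>2))"
    using i by (simp only: complex_of_real_integrable_eq)
  have "complex_of_real (LINT x::real^'n|lborel. exp (- a * (norm x)\<^sup>2))
      = (complex_of_real (sqrt pi) / csqrt (complex_of_real a)) ^ CARD('n)"
    using integral_gaussian_vec[of "complex_of_real a" "0::real^'n"] assms unfolding eq
    by (simp only: integral_complex_of_real) simp
  also have "\<dots> = complex_of_real (sqrt (pi / a) ^ CARD('n))"
    using assms by (simp add: csqrt_of_real_nonneg real_sqrt_divide)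
  finally have "(LINT x::real^'n|lborel. exp (- a * (norm x)\<^sup>2)) = sqrt (pi / a) ^ CARD('n)"
    by (simp only: of_real_eq_iff)
  also have "\<dots> = (pi / a) powr (real CARD('n) / 2)"
    using assms by (simp add: powr_half_sqrt[symmetric] powr_realpow[symmetric] powr_powr)
  finally show "(LINT x::real^'n|lborel. exp (- a * (norm x)\<^sup>2)) = (pi / a) powr (real CARD('n) / 2)" .
qed

subsection \<open>The Fourier integral\<close>

lemma fourier_eq_inv_fourier: "fourier \<phi> \<xi> = inv_fourier \<phi> (- \<xi>)"
  by (simp add: fourier_def inv_fourier_def inner_commute)

lemma continuous_imp_borel [measurable (raw)]:
  "continuous_on UNIV f \<Longrightarrow> f \<in> borel_measurable (lborel :: 'a::euclidean_space measure)"
  by (simp add: borel_measurable_continuous_onI)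

lemma cis_inner_measurable [measurable]: "(\<lambda>x. cis (x \<bullet> \<xi>)) \<in> borel_measurable (borel :: (real^'n) measure)"
  by (intro borel_measurable_continuous_onI continuous_intros)

lemma integrable_cis_mult:
  fixes u :: "real^'n \<Rightarrow> complex"
  assumes "integrable lborel u"
  shows "integrable lborel (\<lambda>x. cis (x \<bullet> \<xi>) * u x)"
  by (rule Bochner_Integration.integrable_bound[OF assms])
     (use assms in \<open>auto simp: norm_mult intro!: borel_measurable_times\<close>)

lemma norm_inv_fourier_le:
  fixes u :: "real^'n \<Rightarrow> complex"
  assumes "integrable lborel u"
  shows "norm (inv_fourier u x) \<le> (2 * pi) powr (- real CARD('n) / 2) * (LINT \<xi>|lborel. norm (u \<xi>))"
proof -
  have "norm (LINT \<xi>|lborel. cis (x \<bullet> \<xi>) * u \<xi>) \<le> (LINT \<xi>|lborel. norm (cis (x \<bullet> \<xi>) * u \<xi>))"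
    by (rule integral_norm_bound)
  then show ?thesis by (simp add: inv_fourier_def norm_mult mult_left_mono)
qed

lemma integrable_kernel:
  fixes u v :: "real^'n \<Rightarrow> complex"
  assumes u: "integrable lborel u" and v: "integrable lborel v"
  shows "integrable (lborel \<Otimes>\<^sub>M lborel) (\<lambda>(x, \<xi>). cis (x \<bullet> \<xi>) * (u x * v \<xi>))"
proof (rule lborel_pair.Fubini_integrable)
  have [measurable]: "u \<in> borel_measurable borel" "v \<in> borel_measurable borel"
    using u v by (auto dest: borel_measurable_integrable)
  have "(\<lambda>z. cis (fst z \<bullet> snd z)) \<in> borel_measurable (borel :: ((real^'n) \<times> (real^'n)) measure)"
    by (intro borel_measurable_continuous_onI continuous_intros)
  then have [measurable]: "(\<lambda>z. cis (fst z \<bullet> snd z)) \<in> borel_measurable (borel \<Otimes>\<^sub>M borel :: ((real^'n) \<times> (real^'n)) measure)"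
    by (simp only: borel_prod)
  show "(\<lambda>(x, \<xi>). cis (x \<bullet> \<xi>) * (u x * v \<xi>)) \<in> borel_measurable (lborel \<Otimes>\<^sub>M lborel)"
    unfolding case_prod_beta by measurable
  show "integrable lborel (\<lambda>x. LINT y|lborel. norm (case (x, y) of (x, \<xi>) \<Rightarrow> cis (x \<bullet> \<xi>) * (u x * v \<xi>)))"
    using u by (simp add: norm_mult)
  show "AE x in lborel. integrable lborel (\<lambda>y. case (x, y) of (x, \<xi>) \<Rightarrow> cis (x \<bullet> \<xi>) * (u x * v \<xi>))"
  proof (rule AE_I2)
    fix x
    have "integrable lborel (\<lambda>y. u x * (cis (y \<bullet> x) * v y))"
      by (intro integrable_mult_right integrable_cis_mult v)
    then show "integrable lborel (\<lambda>y. case (x, y) of (x, \<xi>) \<Rightarrow> cis (x \<bullet> \<xi>) * (u x * v \<xi>))"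
      by (simp add: mult_ac inner_commute)
  qed
qed

lemma inv_fourier_measurable [measurable]:
  fixes u :: "real^'n \<Rightarrow> complex"
  assumes "integrable lborel u"
  shows "inv_fourier u \<in> borel_measurable borel"
proof -
  have [measurable]: "u \<in> borel_measurable borel"
    using assms by (auto dest: borel_measurable_integrable)
  have "(\<lambda>z. cis (fst z \<bullet> snd z)) \<in> borel_measurable (borel :: ((real^'n) \<times> (real^'n)) measure)"
    by (intro borel_measurable_continuous_onI continuous_intros)
  then have [measurable]: "(\<lambda>z. cis (fst z \<bullet> snd z)) \<in> borel_measurable (borel \<Otimes>\<^sub>M borel :: ((real^'n) \<times> (real^'n)) measure)"
    by (simp only: borel_prod)
  have "(\<lambda>x. LINT \<xi>|lborel. cis (x \<bullet> \<xi>) * u \<xi>) \<in> borel_measurable borel"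
    by (rule lborel.borel_measurable_lebesgue_integral) (simp add: case_prod_beta)
  then show ?thesis by (simp add: inv_fourier_def[abs_def])
qed

lemma inv_fourier_duality:
  fixes u v :: "real^'n \<Rightarrow> complex"
  assumes u: "integrable lborel u" and v: "integrable lborel v"
  shows "(LINT x|lborel. u x * inv_fourier v x) = (LINT \<xi>|lborel. inv_fourier u \<xi> * v \<xi>)"
proof -
  let ?c = "(2 * pi) powr (- real CARD('n) / 2)"
  have "(LINT x|lborel. u x * inv_fourier v x) = ?c *\<^sub>R (LINT x|lborel. LINT \<xi>|lborel. cis (x \<bullet> \<xi>) * (u x * v \<xi>))"
    by (simp add: inv_fourier_def mult_ac flip: integral_mult_right_zero integral_scaleR_right)
  also have "(LINT x|lborel. LINT \<xi>|lborel. cis (x \<bullet> \<xi>) * (u x * v \<xi>))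
      = (LINT \<xi>|lborel. LINT x|lborel. cis (x \<bullet> \<xi>) * (u x * v \<xi>))"
    by (rule lborel_pair.Fubini_integral[symmetric]) (rule integrable_kernel[OF u v])
  also have "?c *\<^sub>R \<dots> = (LINT \<xi>|lborel. inv_fourier u \<xi> * v \<xi>)"
    by (simp add: inv_fourier_def mult_ac inner_commute flip: integral_mult_right_zero integral_mult_left_zero integral_scaleR_right)
  finally show ?thesis .
qed

lemma integrable_reflect:
  fixes f :: "'a::euclidean_space \<Rightarrow> 'b::{banach,second_countable_topology}"
  assumes "integrable lborel f"
  shows "integrable lborel (\<lambda>x. f (- x))"
proof -
  have [measurable]: "f \<in> borel_measurable borel" using assms by (auto dest: borel_measurable_integrable)
  have "(lborel :: 'a measure) = distr lborel borel uminus"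
    using lborel_affine[of "-1" "0::'a"] by (simp add: density_1)
  then show ?thesis
    using integrable_distr_eq[of uminus lborel borel f] assms by simp
qed

lemma fourier_duality:
  fixes u v :: "real^'n \<Rightarrow> complex"
  assumes u: "integrable lborel u" and v: "integrable lborel v"
  shows "(LINT x|lborel. u x * fourier v x) = (LINT \<xi>|lborel. fourier u \<xi> * v \<xi>)"
proof -
  have refl: "(LINT x|lborel. f (- x)) = (LINT x|lborel. f x)" if "f \<in> borel_measurable borel" for f :: "real^'n \<Rightarrow> complex"
    using integral_affine[OF that, of "-1" 0] by simp
  have u': "integrable lborel (\<lambda>x. u (- x))"
    using u by (rule integrable_reflect)
  have [measurable]: "u \<in> borel_measurable borel" "v \<in> borel_measurable borel"
    "inv_fourier v \<in> borel_measurable borel" 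
    using u v inv_fourier_measurable[OF v] by (auto dest: borel_measurable_integrable)
  have "(LINT x|lborel. u x * fourier v x) = (LINT x|lborel. u (- x) * inv_fourier v x)"
    using refl[of "\<lambda>x. u (- x) * inv_fourier v x"] by (simp add: fourier_eq_inv_fourier)
  also have "\<dots> = (LINT \<xi>|lborel. inv_fourier (\<lambda>x. u (- x)) \<xi> * v \<xi>)"
    by (rule inv_fourier_duality[OF u' v])
  also have "inv_fourier (\<lambda>x. u (- x)) = fourier u"
  proof
    fix \<xi> :: "real^'n"
    have "(LINT x|lborel. cis (\<xi> \<bullet> x) * u (- x)) = (LINT x|lborel. cis (\<xi> \<bullet> - x) * u (- (- x)))"
      by (rule refl[symmetric]) (use cis_inner_measurable[of \<xi>] in \<open>simp add: inner_commute\<close>)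
    then show "inv_fourier (\<lambda>x. u (- x)) \<xi> = fourier u \<xi>"
      by (simp add: inv_fourier_def fourier_def inner_commute)
  qed
  finally show ?thesis .
qed

text \<open>The Gaussian \<open>exp (- w |\<xi> - \<eta>|\<^sup>2)\<close> of complex width, only meant for \<open>Re w > 0\<close>, centred at \<open>\<eta>\<close>
  and modulated by \<open>exp (i y \<bullet> \<xi>)\<close>. The Fourier integral maps this family to itself, up to factors.\<close>

definition gauss :: "complex \<Rightarrow> real^'n \<Rightarrow> real^'n \<Rightarrow> real^'n \<Rightarrow> complex" where
  "gauss w \<eta> y \<xi> = exp (- w * complex_of_real ((norm (\<xi> - \<eta>))\<^sup>2)) * cis (y \<bullet> \<xi>)"

lemma gauss_continuous: "continuous_on S (gauss w \<eta> y)"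
  unfolding gauss_def[abs_def] by (intro continuous_intros)

lemma norm_gauss: "norm (gauss w \<eta> y \<xi>) = exp (- Re w * (norm (\<xi> - \<eta>))\<^sup>2)"
  by (simp add: gauss_def norm_mult)

lemma integrable_gauss:
  assumes "0 < Re w"
  shows "integrable lborel (gauss w \<eta> (y :: real^'n))"
proof -
  have "integrable lborel (\<lambda>x::real^'n. exp (- Re w * (norm (- \<eta> + x))\<^sup>2))"
    by (rule integrable_shift[OF integrable_gaussian_vec_real[OF assms]])
  then show ?thesis
    by (rule Bochner_Integration.integrable_bound)
       (auto simp: norm_gauss intro!: borel_measurable_continuous_onI gauss_continuous)
qed

lemma inv_fourier_gauss:
  fixes y :: "real^'n"
  assumes w: "0 < Re w"
  shows "inv_fourier (gauss w \<eta> y) x =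
    (2 * pi) powr (- real CARD('n) / 2) *\<^sub>R (complex_of_real (sqrt pi) / csqrt w) ^ CARD('n)
      * cis (\<eta> \<bullet> y) * gauss (1 / (4 * w)) (- y) \<eta> x"
proof -
  let ?E = "\<lambda>x::real^'n. exp (- w * complex_of_real ((norm x)\<^sup>2))"
  have "(LINT \<xi>|lborel. cis (x \<bullet> \<xi>) * gauss w \<eta> y \<xi>) = (LINT \<xi>|lborel. cis (x \<bullet> (\<eta> + \<xi>)) * gauss w \<eta> y (\<eta> + \<xi>))"
    using borel_measurable_integrable[OF integrable_cis_mult[OF integrable_gauss[OF w]], of x \<eta> y]
    by (subst integral_shift) (auto simp: inner_commute)
  also have "(\<lambda>\<xi>. cis (x \<bullet> (\<eta> + \<xi>)) * gauss w \<eta> y (\<eta> + \<xi>)) = (\<lambda>\<xi>. cis ((x + y) \<bullet> \<eta>) * (cis (\<xi> \<bullet> (x + y)) * ?E \<xi>))"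
    by (simp add: gauss_def fun_eq_iff inner_simps inner_commute cis_mult mult_ac)
       (simp add: cis_mult algebra_simps flip: mult.assoc)
  also have "(LINT \<xi>|lborel. \<dots> \<xi>) = cis ((x + y) \<bullet> \<eta>) * ((complex_of_real (sqrt pi) / csqrt w) ^ CARD('n)
      * exp (- complex_of_real ((norm (x + y))\<^sup>2) / (4 * w)))"
    by (simp only: integral_mult_right_zero integral_gaussian_vec[OF w])
  finally show ?thesis
    by (simp add: inv_fourier_def gauss_def inner_simps inner_commute cis_mult[symmetric] mult_ac)
qed


section \<open>Schwartz functions\<close>

subsection \<open>Iterated partial derivatives\<close>

lemma partial_has_derivative:
  assumes "(f has_derivative D) (at x)"
  shows "partial i f x = D (axis i 1)"
  using frechet_derivative_at[OF assms] by (simp add: partial_def)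

lemma partial_eq_0_outside_closed:
  assumes "closed S" "\<And>x. x \<notin> S \<Longrightarrow> f x = 0" "x \<notin> S"
  shows "partial i f x = 0"
proof -
  have "(f has_derivative (\<lambda>_. 0)) (at x)"
  proof (rule has_derivative_transform_within_open)
    show "((\<lambda>_. 0) has_derivative (\<lambda>_. 0)) (at x)" by simp
    show "open (- S)" using assms by auto
  qed (use assms in auto)
  from partial_has_derivative[OF this] show ?thesis by simp
qed

lemma iter_partial_append: "iter_partial is (iter_partial js f) = iter_partial (is @ js) f"
  by (induction "is") auto

lemma closed_under_partial_smooth:
  assumes "f \<in> \<C>" "\<And>f x. f \<in> \<C> \<Longrightarrow> f differentiable (at x)" "\<And>f i. f \<in> \<C> \<Longrightarrow> partial i f \<in> \<C>"
  shows "iter_partial is f \<in> \<C>" "smooth f"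
proof -
  show *: "iter_partial is f \<in> \<C>" for "is" by (induction "is") (use assms in auto)
  show "smooth f" unfolding smooth_def using * assms(2) by blast
qed

lemma smooth_differentiable: "smooth f \<Longrightarrow> iter_partial is f differentiable (at x)"
  by (simp add: smooth_def)

lemma smooth_continuous: "smooth f \<Longrightarrow> continuous_on S (iter_partial is f)"
  by (intro continuous_at_imp_continuous_on ballI differentiable_imp_continuous_within smooth_differentiable)

text \<open>The algebra of functions generated by \<open>G\<close>. If the generators are differentiable and their
  partial derivatives lie in the algebra, then all its elements are smooth.\<close>

inductive_set generated_algebra :: "(real^'n \<Rightarrow> complex) set \<Rightarrow> (real^'n \<Rightarrow> complex) set" for G where
  base: "g \<in> G \<Longrightarrow> g \<in> generated_algebra G"
| add: "f \<in> generated_algebra G \<Longrightarrow> g \<in> generated_algebra G \<Longrightarrow> (\<lambda>x. f x + g x) \<in> generated_algebra G"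
| mult: "f \<in> generated_algebra G \<Longrightarrow> g \<in> generated_algebra G \<Longrightarrow> (\<lambda>x. f x * g x) \<in> generated_algebra G"

lemma generated_algebra_partial:
  assumes "f \<in> generated_algebra G"
    and diff: "\<And>g x. g \<in> G \<Longrightarrow> g differentiable (at x)"
    and part: "\<And>g i. g \<in> G \<Longrightarrow> partial i g \<in> generated_algebra G"
  shows "(\<forall>x. f differentiable (at x)) \<and> (\<forall>i. partial i f \<in> generated_algebra G)"
  using assms(1)
proof induction
  case (base g)
  then show ?case using diff part by blast
next
  case (add f g)
  have "partial i (\<lambda>x. f x + g x) = (\<lambda>x. partial i f x + partial i g x)" for i
  proof
    fix x
    have "((\<lambda>x. f x + g x) has_derivative
        (\<lambda>h. frechet_derivative f (at x) h + frechet_derivative g (at x) h)) (at x)"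
      using add.IH by (intro has_derivative_add) (auto simp: frechet_derivative_works[symmetric])
    from partial_has_derivative[OF this]
    show "partial i (\<lambda>x. f x + g x) x = partial i f x + partial i g x" by (simp add: partial_def)
  qed
  then show ?case using add.IH by (auto intro: generated_algebra.add)
next
  case (mult f g)
  have "partial i (\<lambda>x. f x * g x) = (\<lambda>x. f x * partial i g x + partial i f x * g x)" for i
  proof
    fix x
    have "((\<lambda>x. f x * g x) has_derivative
        (\<lambda>h. f x * frechet_derivative g (at x) h + frechet_derivative f (at x) h * g x)) (at x)"
      using mult.IH by (intro has_derivative_mult) (auto simp: frechet_derivative_works[symmetric])
    from partial_has_derivative[OF this]
    show "partial i (\<lambda>x. f x * g x) x = f x * partial i g x + partial i f x * g x" by (simp add: partial_def)
  qed
  then show ?case using mult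
    by (auto intro!: generated_algebra.add generated_algebra.mult)
qed

subsection \<open>Integrability and decay\<close>

text \<open>The decay of order \<open>2 d\<close> is more than needed, but it allows the comparison with the product of
  the one-dimensional functions \<open>1 / (1 + x\<^sub>i\<^sup>2)\<close>.\<close>

lemma integrable_decay: "integrable lborel (\<lambda>x::real^'n. 1 / (1 + norm x) ^ (2 * CARD('n)))"
proof -
  have "integrable lborel (\<lambda>x::real. inverse (1 + x\<^sup>2))"
    using integrable_inverse_1_plus_square
    by (simp add: set_integrable_def einterval_def)
  then have *: "integrable lborel (\<lambda>x::real^'n. \<Prod>i\<in>UNIV. inverse (1 + (x $ i)\<^sup>2))"
    by (rule integrable_prod_vec)
  show ?thesis
  proof (rule Bochner_Integration.integrable_bound[OF *])
    have "continuous_on UNIV (\<lambda>x::real^'n. 1 / (1 + norm x) ^ (2 * CARD('n)))"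
      by (intro continuous_intros) (auto simp: add_nonneg_eq_0_iff)
    then show "(\<lambda>x::real^'n. 1 / (1 + norm x) ^ (2 * CARD('n))) \<in> borel_measurable lborel"
      by (rule continuous_imp_borel)
    show "AE x in lborel. norm (1 / (1 + norm x) ^ (2 * CARD('n)))
        \<le> norm (\<Prod>i\<in>UNIV. inverse (1 + ((x::real^'n) $ i)\<^sup>2))"
    proof (rule AE_I2)
      fix x :: "real^'n"
      have "inverse ((1 + norm x)\<^sup>2) \<le> inverse (1 + (x $ i)\<^sup>2)" for i
      proof (rule le_imp_inverse_le)
        have "(x $ i)\<^sup>2 \<le> (norm x)\<^sup>2"
          using component_le_norm_cart[of x i] by (simp add: abs_le_square_iff[symmetric])
        moreover have "(1 + norm x)\<^sup>2 = 1 + 2 * norm x + (norm x)\<^sup>2" by (simp add: power2_sum)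
        ultimately show "1 + (x $ i)\<^sup>2 \<le> (1 + norm x)\<^sup>2" using norm_ge_zero[of x] by linarith
      qed (simp add: add_pos_nonneg)
      then have "(\<Prod>i\<in>(UNIV::'n set). inverse ((1 + norm x)\<^sup>2)) \<le> (\<Prod>i\<in>UNIV. inverse (1 + (x $ i)\<^sup>2))"
        by (intro prod_mono) auto
      moreover have "(\<Prod>i\<in>(UNIV::'n set). inverse ((1 + norm x)\<^sup>2)) = 1 / (1 + norm x) ^ (2 * CARD('n))"
        by (simp add: power_mult inverse_eq_divide power_one_over)
      moreover have "0 \<le> (\<Prod>i\<in>UNIV. inverse (1 + (x $ i)\<^sup>2))" by (intro prod_nonneg) auto
      ultimately show "norm (1 / (1 + norm x) ^ (2 * CARD('n))) \<le> norm (\<Prod>i\<in>UNIV. inverse (1 + (x $ i)\<^sup>2))"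
        by simp
    qed
  qed
qed

lemma integrable_of_decay:
  fixes f :: "real^'n \<Rightarrow> complex"
  assumes "f \<in> borel_measurable borel" "\<And>x. (1 + norm x) ^ (2 * CARD('n)) * norm (f x) \<le> C"
  shows "integrable lborel f"
proof (rule Bochner_Integration.integrable_bound[OF integrable_mult_right[OF integrable_decay, of C]])
  have "norm (f x) \<le> C * (1 / (1 + norm x) ^ (2 * CARD('n)))" for x
    using assms(2)[of x] by (simp add: field_simps add_pos_nonneg)
  then show "AE x in lborel. norm (f x) \<le> norm (C * (1 / (1 + norm x) ^ (2 * CARD('n))))"
    by (intro AE_I2) (smt (verit) real_norm_def)
qed (use assms in simp)

lemma schwartz_bound:
  assumes "\<phi> \<in> schwartz"
  obtains C where "\<And>x. (1 + norm x) ^ N * norm (iter_partial is \<phi> x) \<le> C"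
proof -
  have "bounded (range (\<lambda>x. (1 + norm x) ^ N *\<^sub>R iter_partial is \<phi> x))"
    using assms by (simp add: schwartz_def)
  then obtain C where "\<And>x. norm ((1 + norm x) ^ N *\<^sub>R iter_partial is \<phi> x) \<le> C"
    by (auto simp: bounded_iff)
  then show ?thesis using that[of C] by simp
qed

lemma schwartz_smooth: "\<phi> \<in> schwartz \<Longrightarrow> smooth \<phi>"
  by (simp add: schwartz_def)

lemma iter_partial_schwartz: "\<phi> \<in> schwartz \<Longrightarrow> iter_partial js \<phi> \<in> schwartz"
  by (simp add: schwartz_def smooth_def iter_partial_append)

lemma schwartz_continuous: "\<phi> \<in> schwartz \<Longrightarrow> continuous_on S \<phi>"
  using smooth_continuous[of \<phi> S "[]"] schwartz_smooth by auto

lemma schwartz_measurable: "\<phi> \<in> schwartz \<Longrightarrow> \<phi> \<in> borel_measurable borel"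
  by (intro borel_measurable_continuous_onI schwartz_continuous)

lemma schwartz_integrable:
  fixes \<phi> :: "real^'n \<Rightarrow> complex"
  assumes "\<phi> \<in> schwartz"
  shows "integrable lborel \<phi>"
proof -
  obtain C where "\<And>x. (1 + norm x) ^ (2 * CARD('n)) * norm (iter_partial [] \<phi> x) \<le> C"
    using schwartz_bound[OF assms] by blast
  then show ?thesis
    by (intro integrable_of_decay[of _ C]) (use assms in \<open>auto intro: schwartz_measurable\<close>)
qed

lemma norm_le_schwartz_norm:
  assumes "\<phi> \<in> schwartz"
  shows "norm (\<phi> x) \<le> schwartz_norm 0 \<phi>"
proof -
  obtain C where C: "\<And>x. (1 + norm x) ^ 0 * norm (iter_partial [] \<phi> x) \<le> C"
    using schwartz_bound[OF assms] by blast
  have "norm (\<phi> x) \<le> (SUP x. norm (\<phi> x))"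
    by (rule cSUP_upper) (use C in \<open>auto simp: bdd_above_def\<close>)
  moreover have "{is :: 'a list. length is \<le> 0} = {[]}" by auto
  ultimately show ?thesis by (simp add: schwartz_norm_def)
qed

text \<open>The increments of \<open>G\<close> over a unit segment are integrals of the partial derivative; both sides
  are integrated over all segments, and the integral of the increments vanishes by translation
  invariance.\<close>

lemma integral_partial_eq_0:
  fixes G :: "real^'n \<Rightarrow> complex"
  assumes diff: "\<And>x. G differentiable (at x)" and cont: "continuous_on UNIV (partial i G)"
    and int: "integrable lborel G" "integrable lborel (partial i G)"
  shows "(LINT x|lborel. partial i G x) = 0"
proof -
  let ?e = "axis i 1 :: real^'n" and ?D = "partial i G"
  have [measurable]: "?D \<in> borel_measurable borel"
    using cont by (rule borel_measurable_continuous_onI)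
  have gcont: "continuous_on UNIV G"
    by (intro continuous_at_imp_continuous_on ballI differentiable_imp_continuous_within diff)
  then have [measurable]: "G \<in> borel_measurable borel"
    by (rule borel_measurable_continuous_onI)
  have ftc: "(LINT \<tau>|lborel. indicator {0..1} \<tau> *\<^sub>R ?D (\<tau> *\<^sub>R ?e + x)) = G (?e + x) - G x" for x
  proof -
    have d: "((\<lambda>\<tau>. G (\<tau> *\<^sub>R ?e + x)) has_vector_derivative ?D (\<tau> *\<^sub>R ?e + x)) (at \<tau> within {0..1})" for \<tau>
    proof -
      have "(G has_derivative frechet_derivative G (at (\<tau> *\<^sub>R ?e + x))) (at (\<tau> *\<^sub>R ?e + x))"
        using diff frechet_derivative_works by blast
      moreover have "((\<lambda>\<tau>. \<tau> *\<^sub>R ?e + x) has_derivative (\<lambda>h. h *\<^sub>R ?e)) (at \<tau> within {0..1})"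
        by (auto intro!: derivative_eq_intros)
      ultimately have "((\<lambda>\<tau>. G (\<tau> *\<^sub>R ?e + x)) has_derivative
          (\<lambda>h. frechet_derivative G (at (\<tau> *\<^sub>R ?e + x)) (h *\<^sub>R ?e))) (at \<tau> within {0..1})"
        by (rule has_derivative_compose[rotated])
      moreover have "linear (frechet_derivative G (at (\<tau> *\<^sub>R ?e + x)))"
        using diff by (rule linear_frechet_derivative)
      ultimately show ?thesis
        by (simp add: has_vector_derivative_def partial_def linear_scale)
    qed
    have "continuous_on {0..1} (\<lambda>\<tau>. ?D (\<tau> *\<^sub>R ?e + x))"
      by (intro continuous_on_compose2[OF cont] continuous_intros) auto
    from has_bochner_integral_FTC_Icc[OF zero_le_one d this]
    show ?thesis by (simp add: has_bochner_integral_iff)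
  qed
  have eq: "(LINT x|lborel. ?D (\<tau> *\<^sub>R ?e + x)) = (LINT x|lborel. ?D x)" for \<tau>
    by (rule integral_shift) measurable
  have "integrable (lborel \<Otimes>\<^sub>M lborel) (\<lambda>(\<tau>, x). indicator {0..1::real} \<tau> *\<^sub>R ?D (\<tau> *\<^sub>R ?e + x))"
  proof (rule lborel_pair.Fubini_integrable)
    have "continuous_on UNIV (\<lambda>z::real\<times>(real^'n). ?D (fst z *\<^sub>R ?e + snd z))"
      by (intro continuous_on_compose2[OF cont] continuous_intros) auto
    then have "(\<lambda>z::real\<times>(real^'n). ?D (fst z *\<^sub>R ?e + snd z)) \<in> borel_measurable (borel \<Otimes>\<^sub>M borel)"
      unfolding borel_prod by (rule borel_measurable_continuous_onI)
    then show "(\<lambda>(\<tau>, x). indicator {0..1::real} \<tau> *\<^sub>R ?D (\<tau> *\<^sub>R ?e + x)) \<in> borel_measurable (lborel \<Otimes>\<^sub>M lborel)"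
      unfolding case_prod_beta by measurable
    have n: "(LINT x|lborel. norm (?D (\<tau> *\<^sub>R ?e + x))) = (LINT x|lborel. norm (?D x))" for \<tau>
      by (rule integral_shift) measurable
    show "integrable lborel (\<lambda>\<tau>. LINT x|lborel. norm (case (\<tau>, x) of (\<tau>, x) \<Rightarrow> indicator {0..1::real} \<tau> *\<^sub>R ?D (\<tau> *\<^sub>R ?e + x)))"
      by (simp add: n)
    show "AE \<tau> in lborel. integrable lborel (\<lambda>x. case (\<tau>, x) of (\<tau>, x) \<Rightarrow> indicator {0..1::real} \<tau> *\<^sub>R ?D (\<tau> *\<^sub>R ?e + x))"
      by (auto intro!: AE_I2 integrable_shift int)
  qed
  from lborel_pair.Fubini_integral[OF this]
  have "(LINT x|lborel. LINT \<tau>|lborel. indicator {0..1::real} \<tau> *\<^sub>R ?D (\<tau> *\<^sub>R ?e + x))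
     = (LINT \<tau>|lborel. indicator {0..1::real} \<tau> *\<^sub>R (LINT x|lborel. ?D x))"
    by (simp add: eq)
  also have "\<dots> = (LINT x|lborel. ?D x)" by simp
  also have "(LINT x|lborel. LINT \<tau>|lborel. indicator {0..1::real} \<tau> *\<^sub>R ?D (\<tau> *\<^sub>R ?e + x))
     = (LINT x|lborel. G (?e + x)) - (LINT x|lborel. G x)"
    unfolding ftc by (intro Bochner_Integration.integral_diff integrable_shift int)
  also have "\<dots> = 0" by (simp add: integral_shift)
  finally show ?thesis by simp
qed

lemma inv_fourier_partial:
  fixes \<phi> :: "real^'n \<Rightarrow> complex"
  assumes \<phi>: "\<phi> \<in> schwartz"
  shows "inv_fourier (partial i \<phi>) \<xi> = - \<i> * of_real (\<xi> $ i) * inv_fourier \<phi> \<xi>"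
proof -
  let ?G = "\<lambda>x. cis (x \<bullet> \<xi>) * \<phi> x"
  have p: "partial i \<phi> \<in> schwartz" using iter_partial_schwartz[OF \<phi>, of "[i]"] by simp
  have d\<phi>: "(\<phi> has_derivative frechet_derivative \<phi> (at x)) (at x)" for x
    using smooth_differentiable[OF schwartz_smooth[OF \<phi>], of "[]"] by (simp add: frechet_derivative_works)
  have dcis: "((\<lambda>x. cis (x \<bullet> \<xi>)) has_derivative (\<lambda>h. (h \<bullet> \<xi>) *\<^sub>R (\<i> * cis (x \<bullet> \<xi>)))) (at x)" for x :: "real^'n"
  proof -
    have "((\<lambda>x. x \<bullet> \<xi>) has_derivative (\<lambda>h. h \<bullet> \<xi>)) (at x)"
      by (auto intro!: derivative_eq_intros)
    moreover have "(cis has_derivative (\<lambda>h. h *\<^sub>R (\<i> * cis (x \<bullet> \<xi>)))) (at (x \<bullet> \<xi>))"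
    proof -
      have "((\<lambda>t. exp (\<i> * of_real t)) has_vector_derivative \<i> * exp (\<i> * of_real (x \<bullet> \<xi>))) (at (x \<bullet> \<xi>))"
        by (rule has_vector_derivative_real_field) (auto intro!: derivative_eq_intros)
      then show ?thesis by (simp add: has_vector_derivative_def cis_conv_exp[abs_def])
    qed
    ultimately show ?thesis by (rule has_derivative_compose)
  qed
  have dG: "(?G has_derivative (\<lambda>h. cis (x \<bullet> \<xi>) * frechet_derivative \<phi> (at x) h +
      (h \<bullet> \<xi>) *\<^sub>R (\<i> * cis (x \<bullet> \<xi>)) * \<phi> x)) (at x)" for x
    by (rule has_derivative_mult[OF dcis d\<phi>])
  have pG: "partial i ?G = (\<lambda>x. cis (x \<bullet> \<xi>) * partial i \<phi> x + (\<i> * of_real (\<xi> $ i)) * (cis (x \<bullet> \<xi>) * \<phi> x))"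
    by (rule ext, subst partial_has_derivative[OF dG])
       (simp add: partial_def inner_axis' scaleR_conv_of_real mult_ac)
  have i1: "integrable lborel (\<lambda>x. cis (x \<bullet> \<xi>) * partial i \<phi> x)" "integrable lborel ?G"
    by (intro integrable_cis_mult schwartz_integrable p \<phi>)+
  have "(LINT x|lborel. partial i ?G x) = 0"
  proof (rule integral_partial_eq_0)
    show "?G differentiable (at x)" for x using dG differentiable_def by blast
    show "continuous_on UNIV (partial i ?G)"
      unfolding pG by (intro continuous_intros schwartz_continuous p \<phi>)
    show "integrable lborel ?G" by (rule i1)
    show "integrable lborel (partial i ?G)"
      unfolding pG by (intro Bochner_Integration.integrable_add integrable_mult_right i1)
  qed
  then have "(LINT x|lborel. cis (x \<bullet> \<xi>) * partial i \<phi> x) + (\<i> * of_real (\<xi> $ i)) * (LINT x|lborel. ?G x) = 0"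
    unfolding pG by (subst (asm) Bochner_Integration.integral_add) (use i1 in auto)
  then have "(LINT x|lborel. cis (x \<bullet> \<xi>) * partial i \<phi> x) = - (\<i> * of_real (\<xi> $ i)) * (LINT x|lborel. ?G x)"
    by (simp add: eq_neg_iff_add_eq_0)
  then show ?thesis by (simp add: inv_fourier_def inner_commute)
qed

lemma schwartz_inv_fourier_decay:
  fixes \<phi> :: "real^'n \<Rightarrow> complex"
  assumes \<phi>: "\<phi> \<in> schwartz"
  obtains C where "\<And>\<xi>. (1 + norm \<xi>) ^ k * norm (inv_fourier \<phi> \<xi>) \<le> C"
proof -
  have it: "inv_fourier (iter_partial (replicate m i) \<phi>) \<xi> = (- \<i> * of_real (\<xi> $ i)) ^ m * inv_fourier \<phi> \<xi>" for m i \<xi>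
    by (induction m) (simp_all add: inv_fourier_partial iter_partial_schwartz \<phi>)
  define B where "B m i = (2 * pi) powr (- real CARD('n) / 2) * (LINT x|lborel. norm (iter_partial (replicate m i) \<phi> x))" for m i
  have B: "\<bar>\<xi> $ i\<bar> ^ m * norm (inv_fourier \<phi> \<xi>) \<le> B m i" for m i \<xi>
  proof -
    have "norm (inv_fourier (iter_partial (replicate m i) \<phi>) \<xi>) \<le> B m i"
      unfolding B_def by (intro norm_inv_fourier_le schwartz_integrable iter_partial_schwartz \<phi>)
    then show ?thesis by (simp add: it norm_mult norm_power)
  qed
  let ?d = "real CARD('n)"
  \<comment> \<open>\<open>B 0 i\<close> bounds the transform of \<open>\<phi>\<close> itself and does not depend on the index \<open>i\<close>\<close>
  have main: "(1 + norm \<xi>) ^ k * norm (inv_fourier \<phi> \<xi>) \<le> (1 + ?d) ^ k * (B 0 undefined + (\<Sum>i\<in>UNIV. B k i))" for \<xi>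
  proof -
    have n: "norm \<xi> \<le> (\<Sum>i\<in>UNIV. \<bar>\<xi> $ i\<bar>)" by (rule norm_le_l1_cart)
    obtain j where j: "\<And>i. \<bar>\<xi> $ i\<bar> \<le> \<bar>\<xi> $ j\<bar>"
    proof -
      have "Max (range (\<lambda>i. \<bar>\<xi> $ i\<bar>)) \<in> range (\<lambda>i. \<bar>\<xi> $ i\<bar>)" by (rule Max_in) auto
      then obtain j where "Max (range (\<lambda>i. \<bar>\<xi> $ i\<bar>)) = \<bar>\<xi> $ j\<bar>" by blast
      then show ?thesis using that[of j] by (metis Max_ge finite finite_imageI rangeI)
    qed
    define M where "M = max 1 \<bar>\<xi> $ j\<bar>"
    have "(\<Sum>i\<in>UNIV. \<bar>\<xi> $ i\<bar>) \<le> ?d * M"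
      by (rule sum_bounded_above) (use j in \<open>auto simp: M_def intro: le_max_iff_disj[THEN iffD2]\<close>)
    then have "1 + norm \<xi> \<le> (1 + ?d) * M" using n by (simp add: M_def algebra_simps)
    then have "(1 + norm \<xi>) ^ k \<le> (1 + ?d) ^ k * M ^ k"
      using power_mono[of "1 + norm \<xi>" "(1 + ?d) * M" k] by (simp add: power_mult_distrib)
    moreover have "M ^ k \<le> 1 + \<bar>\<xi> $ j\<bar> ^ k"
      by (cases "\<bar>\<xi> $ j\<bar> \<le> 1") (auto simp: M_def max_def)
    ultimately have "(1 + norm \<xi>) ^ k \<le> (1 + ?d) ^ k * (1 + \<bar>\<xi> $ j\<bar> ^ k)"
      by (smt (verit) mult_left_mono of_nat_0_le_iff zero_le_power)
    then have "(1 + norm \<xi>) ^ k * norm (inv_fourier \<phi> \<xi>) \<le> (1 + ?d) ^ k * (1 + \<bar>\<xi> $ j\<bar> ^ k) * norm (inv_fourier \<phi> \<xi>)"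
      by (rule mult_right_mono) simp
    also have "\<dots> = (1 + ?d) ^ k * (norm (inv_fourier \<phi> \<xi>) + \<bar>\<xi> $ j\<bar> ^ k * norm (inv_fourier \<phi> \<xi>))"
      by (simp add: algebra_simps)
    also have "\<dots> \<le> (1 + ?d) ^ k * (B 0 undefined + (\<Sum>i\<in>UNIV. B k i))"
    proof (intro mult_left_mono add_mono)
      show "norm (inv_fourier \<phi> \<xi>) \<le> B 0 undefined" using B[of \<xi> undefined 0] by simp
      have "B k j \<le> (\<Sum>i\<in>UNIV. B k i)" by (rule member_le_sum) (auto simp: B_def)
      then show "\<bar>\<xi> $ j\<bar> ^ k * norm (inv_fourier \<phi> \<xi>) \<le> (\<Sum>i\<in>UNIV. B k i)" using B[of \<xi> j k] by simp
    qed simp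
    finally show ?thesis .
  qed
  show ?thesis by (rule that[OF main])
qed

lemma schwartz_inv_fourier_integrable:
  fixes \<phi> :: "real^'n \<Rightarrow> complex"
  assumes \<phi>: "\<phi> \<in> schwartz"
  shows "integrable lborel (inv_fourier \<phi>)"
proof -
  obtain C where "\<And>\<xi>. (1 + norm \<xi>) ^ (2 * CARD('n)) * norm (inv_fourier \<phi> \<xi>) \<le> C"
    using schwartz_inv_fourier_decay[OF \<phi>] by blast
  then show ?thesis
    by (intro integrable_of_decay[of _ C] inv_fourier_measurable schwartz_integrable \<phi>)
qed

lemma schwartz_inv_fourier_integrable_mult:
  fixes \<phi> :: "real^'n \<Rightarrow> complex"
  assumes \<phi>: "\<phi> \<in> schwartz" and m: "m \<in> borel_measurable borel" and M: "\<And>\<xi>. norm (m \<xi>) \<le> K * (1 + norm \<xi>) ^ k"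
  shows "integrable lborel (\<lambda>\<xi>. m \<xi> * inv_fourier \<phi> \<xi>)"
proof -
  obtain C where C: "\<And>\<xi>. (1 + norm \<xi>) ^ (k + 2 * CARD('n)) * norm (inv_fourier \<phi> \<xi>) \<le> C"
    using schwartz_inv_fourier_decay[OF \<phi>] by blast
  have K: "0 \<le> K" using order_trans[OF norm_ge_zero M[of 0]] by simp
  show ?thesis
  proof (rule integrable_of_decay[of _ "K * C"])
    show "(\<lambda>\<xi>. m \<xi> * inv_fourier \<phi> \<xi>) \<in> borel_measurable borel"
      by (intro borel_measurable_times m inv_fourier_measurable schwartz_integrable \<phi>)
    fix \<xi>
    have "(1 + norm \<xi>) ^ (2 * CARD('n)) * norm (m \<xi> * inv_fourier \<phi> \<xi>)
      \<le> (1 + norm \<xi>) ^ (2 * CARD('n)) * (K * (1 + norm \<xi>) ^ k * norm (inv_fourier \<phi> \<xi>))"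
      unfolding norm_mult by (intro mult_left_mono mult_right_mono M) auto
    also have "\<dots> = K * ((1 + norm \<xi>) ^ (k + 2 * CARD('n)) * norm (inv_fourier \<phi> \<xi>))"
      by (simp add: power_add mult_ac)
    also have "\<dots> \<le> K * C" by (intro mult_left_mono C K)
    finally show "(1 + norm \<xi>) ^ (2 * CARD('n)) * norm (m \<xi> * inv_fourier \<phi> \<xi>) \<le> K * C" .
  qed
qed


subsection \<open>Gaussians with polynomially bounded factors\<close>

text \<open>The symbols built from polynomials and real powers of \<open>1 + |x|\<^sup>2\<close>.\<close>

definition symbols :: "(real^'n \<Rightarrow> complex) set" where
  "symbols = generated_algebra
     (range (\<lambda>c x. c) \<union> range (\<lambda>i x. complex_of_real (x $ i)) \<union>
      range (\<lambda>a x. complex_of_real ((1 + (norm x)\<^sup>2) powr a)))"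

lemma symbols_const: "(\<lambda>x. c) \<in> symbols"
  unfolding symbols_def by (rule generated_algebra.base) auto

lemma symbols_coord: "(\<lambda>x. complex_of_real (x $ i)) \<in> symbols"
  unfolding symbols_def by (rule generated_algebra.base) auto

lemma symbols_powr: "(\<lambda>x. complex_of_real ((1 + (norm x)\<^sup>2) powr a)) \<in> symbols"
  unfolding symbols_def by (rule generated_algebra.base) auto

lemma symbols_add: "f \<in> symbols \<Longrightarrow> g \<in> symbols \<Longrightarrow> (\<lambda>x. f x + g x) \<in> symbols"
  unfolding symbols_def by (rule generated_algebra.add)

lemma symbols_mult: "f \<in> symbols \<Longrightarrow> g \<in> symbols \<Longrightarrow> (\<lambda>x. f x * g x) \<in> symbols"
  unfolding symbols_def by (rule generated_algebra.mult)

lemma has_derivative_bracket_powr: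
  fixes x :: "real^'n"
  shows "((\<lambda>x. complex_of_real ((1 + (norm x)\<^sup>2) powr a)) has_derivative
    (\<lambda>h. complex_of_real (2 * (x \<bullet> h) * (a * (1 + (norm x)\<^sup>2) powr (a - 1))))) (at x)"
proof -
  have pos: "0 < 1 + x \<bullet> x" by (simp add: add_pos_nonneg)
  have "((\<lambda>x. 1 + x \<bullet> x) has_derivative (\<lambda>h. 2 * (x \<bullet> h))) (at x)"
    by (auto intro!: derivative_eq_intros simp: inner_commute)
  moreover have "((\<lambda>t. t powr a) has_derivative (\<lambda>h. h * (a * (1 + x \<bullet> x) powr (a - 1)))) (at (1 + x \<bullet> x))"
    using has_real_derivative_powr[OF pos, of a] by (simp only: has_field_derivative_def mult_commute_abs)
  ultimately have "((\<lambda>x. (1 + x \<bullet> x) powr a) has_derivative (\<lambda>h. (2 * (x \<bullet> h)) * (a * (1 + x \<bullet> x) powr (a - 1)))) (at x)"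
    by (rule has_derivative_compose)
  from has_derivative_of_real[OF this, where 'a=complex] show ?thesis
    unfolding power2_norm_eq_inner .
qed

lemma symbols_partial:
  fixes u :: "real^'n \<Rightarrow> complex"
  assumes "u \<in> symbols"
  shows "(\<forall>x. u differentiable (at x)) \<and> (\<forall>i. partial i u \<in> symbols)"
  using assms unfolding symbols_def
proof (rule generated_algebra_partial, fold symbols_def)
  fix g :: "real^'n \<Rightarrow> complex" and x i
  have c: "((\<lambda>x::real^'n. c) has_derivative (\<lambda>_. 0)) (at x)" for c :: complex and x by simp
  have e: "((\<lambda>x::real^'n. complex_of_real (x $ j)) has_derivative (\<lambda>h. complex_of_real (h $ j))) (at x)" for j x
    by (auto intro!: derivative_eq_intros bounded_linear_imp_has_derivative bounded_linear_vec_nth bounded_linear_compose[OF bounded_linear_of_real])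
  assume "g \<in> range (\<lambda>c x. c) \<union> range (\<lambda>i x. complex_of_real (x $ i)) \<union>
      range (\<lambda>a x. complex_of_real ((1 + (norm x)\<^sup>2) powr a))"
  then consider (1) c where "g = (\<lambda>x. c)" | (2) j where "g = (\<lambda>x. complex_of_real (x $ j))"
    | (3) a where "g = (\<lambda>x. complex_of_real ((1 + (norm x)\<^sup>2) powr a))" by auto
  note cases = this
  from cases show "g differentiable (at x)"
    by cases (use c e has_derivative_bracket_powr in \<open>blast intro: differentiableI\<close>)+
  from cases show "partial i g \<in> symbols"
  proof cases
    case (1 c)
    then have "partial i g = (\<lambda>x. 0)" using partial_has_derivative[OF c] by auto
    then show ?thesis using symbols_const by simp
  next
    case (2 j)
    then have "partial i g = (\<lambda>x. complex_of_real (axis i 1 $ j))" using partial_has_derivative[OF e] by auto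
    then show ?thesis using symbols_const by simp
  next
    case (3 a)
    have "partial i g = (\<lambda>x. complex_of_real (2 * a) * (complex_of_real (x $ i) * complex_of_real ((1 + (norm x)\<^sup>2) powr (a - 1))))"
      unfolding 3 by (rule ext, subst partial_has_derivative[OF has_derivative_bracket_powr]) (simp add: inner_axis mult_ac)
    then show ?thesis by (simp add: symbols_mult symbols_const symbols_coord symbols_powr)
  qed
qed

lemma symbols_growth:
  fixes u :: "real^'n \<Rightarrow> complex"
  assumes "u \<in> symbols"
  shows "\<exists>K k. \<forall>x. norm (u x) \<le> K * (1 + norm x) ^ k"
  using assms unfolding symbols_def
proof induction
  case (base g)
  then consider (1) c where "g = (\<lambda>x. c)" | (2) j where "g = (\<lambda>x. complex_of_real (x $ j))"
    | (3) a where "g = (\<lambda>x. complex_of_real ((1 + (norm x)\<^sup>2) powr a))" by auto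
  then show ?case
  proof cases
    case (1 c)
    then show ?thesis by (intro exI[of _ "norm c"] exI[of _ 0]) auto
  next
    case (2 j)
    then show ?thesis
      by (intro exI[of _ 1] exI[of _ 1]) (auto simp: add_increasing component_le_norm_cart)
  next
    case (3 a)
    have "(1 + (norm x)\<^sup>2) powr a \<le> (1 + norm x) ^ (2 * nat \<lceil>\<bar>a\<bar>\<rceil>)" for x :: "real^'n"
    proof -
      have "(1 + (norm x)\<^sup>2) powr a \<le> (1 + (norm x)\<^sup>2) powr real (nat \<lceil>\<bar>a\<bar>\<rceil>)"
        by (intro powr_mono) (auto, linarith)
      also have "\<dots> = (1 + (norm x)\<^sup>2) ^ nat \<lceil>\<bar>a\<bar>\<rceil>"
        by (rule powr_realpow) (simp add: add_pos_nonneg)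
      also have "\<dots> \<le> ((1 + norm x)\<^sup>2) ^ nat \<lceil>\<bar>a\<bar>\<rceil>"
        by (intro power_mono) (auto simp: power2_sum)
      finally show ?thesis by (simp add: power_mult)
    qed
    then show ?thesis using 3
      by (intro exI[of _ 1] exI[of _ "2 * nat \<lceil>\<bar>a\<bar>\<rceil>"]) simp
  qed
next
  case (add f g)
  then obtain K k L l where f: "\<And>x. norm (f x) \<le> K * (1 + norm x) ^ k" and g: "\<And>x. norm (g x) \<le> L * (1 + norm x) ^ l"
    by blast
  have "norm (f x + g x) \<le> (\<bar>K\<bar> + \<bar>L\<bar>) * (1 + norm x) ^ (k + l)" for x
  proof -
    have "norm (f x + g x) \<le> \<bar>K\<bar> * (1 + norm x) ^ k + \<bar>L\<bar> * (1 + norm x) ^ l"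
      using f[of x] g[of x] norm_triangle_ineq[of "f x" "g x"]
        mult_right_mono[OF abs_ge_self[of K], of "(1 + norm x) ^ k"] mult_right_mono[OF abs_ge_self[of L], of "(1 + norm x) ^ l"]
      by (smt (verit) norm_ge_zero zero_le_power)
    also have "\<dots> \<le> \<bar>K\<bar> * (1 + norm x) ^ (k + l) + \<bar>L\<bar> * (1 + norm x) ^ (k + l)"
      by (intro add_mono mult_left_mono power_increasing) auto
    finally show ?thesis by (simp add: algebra_simps)
  qed
  then show ?case by blast
next
  case (mult f g)
  then obtain K k L l where f: "\<And>x. norm (f x) \<le> K * (1 + norm x) ^ k" and g: "\<And>x. norm (g x) \<le> L * (1 + norm x) ^ l"
    by blast
  have "norm (f x * g x) \<le> (K * L) * (1 + norm x) ^ (k + l)" for x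
  proof -
    have "norm (f x * g x) \<le> (K * (1 + norm x) ^ k) * (L * (1 + norm x) ^ l)"
      unfolding norm_mult using order_trans[OF norm_ge_zero f[of x]] by (intro mult_mono f g) auto
    then show ?thesis by (simp add: power_add mult_ac)
  qed
  then show ?case by blast
qed

lemma has_derivative_gauss:
  fixes x :: "real^'n"
  shows "(gauss w \<eta> y has_derivative
    (\<lambda>h. (- w * complex_of_real (2 * ((x - \<eta>) \<bullet> h)) + \<i> * complex_of_real (y \<bullet> h)) * gauss w \<eta> y x)) (at x)"
proof -
  have E: "gauss w \<eta> y = (\<lambda>x. exp (- w * complex_of_real ((x - \<eta>) \<bullet> (x - \<eta>)) + \<i> * complex_of_real (y \<bullet> x)))"
    by (auto simp: gauss_def fun_eq_iff cis_conv_exp power2_norm_eq_inner mult_exp_exp)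
  have "((\<lambda>x. - w * complex_of_real ((x - \<eta>) \<bullet> (x - \<eta>)) + \<i> * complex_of_real (y \<bullet> x)) has_derivative
    (\<lambda>h. - w * complex_of_real (2 * ((x - \<eta>) \<bullet> h)) + \<i> * complex_of_real (y \<bullet> h))) (at x)"
    by (auto intro!: derivative_eq_intros simp: inner_commute)
  moreover have "(exp has_derivative (\<lambda>h. h * exp z)) (at z)" for z :: complex
    using DERIV_exp[of z] by (simp only: has_field_derivative_def mult_commute_abs)
  ultimately show ?thesis
    unfolding E by (rule has_derivative_compose)
qed

lemma gauss_decay:
  assumes "0 < Re w"
  obtains C where "\<And>x::real^'n. (1 + norm x) ^ k * norm (gauss w \<eta> y x) \<le> C"
proof
  fix x :: "real^'n"
  define a where "a = Re w"
  have a: "0 < a" using assms by (simp add: a_def)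
  let ?r = "norm (x - \<eta>)"
  have "1 + norm x \<le> (1 + norm \<eta>) * (1 + ?r)"
  proof -
    have "norm x \<le> norm \<eta> + ?r" using norm_triangle_ineq[of "x - \<eta>" \<eta>] by simp
    then show ?thesis using mult_nonneg_nonneg[of "norm \<eta>" ?r, OF norm_ge_zero norm_ge_zero] by (simp add: algebra_simps del: mult_nonneg_nonneg zero_le_mult_iff)
  qed
  also have "\<dots> \<le> (1 + norm \<eta>) * exp ?r"
    by (intro mult_left_mono exp_ge_add_one_self) auto
  finally have "(1 + norm x) ^ k \<le> (1 + norm \<eta>) ^ k * exp (real k * ?r)"
    using power_mono[of "1 + norm x" "(1 + norm \<eta>) * exp ?r" k] by (simp add: power_mult_distrib exp_of_nat_mult)
  moreover have "real k * ?r \<le> a * ?r\<^sup>2 + (real k)\<^sup>2 / (4 * a)"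
  proof -
    have "0 \<le> (2 * a * ?r - real k)\<^sup>2 / (4 * a)" using a by simp
    also have "\<dots> = a * ?r\<^sup>2 + (real k)\<^sup>2 / (4 * a) - real k * ?r"
      using a by (simp add: power2_diff field_simps power2_eq_square)
    finally show ?thesis by simp
  qed
  ultimately have "(1 + norm x) ^ k \<le> (1 + norm \<eta>) ^ k * exp (a * ?r\<^sup>2 + (real k)\<^sup>2 / (4 * a))"
    by (meson exp_le_cancel_iff mult_left_mono norm_ge_zero order_trans zero_le_power add_nonneg_nonneg zero_le_one)
  then have "(1 + norm x) ^ k * norm (gauss w \<eta> y x) \<le>
     (1 + norm \<eta>) ^ k * exp (a * ?r\<^sup>2 + (real k)\<^sup>2 / (4 * a)) * norm (gauss w \<eta> y x)"
    by (rule mult_right_mono) simp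
  also have "\<dots> = (1 + norm \<eta>) ^ k * exp ((real k)\<^sup>2 / (4 * a))"
    by (simp add: norm_gauss a_def mult.assoc flip: exp_add)
  finally show "(1 + norm x) ^ k * norm (gauss w \<eta> y x) \<le> (1 + norm \<eta>) ^ k * exp ((real k)\<^sup>2 / (4 * Re w))"
    by (simp add: a_def)
qed

lemma symbol_mult_gauss_schwartz:
  fixes u :: "real^'n \<Rightarrow> complex"
  assumes w: "0 < Re w" and u: "u \<in> symbols"
  shows "(\<lambda>x. u x * gauss w \<eta> y x) \<in> schwartz"
proof -
  define \<C> where "\<C> = {\<lambda>x. v x * gauss w \<eta> y x | v. v \<in> symbols}"
  have d: "((\<lambda>x. v x * gauss w \<eta> y x) has_derivative
      (\<lambda>h. v x * ((- w * complex_of_real (2 * ((x - \<eta>) \<bullet> h)) + \<i> * complex_of_real (y \<bullet> h)) * gauss w \<eta> y x)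
        + frechet_derivative v (at x) h * gauss w \<eta> y x)) (at x)" if "v \<in> symbols" for v x
    using symbols_partial[OF that]
    by (intro has_derivative_mult has_derivative_gauss) (auto simp: frechet_derivative_works[symmetric])
  have inC: "(\<lambda>x. u x * gauss w \<eta> y x) \<in> \<C>" using u by (auto simp: \<C>_def)
  have dC: "f differentiable (at x)" if "f \<in> \<C>" for f x
    using that d unfolding \<C>_def by (auto intro: differentiableI)
  have pC: "partial i f \<in> \<C>" if f: "f \<in> \<C>" for f i
  proof -
    obtain v where v: "v \<in> symbols" "f = (\<lambda>x. v x * gauss w \<eta> y x)" using f by (auto simp: \<C>_def)
    define v' where "v' = (\<lambda>x. v x * ((- 2 * w) * (complex_of_real (x $ i) + (- complex_of_real (\<eta> $ i))) + \<i> * complex_of_real (y $ i)) + partial i v x)"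
    have "v' \<in> symbols" unfolding v'_def
      using symbols_partial[OF v(1)] by (intro symbols_add symbols_mult symbols_const symbols_coord v) auto
    moreover have "partial i f = (\<lambda>x. v' x * gauss w \<eta> y x)"
    proof
      fix x
      show "partial i f x = v' x * gauss w \<eta> y x"
        unfolding v(2) partial_has_derivative[OF d[OF v(1)]]
        by (simp add: v'_def partial_def inner_axis algebra_simps)
    qed
    ultimately show ?thesis by (auto simp: \<C>_def)
  qed
  note cl = closed_under_partial_smooth[of _ \<C>, OF inC dC pC]
  have "bounded (range (\<lambda>x. (1 + norm x) ^ N *\<^sub>R iter_partial is (\<lambda>x. u x * gauss w \<eta> y x) x))" for N "is"
  proof -
    obtain v where v: "v \<in> symbols" "iter_partial is (\<lambda>x. u x * gauss w \<eta> y x) = (\<lambda>x. v x * gauss w \<eta> y x)"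
      using cl(1)[of "is"] by (auto simp: \<C>_def)
    obtain K k where K: "\<And>x. norm (v x) \<le> K * (1 + norm x) ^ k" using symbols_growth[OF v(1)] by blast
    have K0: "0 \<le> K" using order_trans[OF norm_ge_zero K[of 0]] by simp
    obtain C where C: "\<And>x::real^'n. (1 + norm x) ^ (N + k) * norm (gauss w \<eta> y x) \<le> C" using gauss_decay[OF w] by blast
    have "norm ((1 + norm x) ^ N *\<^sub>R (v x * gauss w \<eta> y x)) \<le> K * C" for x
    proof -
      have "norm ((1 + norm x) ^ N *\<^sub>R (v x * gauss w \<eta> y x)) = (1 + norm x) ^ N * (norm (v x) * norm (gauss w \<eta> y x))"
        by (simp add: norm_mult)
      also have "\<dots> \<le> (1 + norm x) ^ N * (K * (1 + norm x) ^ k * norm (gauss w \<eta> y x))"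
        by (intro mult_left_mono mult_right_mono K) auto
      also have "\<dots> = K * ((1 + norm x) ^ (N + k) * norm (gauss w \<eta> y x))" by (simp add: power_add mult_ac)
      also have "\<dots> \<le> K * C" by (intro mult_left_mono C K0)
      finally show ?thesis .
    qed
    then show ?thesis unfolding v(2) by (auto simp: bounded_iff)
  qed
  with cl(2) show ?thesis by (simp add: schwartz_def)
qed

lemma gauss_schwartz: "0 < Re w \<Longrightarrow> gauss w \<eta> y \<in> schwartz"
  using symbol_mult_gauss_schwartz[OF _ symbols_const[of 1], of w \<eta> y] by simp

subsection \<open>Fourier inversion\<close>

text \<open>The integral over \<open>inv_fourier A\<close> is regularised by the factor \<open>exp (- (\<delta>\<^sub>n |x|)\<^sup>2 / 4)\<close>; on the other
  side of the duality this gives the averages of \<open>A\<close> with Gaussian weights of width \<open>\<delta>\<^sub>n\<close> around \<open>\<xi>\<close>.\<close>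

lemma fourier_inv_fourier:
  fixes A :: "real^'n \<Rightarrow> complex"
  assumes cont: "continuous_on UNIV A" and bdd: "\<And>\<xi>. norm (A \<xi>) \<le> K"
    and A: "integrable lborel A" and h: "integrable lborel (inv_fourier A)"
  shows "fourier (inv_fourier A) \<xi> = A \<xi>"
proof -
  define \<delta> where "\<delta> n = 1 / (real n + 1)" for n
  have \<delta>: "\<delta> n > 0" for n by (simp add: \<delta>_def)
  have \<delta>0: "\<delta> \<longlonglongrightarrow> 0" unfolding \<delta>_def[abs_def] using LIMSEQ_inverse_real_of_nat by (simp add: inverse_eq_divide add.commute)
  let ?c = "(2 * pi) powr (- real CARD('n) / 2)"
  have [measurable]: "A \<in> borel_measurable borel" "inv_fourier A \<in> borel_measurable borel"
    using A h by (auto dest: borel_measurable_integrable)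
  define g where "g n = gauss (complex_of_real ((\<delta> n)\<^sup>2 / 4)) 0 (- \<xi>)" for n
  have gi: "integrable lborel (g n)" for n unfolding g_def by (rule integrable_gauss) (use \<delta>[of n] in simp)
  have lim1: "(\<lambda>n. LINT x|lborel. g n x * inv_fourier A x) \<longlonglongrightarrow> (LINT x|lborel. cis (- (x \<bullet> \<xi>)) * inv_fourier A x)"
  proof (rule integral_dominated_convergence[where w="\<lambda>x. norm (inv_fourier A x)"])
    show "(\<lambda>x. cis (- (x \<bullet> \<xi>)) * inv_fourier A x) \<in> borel_measurable lborel"
      using cis_inner_measurable[of "- \<xi>"] by simp
    show "(\<lambda>x. g n x * inv_fourier A x) \<in> borel_measurable lborel" for n
      using borel_measurable_integrable[OF gi[of n]] by simp
    show "integrable lborel (\<lambda>x. norm (inv_fourier A x))" using h by simp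
    show "AE x in lborel. (\<lambda>n. g n x * inv_fourier A x) \<longlonglongrightarrow> cis (- (x \<bullet> \<xi>)) * inv_fourier A x"
    proof (rule AE_I2)
      fix x
      have "(\<lambda>n. exp (- complex_of_real ((\<delta> n)\<^sup>2 / 4) * complex_of_real ((norm (x - 0))\<^sup>2)) * cis ((- \<xi>) \<bullet> x) * inv_fourier A x)
        \<longlonglongrightarrow> exp (- complex_of_real (0\<^sup>2 / 4) * complex_of_real ((norm (x - 0))\<^sup>2)) * cis ((- \<xi>) \<bullet> x) * inv_fourier A x"
        by (intro tendsto_intros \<delta>0) simp
      then show "(\<lambda>n. g n x * inv_fourier A x) \<longlonglongrightarrow> cis (- (x \<bullet> \<xi>)) * inv_fourier A x"
        by (simp add: g_def gauss_def inner_commute)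
    qed
    show "AE x in lborel. norm (g n x * inv_fourier A x) \<le> norm (inv_fourier A x)" for n
      by (auto simp: g_def norm_mult norm_gauss intro!: AE_I2 mult_left_le_one_le)
  qed
  define k where "k = ?c *\<^sub>R (complex_of_real (2 * sqrt pi)) ^ CARD('n)"
  have eq: "(LINT x|lborel. g n x * inv_fourier A x) = k * (LINT z|lborel. complex_of_real (exp (- (norm z)\<^sup>2)) * A (\<xi> + \<delta> n *\<^sub>R z))" for n
  proof -
    let ?w = "complex_of_real ((\<delta> n)\<^sup>2 / 4)"
    have cs: "csqrt ?w = complex_of_real (\<delta> n / 2)"
      using \<delta>[of n] by (simp add: csqrt_of_real_nonneg real_sqrt_divide)
    have "(LINT x|lborel. g n x * inv_fourier A x) = (LINT \<eta>|lborel. inv_fourier (g n) \<eta> * A \<eta>)"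
      by (rule inv_fourier_duality[OF gi A])
    also have "inv_fourier (g n) = (\<lambda>\<eta>. ?c *\<^sub>R (complex_of_real (sqrt pi) / csqrt ?w) ^ CARD('n) * gauss (1 / (4 * ?w)) \<xi> 0 \<eta>)"
      unfolding g_def using \<delta>[of n] by (intro ext, subst inv_fourier_gauss) auto
    also have "(LINT \<eta>|lborel. ?c *\<^sub>R (complex_of_real (sqrt pi) / csqrt ?w) ^ CARD('n) * gauss (1 / (4 * ?w)) \<xi> 0 \<eta> * A \<eta>)
       = ?c *\<^sub>R (complex_of_real (sqrt pi) / csqrt ?w) ^ CARD('n) * (LINT \<eta>|lborel. gauss (1 / (4 * ?w)) \<xi> 0 \<eta> * A \<eta>)"
      by (simp only: mult.assoc integral_mult_right_zero)
    also have "(LINT \<eta>|lborel. gauss (1 / (4 * ?w)) \<xi> 0 \<eta> * A \<eta>)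
      = (LINT z|lborel. \<bar>\<delta> n\<bar> ^ DIM(real^'n) *\<^sub>R (gauss (1 / (4 * ?w)) \<xi> 0 (\<xi> + \<delta> n *\<^sub>R z) * A (\<xi> + \<delta> n *\<^sub>R z)))"
      using \<delta>[of n] by (intro integral_affine borel_measurable_times borel_measurable_continuous_onI[OF gauss_continuous]) auto
    also have "\<dots> = (\<delta> n) ^ CARD('n) *\<^sub>R (LINT z|lborel. complex_of_real (exp (- (norm z)\<^sup>2)) * A (\<xi> + \<delta> n *\<^sub>R z))"
      using \<delta>[of n] by (simp add: gauss_def power_mult_distrib exp_of_real[symmetric])
    finally have e: "(LINT x|lborel. g n x * inv_fourier A x) = ?c *\<^sub>R (complex_of_real (sqrt pi) / csqrt ?w) ^ CARD('n) *
      (\<delta> n ^ CARD('n) *\<^sub>R (LINT z|lborel. complex_of_real (exp (- (norm z)\<^sup>2)) * A (\<xi> + \<delta> n *\<^sub>R z)))" .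
    show ?thesis unfolding e cs using \<delta>[of n]
      by (simp add: k_def power_mult_distrib power_divide scaleR_conv_of_real[where 'a=complex])
  qed
  have lim2: "(\<lambda>n. LINT z|lborel. complex_of_real (exp (- (norm z)\<^sup>2)) * A (\<xi> + \<delta> n *\<^sub>R z))
      \<longlonglongrightarrow> (LINT z::real^'n|lborel. complex_of_real (exp (- (norm z)\<^sup>2)) * A \<xi>)"
  proof (rule integral_dominated_convergence[where w="\<lambda>z::real^'n. exp (- 1 * (norm z)\<^sup>2) * K"])
    have mz: "(\<lambda>z::real^'n. complex_of_real (exp (- (norm z)\<^sup>2))) \<in> borel_measurable borel"
      by (intro borel_measurable_continuous_onI continuous_intros)
    show "(\<lambda>z::real^'n. complex_of_real (exp (- (norm z)\<^sup>2)) * A \<xi>) \<in> borel_measurable lborel"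
      using mz by simp
    have "(\<lambda>z. A (\<xi> + \<delta> n *\<^sub>R z)) \<in> borel_measurable borel" for n by measurable
    then show "(\<lambda>z. complex_of_real (exp (- (norm z)\<^sup>2)) * A (\<xi> + \<delta> n *\<^sub>R z)) \<in> borel_measurable lborel" for n
      using mz by simp
    show "integrable lborel (\<lambda>z::real^'n. exp (- 1 * (norm z)\<^sup>2) * K)"
      by (intro integrable_mult_left integrable_gaussian_vec_real) simp
    show "AE z in lborel. norm (complex_of_real (exp (- (norm z)\<^sup>2)) * A (\<xi> + \<delta> n *\<^sub>R z)) \<le> exp (- 1 * (norm z)\<^sup>2) * K" for n
      by (rule AE_I2) (simp add: norm_mult bdd)
    show "AE z in lborel. (\<lambda>n. complex_of_real (exp (- (norm z)\<^sup>2)) * A (\<xi> + \<delta> n *\<^sub>R z)) \<longlonglongrightarrow> complex_of_real (exp (- (norm z)\<^sup>2)) * A \<xi>"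
    proof (rule AE_I2, rule tendsto_mult[OF tendsto_const])
      fix z :: "real^'n"
      have "(\<lambda>n. \<xi> + \<delta> n *\<^sub>R z) \<longlonglongrightarrow> \<xi> + 0 *\<^sub>R z" by (intro tendsto_intros \<delta>0)
      then have "(\<lambda>n. \<xi> + \<delta> n *\<^sub>R z) \<longlonglongrightarrow> \<xi>" by simp
      from continuous_on_tendsto_compose[OF cont this]
      show "(\<lambda>n. A (\<xi> + \<delta> n *\<^sub>R z)) \<longlonglongrightarrow> A \<xi>" by simp
    qed
  qed
  have "(LINT z::real^'n|lborel. complex_of_real (exp (- (norm z)\<^sup>2)) * A \<xi>) = complex_of_real (pi powr (real CARD('n) / 2)) * A \<xi>"
    using integral_gaussian_vec_real[where 'n='n, of 1]
    by (simp only: integral_mult_left_zero integral_complex_of_real) (simp add: powr_divide)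
  with lim2 have "(\<lambda>n. LINT x|lborel. g n x * inv_fourier A x) \<longlonglongrightarrow> k * (complex_of_real (pi powr (real CARD('n) / 2)) * A \<xi>)"
    unfolding eq by (intro tendsto_mult tendsto_const) (simp only:)
  from LIMSEQ_unique[OF lim1 this]
  have "fourier (inv_fourier A) \<xi> = ?c *\<^sub>R (k * (complex_of_real (pi powr (real CARD('n) / 2)) * A \<xi>))"
    by (simp add: fourier_def)
  also have "\<dots> = complex_of_real (?c * (?c * (2 * sqrt pi) ^ CARD('n) * pi powr (real CARD('n) / 2))) * A \<xi>"
    by (simp add: k_def scaleR_conv_of_real[where 'a=complex])
  also have "?c * (?c * (2 * sqrt pi) ^ CARD('n) * pi powr (real CARD('n) / 2)) = 1"
  proof -
    have "(2 * sqrt pi) ^ CARD('n) = 2 powr real CARD('n) * pi powr (real CARD('n) / 2)"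
      by (simp add: power_mult_distrib powr_realpow powr_half_sqrt[symmetric] powr_powr flip: powr_realpow[of "pi powr (1/2)"])
    then show ?thesis
      by (simp add: powr_mult powr_minus divide_simps flip: powr_add)
  qed
  finally show ?thesis by simp
qed


section \<open>Distributions with a given Fourier transform\<close>

text \<open>The distribution with the Fourier transform \<open>A\<close>. It is encoded as the integration against the
  inverse Fourier transform of \<open>A\<close>, which is integrable if \<open>A\<close> is a Schwartz function, the only case
  of interest.\<close>

definition spectral :: "(real^'n \<Rightarrow> complex) \<Rightarrow> 'n::finite distr" where
  "spectral A \<phi> = (LINT x|lborel. inv_fourier A x * \<phi> x)"

lemma integrable_mult_bounded:
  fixes h m :: "real^'n \<Rightarrow> complex"
  assumes h: "integrable lborel h" and m: "m \<in> borel_measurable borel" "\<And>x. norm (m x) \<le> K"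
  shows "integrable lborel (\<lambda>x. h x * m x)"
proof (rule Bochner_Integration.integrable_bound[OF integrable_mult_left[OF integrable_norm[OF h], of K]])
  show "(\<lambda>x. h x * m x) \<in> borel_measurable lborel" using h m by (auto dest: borel_measurable_integrable)
  have "0 \<le> K" using order_trans[OF norm_ge_zero m(2)] .
  then show "AE x in lborel. norm (h x * m x) \<le> norm (norm (h x) * K)"
    by (auto intro!: AE_I2 mult_left_mono m simp: norm_mult)
qed

lemma spectral_integrable:
  assumes "A \<in> schwartz" "\<phi> \<in> schwartz"
  shows "integrable lborel (\<lambda>x. inv_fourier A x * \<phi> x)"
  by (rule integrable_mult_bounded[OF schwartz_inv_fourier_integrable[OF assms(1)] schwartz_measurable norm_le_schwartz_norm])
     (use assms in auto)

lemma tempered_spectral: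
  fixes A :: "real^'n::finite \<Rightarrow> complex"
  assumes A: "A \<in> schwartz"
  shows "tempered (spectral A)"
  unfolding tempered_def
proof (intro conjI ballI allI)
  fix \<phi> \<psi> :: "real^'n \<Rightarrow> complex" assume "\<phi> \<in> schwartz" "\<psi> \<in> schwartz"
  then show "spectral A (\<lambda>x. \<phi> x + \<psi> x) = spectral A \<phi> + spectral A \<psi>"
    by (simp add: spectral_def distrib_left spectral_integrable A)
next
  fix \<phi> :: "real^'n \<Rightarrow> complex" and c
  have "(\<lambda>x. inv_fourier A x * (c * \<phi> x)) = (\<lambda>x. c * (inv_fourier A x * \<phi> x))" by (simp add: mult_ac)
  then show "spectral A (\<lambda>x. c * \<phi> x) = c * spectral A \<phi>"
    by (simp add: spectral_def)
next
  let ?C = "LINT x|lborel. norm (inv_fourier A x)"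
  have "norm (spectral A \<phi>) \<le> ?C * schwartz_norm 0 \<phi>" if \<phi>: "\<phi> \<in> schwartz" for \<phi> :: "real^'n \<Rightarrow> complex"
  proof -
    have "norm (spectral A \<phi>) \<le> (LINT x|lborel. norm (inv_fourier A x) * schwartz_norm 0 \<phi>)"
      unfolding spectral_def
    proof (rule Bochner_Integration.integral_norm_bound_integral)
      show "integrable lborel (\<lambda>x. inv_fourier A x * \<phi> x)" by (rule spectral_integrable[OF A \<phi>])
      show "integrable lborel (\<lambda>x. norm (inv_fourier A x) * schwartz_norm 0 \<phi>)"
        by (intro integrable_mult_left integrable_norm schwartz_inv_fourier_integrable A)
      show "norm (inv_fourier A x * \<phi> x) \<le> norm (inv_fourier A x) * schwartz_norm 0 \<phi>" for x
        by (simp add: norm_mult mult_left_mono norm_le_schwartz_norm \<phi>)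
    qed
    then show ?thesis by simp
  qed
  then show "\<exists>N C. \<forall>\<phi>\<in>schwartz. norm (spectral A \<phi>) \<le> C * schwartz_norm N \<phi>" by blast
qed

lemma fourier_inv_fourier_schwartz:
  fixes A :: "real^'n \<Rightarrow> complex"
  assumes A: "A \<in> schwartz"
  shows "fourier (inv_fourier A) = A"
  by (rule ext, rule fourier_inv_fourier[OF _ norm_le_schwartz_norm])
     (use A in \<open>auto intro: schwartz_continuous schwartz_integrable schwartz_inv_fourier_integrable\<close>)

text \<open>The transposed multiplier is moved to \<open>A\<close>: it suffices to invert the Fourier transform at \<open>A\<close>,
  and that of the test function need only be integrable against \<open>m\<close>.\<close>

lemma fourier_multiplier_spectral:
  fixes A :: "real^'n::finite \<Rightarrow> complex"
  assumes A: "A \<in> schwartz" and \<phi>: "\<phi> \<in> schwartz"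
    and m: "m \<in> borel_measurable borel" "\<And>\<xi>. norm (m \<xi>) \<le> K * (1 + norm \<xi>) ^ k"
  shows "fourier_multiplier m (spectral A) \<phi> = (LINT \<xi>|lborel. A \<xi> * (m \<xi> * inv_fourier \<phi> \<xi>))"
proof -
  have "fourier_multiplier m (spectral A) \<phi> = (LINT x|lborel. inv_fourier A x * fourier (\<lambda>\<xi>. m \<xi> * inv_fourier \<phi> \<xi>) x)"
    by (simp add: fourier_multiplier_def distr_inv_fourier_def distr_mult_def distr_fourier_def spectral_def)
  also have "\<dots> = (LINT \<xi>|lborel. fourier (inv_fourier A) \<xi> * (m \<xi> * inv_fourier \<phi> \<xi>))"
    by (rule fourier_duality) (intro schwartz_inv_fourier_integrable A schwartz_inv_fourier_integrable_mult[OF \<phi> m])+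
  finally show ?thesis by (simp add: fourier_inv_fourier_schwartz A)
qed

lemma represents_fourier_multiplier:
  fixes A :: "real^'n::finite \<Rightarrow> complex"
  assumes A: "A \<in> schwartz"
    and m: "m \<in> borel_measurable borel" "\<And>\<xi>. norm (m \<xi>) \<le> K * (1 + norm \<xi>) ^ k"
    and int: "integrable lborel (\<lambda>\<xi>. m \<xi> * A \<xi>)"
  shows "represents (inv_fourier (\<lambda>\<xi>. m \<xi> * A \<xi>)) (fourier_multiplier m (spectral A))"
  unfolding represents_def
proof (intro conjI ballI)
  let ?g = "inv_fourier (\<lambda>\<xi>. m \<xi> * A \<xi>)"
  show g: "?g \<in> borel_measurable lborel" using inv_fourier_measurable[OF int] by simp
  fix \<phi> :: "real^'n \<Rightarrow> complex" assume \<phi>: "\<phi> \<in> schwartz"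
  have "integrable lborel (\<lambda>x. \<phi> x * ?g x)"
    by (rule integrable_mult_bounded[OF schwartz_integrable[OF \<phi>] _ norm_inv_fourier_le[OF int]]) (use g in simp)
  then show "integrable lborel (\<lambda>x. ?g x * \<phi> x)" by (simp add: mult.commute)
  have "fourier_multiplier m (spectral A) \<phi> = (LINT \<xi>|lborel. (m \<xi> * A \<xi>) * inv_fourier \<phi> \<xi>)"
    by (subst fourier_multiplier_spectral[OF A \<phi> m]) (simp add: mult_ac)
  also have "\<dots> = (LINT x|lborel. ?g x * \<phi> x)"
    by (rule inv_fourier_duality[OF int schwartz_integrable[OF \<phi>]])
  finally show "fourier_multiplier m (spectral A) \<phi> = (LINT x|lborel. ?g x * \<phi> x)" .
qed

lemma schroedinger_spectral:
  fixes A :: "real^'n::finite \<Rightarrow> complex"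
  assumes "A \<in> schwartz" "\<phi> \<in> schwartz"
  shows "schroedinger t (spectral A) \<phi> = (LINT \<xi>|lborel. A \<xi> * (cis (- (t * (norm \<xi>)\<^sup>2)) * inv_fourier \<phi> \<xi>))"
  unfolding schroedinger_def
  by (rule fourier_multiplier_spectral[OF assms, where K=1 and k=0])
     (auto intro!: borel_measurable_continuous_onI continuous_intros)

section \<open>Lebesgue norms\<close>

lemma ennpowr_ennreal: "0 \<le> r \<Longrightarrow> ennpowr (ennreal r) a = ennreal (r powr a)"
  by (simp add: ennpowr_def)

lemma ennpowr_mono: "0 \<le> a \<Longrightarrow> x \<le> y \<Longrightarrow> ennpowr x a \<le> ennpowr y a"
  unfolding ennpowr_def
  by (auto simp: top_unique less_top intro!: ennreal_leI powr_mono2 enn2real_mono)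

lemma ennpowr_inverse: "0 < a \<Longrightarrow> ennpowr (ennpowr x (1 / a)) a = x"
  by (auto simp: ennpowr_def powr_powr less_top)

lemma ennpowr_measurable [measurable]: "(\<lambda>x. ennpowr x a) \<in> borel_measurable borel"
  unfolding ennpowr_def by measurable

lemma recip_top [simp]: "recip top = 0"
  by (simp add: recip_def)

lemma recip_finite:
  assumes "p \<noteq> top"
  shows "recip p = 1 / enn2real p"
proof -
  obtain r where r: "p = ennreal r" "0 \<le> r" using assms by (cases p) auto
  show ?thesis
  proof (cases "r = 0")
    case False
    then have "1 / p = ennreal (1 / r)" using r divide_ennreal[of 1 r] by simp
    then show ?thesis using r by (simp add: recip_def)
  qed (simp add: r recip_def)
qed

lemma one_le_exponent:
  assumes "1 \<le> p" "p \<noteq> (top :: ennreal)"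
  shows "1 \<le> enn2real p"
  using enn2real_mono[of 1 p] assms by (simp add: less_top)

lemma recip_nonneg [simp]: "0 \<le> recip p"
  by (simp add: recip_def)

lemma recip_le_1: "1 \<le> p \<Longrightarrow> recip p \<le> 1"
  using one_le_exponent[of p] by (cases "p = top") (auto simp: recip_finite)

lemma Lp_norm_finite:
  "p \<noteq> top \<Longrightarrow> Lp_norm p M g = ennpowr (\<integral>\<^sup>+x. ennpowr (g x) (enn2real p) \<partial>M) (recip p)"
  by (simp add: Lp_norm_def recip_finite)

lemma Lp_norm_top: "Lp_norm top M g = esssup M g"
  by (simp add: Lp_norm_def)

lemma Lp_norm_lower_bound:
  fixes h :: "real \<Rightarrow> ennreal"
  assumes I: "I \<in> sets lborel" and S: "S \<in> sets lborel" "S \<subseteq> I" "emeasure lborel S = ennreal m" "0 < m"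
    and D: "0 \<le> D" and h: "AE t in lborel. t \<in> S \<longrightarrow> ennreal D \<le> h t" and p: "1 \<le> p"
  shows "ennreal (D * m powr recip p) \<le> Lp_norm p (restrict_space lborel I) h"
proof (cases "p = top")
  case True
  have "AE t in restrict_space lborel I. h t \<le> esssup (restrict_space lborel I) h" by (rule esssup_AE)
  then have *: "AE t in lborel. t \<in> I \<longrightarrow> h t \<le> esssup (restrict_space lborel I) h"
    using I by (subst (asm) AE_restrict_space_iff) auto
  have "\<not> (AE t in lborel. t \<notin> S)"
    using S AE_iff_measurable[of S lborel "\<lambda>t. t \<notin> S"] by auto
  moreover have "AE t in lborel. t \<notin> S" if "\<not> ennreal D \<le> esssup (restrict_space lborel I) h"
    using * h by eventually_elim (use that S(2) in \<open>blast dest: order_trans\<close>)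
  ultimately show ?thesis using True S(4) by (auto simp: Lp_norm_top)
next
  case False
  have e: "1 \<le> enn2real p" using one_le_exponent[OF p False] .
  have "ennreal (D powr enn2real p * m) = (\<integral>\<^sup>+t. ennreal (D powr enn2real p) * indicator S t \<partial>lborel)"
    using S by (subst nn_integral_cmult_indicator) (auto simp: ennreal_mult)
  also have "\<dots> \<le> (\<integral>\<^sup>+t. ennpowr (h t) (enn2real p) * indicator I t \<partial>lborel)"
  proof (rule nn_integral_mono_AE)
    show "AE t in lborel. ennreal (D powr enn2real p) * indicator S t \<le> ennpowr (h t) (enn2real p) * indicator I t"
      using h
    proof eventually_elim
      case (elim t)
      show ?case
      proof (cases "t \<in> S")
        case True
        then have "ennpowr (ennreal D) (enn2real p) \<le> ennpowr (h t) (enn2real p)"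
          using elim e by (intro ennpowr_mono) auto
        then show ?thesis using True S(2) D by (auto simp: ennpowr_ennreal)
      qed simp
    qed
  qed
  also have "\<dots> = (\<integral>\<^sup>+t. ennpowr (h t) (enn2real p) \<partial>restrict_space lborel I)"
    using I by (subst nn_integral_restrict_space) auto
  finally have "ennpowr (ennreal (D powr enn2real p * m)) (recip p) \<le> Lp_norm p (restrict_space lborel I) h"
    unfolding Lp_norm_finite[OF False] by (rule ennpowr_mono[OF recip_nonneg])
  moreover have "ennpowr (ennreal (D powr enn2real p * m)) (recip p) = ennreal (D * m powr recip p)"
    using D S(4) e False by (simp add: ennpowr_ennreal powr_mult powr_powr recip_finite)
  ultimately show ?thesis by simp
qed

text \<open>The \<open>L\<^sup>p\<close> norm over space-time, bounded below by the \<open>L\<^sup>p\<close> norms of the time slices.\<close>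

lemma Lp_norm_spacetime_lower_bound:
  fixes F :: "real \<times> (real^'n) \<Rightarrow> complex"
  assumes F: "F \<in> borel_measurable lborel"
    and I: "I \<in> sets lborel" and S: "S \<in> sets lborel" "S \<subseteq> I" "emeasure lborel S = ennreal m" "0 < m"
    and D: "0 \<le> D" and p: "1 \<le> p"
    and h: "AE t in lborel. t \<in> S \<longrightarrow> ennreal D \<le> Lp_norm p lborel (\<lambda>x. ennreal (norm (F (t, x))))"
  shows "ennreal (D * m powr recip p) \<le> Lp_norm p (restrict_space lborel (I \<times> UNIV)) (\<lambda>z. ennreal (norm (F z)))"
proof (cases "p = top")
  case True
  let ?E = "esssup (restrict_space lborel (I \<times> UNIV)) (\<lambda>z. ennreal (norm (F z)))"
  have IU: "I \<times> UNIV \<in> sets (lborel :: (real \<times> (real^'n)) measure)"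
    using I unfolding lborel_prod[symmetric] by (intro pair_measureI) auto
  have "AE z in restrict_space lborel (I \<times> UNIV). ennreal (norm (F z)) \<le> ?E" by (rule esssup_AE)
  then have "AE z in lborel. z \<in> I \<times> UNIV \<longrightarrow> ennreal (norm (F z)) \<le> ?E"
    using AE_restrict_space_iff[of "I \<times> UNIV" "lborel :: (real \<times> (real^'n)) measure"] IU by simp
  then have "AE z in lborel \<Otimes>\<^sub>M lborel. z \<in> I \<times> UNIV \<longrightarrow> ennreal (norm (F z)) \<le> ?E"
    by (simp only: lborel_prod)
  from lborel_pair.AE_pair[OF this]
  have *: "AE t in lborel. AE x in lborel. (t, x) \<in> I \<times> UNIV \<longrightarrow> ennreal (norm (F (t, x))) \<le> ?E" .
  have "F \<in> borel_measurable (lborel \<Otimes>\<^sub>M lborel)" using F by (simp only: lborel_prod)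
  then have m: "(\<lambda>x. F (t, x)) \<in> borel_measurable lborel" for t
    by (rule measurable_Pair2) simp
  have "AE t in lborel. t \<in> S \<longrightarrow> ennreal D \<le> ?E"
    using * h
  proof eventually_elim
    case (elim t)
    show ?case
    proof
      assume "t \<in> S"
      then have "ennreal D \<le> esssup lborel (\<lambda>x. ennreal (norm (F (t, x))))"
        using elim(2) True by (simp add: Lp_norm_top)
      also have "\<dots> \<le> ?E"
        using elim(1) \<open>t \<in> S\<close> S(2) m[of t] by (intro esssup_I) auto
      finally show "ennreal D \<le> ?E" .
    qed
  qed
  then have "AE t in lborel. t \<notin> S" if "\<not> ennreal D \<le> ?E"
    by eventually_elim (use that in blast)
  moreover have "\<not> (AE t in lborel. t \<notin> S)"
    using S AE_iff_measurable[of S lborel "\<lambda>t. t \<notin> S"] by auto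
  ultimately have "ennreal D \<le> ?E" by blast
  then show ?thesis using True S(4) by (simp add: Lp_norm_top)
next
  case False
  have e: "1 \<le> enn2real p" using one_le_exponent[OF p False] .
  have IU: "I \<times> UNIV \<in> sets (lborel :: (real \<times> (real^'n)) measure)"
    using I unfolding lborel_prod[symmetric] by (intro pair_measureI) auto
  have F' [measurable]: "F \<in> borel_measurable (lborel \<Otimes>\<^sub>M lborel)" using F by (simp only: lborel_prod)
  have [measurable]: "I \<in> sets borel" using I by simp
  have "ennreal (D powr enn2real p * m) = (\<integral>\<^sup>+t. ennreal (D powr enn2real p) * indicator S t \<partial>lborel)"
    using S by (subst nn_integral_cmult_indicator) (auto simp: ennreal_mult)
  also have "\<dots> \<le> (\<integral>\<^sup>+t. (\<integral>\<^sup>+x. ennpowr (ennreal (norm (F (t, x)))) (enn2real p) * indicator (I \<times> UNIV) (t, x) \<partial>lborel) \<partial>lborel)"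
  proof (rule nn_integral_mono_AE)
    show "AE t in lborel. ennreal (D powr enn2real p) * indicator S t \<le> (\<integral>\<^sup>+x. ennpowr (ennreal (norm (F (t, x)))) (enn2real p) * indicator (I \<times> UNIV) (t, x) \<partial>lborel)"
      using h
    proof eventually_elim
      case (elim t)
      show ?case
      proof (cases "t \<in> S")
        case True
        then have "ennpowr (ennreal D) (enn2real p) \<le> ennpowr (Lp_norm p lborel (\<lambda>x. ennreal (norm (F (t, x))))) (enn2real p)"
          using elim e by (intro ennpowr_mono) auto
        also have "\<dots> = (\<integral>\<^sup>+x. ennpowr (ennreal (norm (F (t, x)))) (enn2real p) \<partial>lborel)"
          using e by (simp add: Lp_norm_finite[OF False] recip_finite[OF False] ennpowr_inverse)
        finally show ?thesis using True S(2) D by (auto simp: ennpowr_ennreal subset_iff)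
      qed simp
    qed
  qed
  also have "\<dots> = (\<integral>\<^sup>+z. ennpowr (ennreal (norm (F z))) (enn2real p) * indicator (I \<times> UNIV) z \<partial>(lborel \<Otimes>\<^sub>M lborel))"
    by (rule lborel.nn_integral_fst) measurable
  also have "\<dots> = (\<integral>\<^sup>+z. ennpowr (ennreal (norm (F z))) (enn2real p) \<partial>restrict_space lborel (I \<times> UNIV))"
    unfolding lborel_prod using IU by (subst nn_integral_restrict_space) auto
  finally have "ennpowr (ennreal (D powr enn2real p * m)) (recip p) \<le> Lp_norm p (restrict_space lborel (I \<times> UNIV)) (\<lambda>z. ennreal (norm (F z)))"
    unfolding Lp_norm_finite[OF False] by (rule ennpowr_mono[OF recip_nonneg])
  moreover have "ennpowr (ennreal (D powr enn2real p * m)) (recip p) = ennreal (D * m powr recip p)"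
    using D S(4) e False by (simp add: ennpowr_ennreal powr_mult powr_powr recip_finite)
  ultimately show ?thesis by simp
qed

lemma integral_gaussian_shifted:
  assumes "0 < b"
  shows "integrable lborel (\<lambda>x::real^'n. exp (- b * (norm (x - y))\<^sup>2))"
    and "(LINT x::real^'n|lborel. exp (- b * (norm (x - y))\<^sup>2)) = (pi / b) powr (real CARD('n) / 2)"
proof -
  show "integrable lborel (\<lambda>x::real^'n. exp (- b * (norm (x - y))\<^sup>2))"
    using integrable_shift[OF integrable_gaussian_vec_real[OF assms], of "- y"] by simp
  have "(\<lambda>x::real^'n. exp (- b * (norm x)\<^sup>2)) \<in> borel_measurable borel"
    by (intro borel_measurable_continuous_onI continuous_intros)
  from integral_shift[OF this, of "- y"]
  show "(LINT x::real^'n|lborel. exp (- b * (norm (x - y))\<^sup>2)) = (pi / b) powr (real CARD('n) / 2)"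
    by (simp add: integral_gaussian_vec_real[OF assms, simplified])
qed

text \<open>Hoelder's inequality against a Gaussian, up to a factor that depends on the dimension only. It is
  derived from Jensen's inequality for the Gaussian probability density, which in turn follows from
  Young's inequality applied to \<open>|g|\<close> and its mean value.\<close>

lemma integral_gaussian_weight_le_Lp_norm:
  fixes g :: "real^'n \<Rightarrow> complex"
  assumes q: "1 \<le> q" and b: "0 < b" and g: "g \<in> borel_measurable borel"
    and int: "integrable lborel (\<lambda>x. norm (g x) * exp (- b * (norm (x - y))\<^sup>2))"
  shows "ennreal (LINT x|lborel. norm (g x) * exp (- b * (norm (x - y))\<^sup>2))
    \<le> ennreal ((pi / b) powr (real CARD('n) / 2 * (1 - recip q))) * Lp_norm q lborel (\<lambda>x. ennreal (norm (g x)))"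
proof -
  define W where "W x = exp (- b * (norm (x - y))\<^sup>2)" for x :: "real^'n"
  define J where "J = (LINT x|lborel. norm (g x) * W x)"
  define Z where "Z = (pi / b) powr (real CARD('n) / 2)"
  have Z0: "0 < Z" using b by (simp add: Z_def)
  have W: "0 < W x" "W x \<le> 1" for x using b by (auto simp: W_def)
  have Wi: "integrable lborel W" "(LINT x|lborel. W x) = Z"
    unfolding W_def[abs_def] Z_def using integral_gaussian_shifted[OF b] by auto
  have int': "integrable lborel (\<lambda>x. norm (g x) * W x)" using int by (simp add: W_def)
  have J0: "0 \<le> J" unfolding J_def by (intro Bochner_Integration.integral_nonneg mult_nonneg_nonneg less_imp_le[OF W(1)]) simp
  have main: "ennreal J \<le> ennreal (Z powr (1 - recip q)) * Lp_norm q lborel (\<lambda>x. ennreal (norm (g x)))"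
  proof (cases "q = top")
    case True
    let ?E = "esssup lborel (\<lambda>x. ennreal (norm (g x)))"
    show ?thesis
    proof (cases "?E = top")
      case True
      then show ?thesis using \<open>q = top\<close> Z0 by (simp add: Lp_norm_top ennreal_mult_top)
    next
      case False
      then obtain e where e: "?E = ennreal e" "0 \<le> e" by (cases ?E) auto
      have "AE x in lborel. norm (g x) \<le> e"
        using esssup_AE[of "\<lambda>x. ennreal (norm (g x))" lborel] unfolding e by (simp add: e(2))
      then have "J \<le> (LINT x|lborel. e * W x)"
        unfolding J_def using W(1)
        by (intro integral_mono_AE int' integrable_mult_right Wi) (auto elim!: eventually_mono intro!: mult_right_mono less_imp_le)
      then have "J \<le> Z * e" by (simp add: Wi mult.commute)
      then show ?thesis using True e Z0 by (simp add: Lp_norm_top ennreal_mult[symmetric])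
    qed
  next
    case False
    define a where "a = enn2real q"
    have a: "1 \<le> a" using one_le_exponent[OF q False] by (simp add: a_def)
    have ra: "recip q = 1 / a" using False by (simp add: recip_finite a_def)
    have N: "Lp_norm q lborel (\<lambda>x. ennreal (norm (g x))) = ennpowr (\<integral>\<^sup>+x. ennreal (norm (g x) powr a) \<partial>lborel) (1 / a)"
      by (simp add: Lp_norm_finite[OF False] ra ennpowr_ennreal flip: a_def)
    show ?thesis
    proof (cases "(\<integral>\<^sup>+x. ennreal (norm (g x) powr a) \<partial>lborel) = top")
      case True
      then show ?thesis using Z0 by (simp add: N ennpowr_def ennreal_mult_top)
    next
      case fin: False
      have gi: "integrable lborel (\<lambda>x. norm (g x) powr a)"
        using g fin by (intro integrableI_nonneg) (auto simp: less_top)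
      define K where "K = (LINT x|lborel. norm (g x) powr a)"
      have K: "(\<integral>\<^sup>+x. ennreal (norm (g x) powr a) \<partial>lborel) = ennreal K"
        unfolding K_def by (rule nn_integral_eq_integral[OF gi]) simp
      have K0: "0 \<le> K" by (simp add: K_def)
      \<comment> \<open>the mean value of \<open>|g|\<close> for the density \<open>W / Z\<close>\<close>
      define c where "c = J / Z"
      have c0: "0 \<le> c" using J0 Z0 by (simp add: c_def)
      have young: "norm (g x) * c powr (a - 1) \<le> norm (g x) powr a / a + (1 - 1 / a) * c powr a" for x
      proof (cases "norm (g x) = 0 \<or> c = 0")
        case True
        moreover have "0 \<le> (1 - 1 / a) * c powr a" using a by (intro mult_nonneg_nonneg) auto
        ultimately show ?thesis using a by auto
      next
        case False
        then show ?thesis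
          using Youngs_inequality_0[of "1 / a" "1 - 1 / a" "norm (g x) powr a" "c powr a"] a c0
          by (simp add: powr_powr algebra_simps)
      qed
      have "(LINT x|lborel. c powr (a - 1) * (norm (g x) * W x)) \<le> (LINT x|lborel. norm (g x) powr a / a + (1 - 1 / a) * c powr a * W x)"
      proof (rule integral_mono)
        show "integrable lborel (\<lambda>x. c powr (a - 1) * (norm (g x) * W x))" by (intro integrable_mult_right int')
        show "integrable lborel (\<lambda>x. norm (g x) powr a / a + (1 - 1 / a) * c powr a * W x)"
          by (intro Bochner_Integration.integrable_add integrable_divide gi integrable_mult_right Wi)
        fix x
        have "c powr (a - 1) * (norm (g x) * W x) \<le> (norm (g x) powr a / a + (1 - 1 / a) * c powr a) * W x"
          using mult_right_mono[OF young[of x], of "W x"] W(1)[of x] by (simp add: mult_ac)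
        also have "\<dots> \<le> norm (g x) powr a / a + (1 - 1 / a) * c powr a * W x"
          using W[of x] a by (simp add: distrib_right mult_left_le divide_right_mono)
        finally show "c powr (a - 1) * (norm (g x) * W x) \<le> norm (g x) powr a / a + (1 - 1 / a) * c powr a * W x" .
      qed
      also have "\<dots> = K / a + (1 - 1 / a) * c powr a * Z"
        using gi Wi by (simp add: K_def)
      finally have "c powr (a - 1) * J \<le> K / a + (1 - 1 / a) * c powr a * Z" by (simp add: J_def)
      moreover have "c powr (a - 1) * J = c powr a * Z"
      proof (cases "c = 0")
        case True
        then show ?thesis using Z0 a by (simp add: c_def)
      next
        case False
        then have "c powr (a - 1) * c = c powr a" using c0 by (simp add: powr_mult_base mult.commute)
        then show ?thesis using Z0 by (simp add: c_def field_simps)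
      qed
      ultimately have "c powr a * Z / a \<le> K / a" by (simp add: algebra_simps)
      then have "c powr a * Z \<le> K" using a by (simp add: divide_le_cancel)
      then have "(c powr a * Z) powr (1 / a) \<le> K powr (1 / a)"
        using a Z0 by (intro powr_mono2) auto
      then have "c * Z powr (1 / a) \<le> K powr (1 / a)"
        using a c0 Z0 by (simp add: powr_mult powr_powr)
      then have "Z powr (1 - 1 / a) * (c * Z powr (1 / a)) \<le> Z powr (1 - 1 / a) * K powr (1 / a)"
        by (rule mult_left_mono) simp
      moreover have "Z powr (1 - 1 / a) * (c * Z powr (1 / a)) = J"
      proof -
        have "Z powr (1 - 1 / a) * Z powr (1 / a) = Z" using Z0 by (simp flip: powr_add)
        then have "Z powr (1 - 1 / a) * (c * Z powr (1 / a)) = c * Z" by (simp add: mult_ac)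
        then show ?thesis using Z0 by (simp add: c_def)
      qed
      ultimately have "J \<le> Z powr (1 - 1 / a) * K powr (1 / a)" by simp
      then show ?thesis using K0
        by (simp add: N K ra ennpowr_ennreal ennreal_mult[symmetric])
    qed
  qed
  then show ?thesis by (simp add: J_def W_def Z_def powr_powr)
qed

lemma Lp_norm_gaussian_le:
  fixes g :: "real^'n \<Rightarrow> complex"
  assumes r: "1 \<le> r" and b: "0 < b" and M: "0 \<le> M" and g: "g \<in> borel_measurable borel"
    "\<And>x. norm (g x) = M * exp (- b * (norm (x - y))\<^sup>2)"
  shows "Lp_norm r lborel (\<lambda>x. ennreal (norm (g x))) \<le> ennreal (M * (pi / b) powr (real CARD('n) / 2 * recip r))"
proof (cases "r = top")
  case True
  have "norm (g x) \<le> M" for x using M b by (simp add: g(2) mult_left_le)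
  then show ?thesis using True g M b by (auto simp: Lp_norm_top intro!: esssup_I ennreal_leI)
next
  case False
  define a where "a = enn2real r"
  have a: "1 \<le> a" using one_le_exponent[OF r False] by (simp add: a_def)
  have ra: "recip r = 1 / a" using False by (simp add: recip_finite a_def)
  have ba: "0 < b * a" using a b by simp
  have pw: "norm (g x) powr a = M powr a * exp (- (b * a) * (norm (x - y))\<^sup>2)" for x
    using M by (simp add: g(2) powr_mult) (simp add: powr_def mult_ac)
  have "(\<integral>\<^sup>+x. ennreal (norm (g x) powr a) \<partial>lborel) = ennreal (LINT x|lborel. norm (g x) powr a)"
    unfolding pw by (intro nn_integral_eq_integral integrable_mult_right integral_gaussian_shifted[OF ba]) auto
  also have "(LINT x|lborel. norm (g x) powr a) = M powr a * (pi / (b * a)) powr (real CARD('n) / 2)"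
    unfolding pw by (simp only: integral_mult_right_zero integral_gaussian_shifted[OF ba])
  finally have "Lp_norm r lborel (\<lambda>x. ennreal (norm (g x))) = ennreal ((M powr a * (pi / (b * a)) powr (real CARD('n) / 2)) powr (1 / a))"
    by (simp add: Lp_norm_finite[OF False] ra ennpowr_ennreal flip: a_def)
  also have "(M powr a * (pi / (b * a)) powr (real CARD('n) / 2)) powr (1 / a) = M * (pi / (b * a)) powr (real CARD('n) / 2 * recip r)"
    using a M by (simp add: powr_mult powr_powr ra)
  also have "\<dots> \<le> M * (pi / b) powr (real CARD('n) / 2 * recip r)"
    using a b M by (intro mult_left_mono powr_mono2) (auto simp: divide_simps)
  finally show ?thesis by (simp add: ennreal_leI)
qed


section \<open>Lower bounds for the free evolution\<close>

lemma Re_inverse_quadruple: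
  assumes "w \<noteq> 0"
  shows "Re (1 / (4 * w)) = Re w / (4 * (norm w)\<^sup>2)"
proof -
  have "1 / (4 * w) = inverse w / 4" by (simp add: field_simps)
  then have "Re (1 / (4 * w)) = Re (inverse w / 4)" by (rule arg_cong)
  also have "\<dots> = Re w / (4 * (norm w)\<^sup>2)" by (simp add: cmod_power2)
  finally show ?thesis .
qed

lemma norm_gauss_const:
  assumes "w \<noteq> 0"
  shows "norm ((2 * pi) powr (- real d / 2) *\<^sub>R (complex_of_real (sqrt pi) / csqrt w) ^ d) = (2 * norm w) powr (- real d / 2)"
proof -
  have n: "norm (csqrt w) = sqrt (norm w)"
  proof -
    have "(norm (csqrt w))\<^sup>2 = norm w" by (simp flip: norm_power)
    then show ?thesis by (metis norm_ge_zero real_sqrt_unique)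
  qed
  have "norm ((2 * pi) powr (- real d / 2) *\<^sub>R (complex_of_real (sqrt pi) / csqrt w) ^ d) = (2 * pi) powr (- real d / 2) * sqrt (pi / norm w) ^ d"
    by (simp add: norm_power norm_divide n real_sqrt_divide)
  also have "sqrt (pi / norm w) ^ d = (pi / norm w) powr (real d / 2)"
    using assms by (simp add: powr_half_sqrt[symmetric] powr_realpow[symmetric] powr_powr)
  also have "(2 * pi) powr (- real d / 2) * (pi / norm w) powr (real d / 2) = (2 * norm w) powr (- real d / 2)"
    using assms by (simp add: powr_mult powr_divide powr_minus field_simps)
  finally show ?thesis .
qed

text \<open>At time \<open>t\<close> the solution is tested against a Gaussian whose Fourier transform has, up to a constant,
  the phase opposite to that of the solution. Then the pairing is the integral \<open>P\<close> of a nonnegative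
  function, up to a factor \<open>k\<close> of known modulus.\<close>

lemma evolution_slice_lower_bound:
  fixes A :: "real^'n::finite \<Rightarrow> complex" and B :: "real^'n \<Rightarrow> real" and \<eta> :: "real^'n"
  assumes A: "A \<in> schwartz" "\<And>\<xi>. A \<xi> = cis (t0 * (norm \<xi>)\<^sup>2) * complex_of_real (B \<xi>)"
    and B: "\<And>\<xi>. 0 \<le> B \<xi>"
    and a: "0 < a" "\<bar>t - t0\<bar> \<le> a" and q: "1 \<le> q"
    and g: "represents g (schroedinger t (spectral A))"
  defines "P \<equiv> (LINT \<xi>|lborel. B \<xi> * exp (- a * (norm (\<xi> - \<eta>))\<^sup>2))"
  shows "ennreal ((8 * pi) powr (- real CARD('n) / 2) * a powr (real CARD('n) / 2 * recip q) * P)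
    \<le> Lp_norm q lborel (\<lambda>x. ennreal (norm (g x)))"
proof -
  let ?d = "real CARD('n)"
  define \<tau> where "\<tau> = t - t0"
  define w where "w = Complex a (- \<tau>)"
  have w0: "w \<noteq> 0" "0 < Re w" using a by (auto simp: w_def complex_eq_iff)
  define w' where "w' = 1 / (4 * w)"
  have ww': "1 / (4 * w') = w" using w0 by (simp add: w'_def)
  have nw: "(norm w)\<^sup>2 = a\<^sup>2 + \<tau>\<^sup>2" by (simp add: w_def cmod_def)
  have aw: "a \<le> norm w" using complex_Re_le_cmod[of w] by (simp add: w_def)
  define b where "b = a / (4 * (norm w)\<^sup>2)"
  have b: "0 < b" using a w0 by (simp add: b_def)
  have Rew': "Re w' = b"
    unfolding w'_def b_def Re_inverse_quadruple[OF w0(1)] by (simp add: w_def)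
  define y where "y = (2 * \<tau>) *\<^sub>R \<eta>"
  define \<phi> where "\<phi> = gauss w' y (- \<eta>)"
  have \<phi>: "\<phi> \<in> schwartz" unfolding \<phi>_def by (rule gauss_schwartz) (simp add: Rew' b)
  have n\<phi>: "norm (\<phi> x) = exp (- b * (norm (x - y))\<^sup>2)" for x by (simp add: \<phi>_def norm_gauss Rew')
  define k where "k = (2 * pi) powr (- real CARD('n) / 2) *\<^sub>R (complex_of_real (sqrt pi) / csqrt w') ^ CARD('n) * cis (y \<bullet> - \<eta>)"
  have nk: "norm k = (2 * norm w) powr (?d / 2)"
  proof -
    have "norm k = (2 * norm w') powr (- ?d / 2)"
      unfolding k_def by (subst norm_mult, subst norm_gauss_const) (use w0 in \<open>auto simp: w'_def\<close>)
    also have "2 * norm w' = (2 * norm w) powr (- 1)"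
      using w0 by (simp add: w'_def norm_divide norm_mult powr_minus_divide)
    finally show ?thesis by (simp only: powr_powr) simp
  qed
  have F\<phi>: "inv_fourier \<phi> \<xi> = k * gauss w \<eta> y \<xi>" for \<xi>
    unfolding \<phi>_def by (subst inv_fourier_gauss) (simp_all add: Rew' b k_def ww')
  have phase: "A \<xi> * (cis (- (t * (norm \<xi>)\<^sup>2)) * inv_fourier \<phi> \<xi>)
      = k * cis (\<tau> * (norm \<eta>)\<^sup>2) * complex_of_real (B \<xi> * exp (- a * (norm (\<xi> - \<eta>))\<^sup>2))" for \<xi>
  proof -
    have e: "exp (- w * complex_of_real ((norm (\<xi> - \<eta>))\<^sup>2)) = complex_of_real (exp (- a * (norm (\<xi> - \<eta>))\<^sup>2)) * cis (\<tau> * (norm (\<xi> - \<eta>))\<^sup>2)"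
      by (simp add: exp_eq_polar w_def)
    have "A \<xi> * (cis (- (t * (norm \<xi>)\<^sup>2)) * inv_fourier \<phi> \<xi>) = 
      k * complex_of_real (B \<xi> * exp (- a * (norm (\<xi> - \<eta>))\<^sup>2)) *
       (cis (t0 * (norm \<xi>)\<^sup>2) * cis (- (t * (norm \<xi>)\<^sup>2)) * cis (\<tau> * (norm (\<xi> - \<eta>))\<^sup>2) * cis (y \<bullet> \<xi>))"
      unfolding F\<phi> A(2) gauss_def e by (simp add: mult_ac)
    also have "cis (t0 * (norm \<xi>)\<^sup>2) * cis (- (t * (norm \<xi>)\<^sup>2)) * cis (\<tau> * (norm (\<xi> - \<eta>))\<^sup>2) * cis (y \<bullet> \<xi>) = cis (\<tau> * (norm \<eta>)\<^sup>2)"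
      unfolding cis_mult
      by (rule arg_cong[where f=cis])
         (simp add: \<tau>_def y_def power2_norm_eq_inner inner_simps inner_commute algebra_simps)
    finally show ?thesis by (simp add: mult_ac)
  qed
  have pair: "(LINT x|lborel. g x * \<phi> x) = k * cis (\<tau> * (norm \<eta>)\<^sup>2) * complex_of_real P"
  proof -
    have "(LINT x|lborel. g x * \<phi> x) = schroedinger t (spectral A) \<phi>" using g \<phi> by (simp add: represents_def)
    also have "\<dots> = k * cis (\<tau> * (norm \<eta>)\<^sup>2) * (LINT \<xi>|lborel. complex_of_real (B \<xi> * exp (- a * (norm (\<xi> - \<eta>))\<^sup>2)))"
      by (subst schroedinger_spectral[OF A(1) \<phi>]) (simp only: phase integral_mult_right_zero)
    finally show ?thesis by (simp only: P_def integral_complex_of_real)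
  qed
  have P0: "0 \<le> P" unfolding P_def by (intro Bochner_Integration.integral_nonneg mult_nonneg_nonneg B) simp
  have gm: "g \<in> borel_measurable borel" using g by (simp add: represents_def)
  have gi: "integrable lborel (\<lambda>x. norm (g x) * exp (- b * (norm (x - y))\<^sup>2))"
  proof -
    have "integrable lborel (\<lambda>x. norm (g x * \<phi> x))" using g \<phi> by (intro integrable_norm) (simp add: represents_def)
    then show ?thesis by (simp add: norm_mult n\<phi>)
  qed
  have "norm k * P = norm (LINT x|lborel. g x * \<phi> x)" using P0 by (simp add: pair norm_mult)
  also have "\<dots> \<le> (LINT x|lborel. norm (g x * \<phi> x))" by (rule integral_norm_bound)
  also have "\<dots> = (LINT x|lborel. norm (g x) * exp (- b * (norm (x - y))\<^sup>2))" by (simp add: norm_mult n\<phi>)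
  finally have "ennreal (norm k * P) \<le> ennreal (LINT x|lborel. norm (g x) * exp (- b * (norm (x - y))\<^sup>2))"
    by (rule ennreal_leI)
  also have "\<dots> \<le> ennreal ((pi / b) powr (?d / 2 * (1 - recip q))) * Lp_norm q lborel (\<lambda>x. ennreal (norm (g x)))"
    by (rule integral_gaussian_weight_le_Lp_norm[OF q b gm gi])
  finally have main: "ennreal (norm k * P) \<le> ennreal ((pi / b) powr (?d / 2 * (1 - recip q))) * Lp_norm q lborel (\<lambda>x. ennreal (norm (g x)))" .
  let ?c = "(8 * pi) powr (- ?d / 2)" and ?X = "(pi / b) powr (?d / 2 * (1 - recip q))"
  have rq: "0 \<le> recip q" "recip q \<le> 1" using recip_le_1[OF q] by auto
  have X0: "0 < ?X" using b by simp
  have kb: "?c * a powr (?d / 2 * recip q) * ?X \<le> norm k"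
  proof -
    have "\<tau>\<^sup>2 \<le> a\<^sup>2" using a unfolding \<tau>_def by (metis abs_le_square_iff abs_of_pos)
    then have "4 * pi * (norm w)\<^sup>2 / a \<le> 4 * pi * (2 * a\<^sup>2) / a"
      unfolding nw using a by (intro divide_right_mono mult_left_mono) auto
    moreover have "pi / b = 4 * pi * (norm w)\<^sup>2 / a" by (simp add: b_def)
    ultimately have "pi / b \<le> 8 * pi * a" using a by (simp add: power2_eq_square)
    then have "?X \<le> (8 * pi * a) powr (?d / 2 * (1 - recip q))"
      using b rq by (intro powr_mono2) auto
    also have "\<dots> = (8 * pi) powr (?d / 2 * (1 - recip q)) * a powr (?d / 2 * (1 - recip q))"
      using a by (simp add: powr_mult)
    also have "\<dots> \<le> (8 * pi) powr (?d / 2) * a powr (?d / 2 * (1 - recip q))"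
    proof (intro mult_right_mono powr_mono)
      show "?d / 2 * (1 - recip q) \<le> ?d / 2" using rq by (simp add: mult_left_le)
      show "1 \<le> 8 * pi" using pi_gt3 by simp
    qed simp
    finally have "?c * a powr (?d / 2 * recip q) * ?X \<le> ?c * a powr (?d / 2 * recip q) * ((8 * pi) powr (?d / 2) * a powr (?d / 2 * (1 - recip q)))"
      by (rule mult_left_mono) simp
    also have "\<dots> = (?c * (8 * pi) powr (?d / 2)) * (a powr (?d / 2 * recip q) * a powr (?d / 2 * (1 - recip q)))"
      by (simp only: mult_ac)
    also have "?c * (8 * pi) powr (?d / 2) = 1" by (simp add: powr_minus)
    also have "a powr (?d / 2 * recip q) * a powr (?d / 2 * (1 - recip q)) = a powr (?d / 2)"
    proof -
      have "?d / 2 * recip q + ?d / 2 * (1 - recip q) = ?d / 2" by (simp add: field_simps)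
      then show ?thesis by (simp only: powr_add[symmetric])
    qed
    also have "1 * a powr (?d / 2) \<le> norm k"
      unfolding nk mult_1 using a aw by (intro powr_mono2) auto
    finally show ?thesis .
  qed
  show ?thesis
  proof (cases "Lp_norm q lborel (\<lambda>x. ennreal (norm (g x)))")
    case (real n)
    have "norm k * P \<le> ?X * n"
      using main real X0 by (simp add: ennreal_mult[symmetric])
    moreover have "(?c * a powr (?d / 2 * recip q) * ?X) * P \<le> norm k * P"
      by (rule mult_right_mono[OF kb P0])
    ultimately have "?X * (?c * a powr (?d / 2 * recip q) * P) \<le> ?X * n" by (simp add: mult_ac)
    then have "?c * a powr (?d / 2 * recip q) * P \<le> n" using X0 by (rule mult_left_le_imp_le)
    then show ?thesis using real by (simp add: ennreal_leI)
  qed simp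
qed

lemma
  fixes A :: "real^'n::finite \<Rightarrow> complex" and B :: "real^'n \<Rightarrow> real" and \<eta> :: "real^'n"
  assumes A: "A \<in> schwartz" "\<And>\<xi>. A \<xi> = cis (t0 * (norm \<xi>)\<^sup>2) * complex_of_real (B \<xi>)"
    and B: "\<And>\<xi>. 0 \<le> B \<xi>"
    and \<rho>: "0 < \<rho>" "\<rho> \<le> a" and I: "I \<in> sets lborel" "{t0 - \<rho>..t0 + \<rho>} \<subseteq> I" and p: "1 \<le> p"
  defines "P \<equiv> (LINT \<xi>|lborel. B \<xi> * exp (- a * (norm (\<xi> - \<eta>))\<^sup>2))"
  shows U_mixed_norm_lower_bound: "1 \<le> q \<Longrightarrow>
      ennreal ((8 * pi) powr (- real CARD('n) / 2) * a powr (real CARD('n) / 2 * recip q) * P * (2 * \<rho>) powr recip p)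
        \<le> U_mixed_norm p I q (spectral A)"
    and U_Lp_norm_lower_bound:
      "ennreal ((8 * pi) powr (- real CARD('n) / 2) * a powr (real CARD('n) / 2 * recip p) * P * (2 * \<rho>) powr recip p)
        \<le> U_Lp_norm p I (spectral A)"
proof -
  let ?S = "{t0 - \<rho>..t0 + \<rho>}"
  let ?D = "\<lambda>q. (8 * pi) powr (- real CARD('n) / 2) * a powr (real CARD('n) / 2 * recip q) * P"
  have P0: "0 \<le> P" unfolding P_def by (intro Bochner_Integration.integral_nonneg mult_nonneg_nonneg B) simp
  then have D0: "0 \<le> ?D q" for q by simp
  have S: "?S \<in> sets lborel" "?S \<subseteq> I" "emeasure lborel ?S = ennreal (2 * \<rho>)" "0 < 2 * \<rho>"
    using \<rho> I by auto
  have slices: "AE t in lborel. t \<in> ?S \<longrightarrow> ennreal (?D q) \<le> Lp_norm q lborel (\<lambda>x. ennreal (norm (F (t, x))))"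
    if F: "represents_U I F (spectral A)" and q: "1 \<le> q" for F q
  proof -
    have "AE t in lborel. t \<in> I \<longrightarrow> represents (\<lambda>x. F (t, x)) (schroedinger t (spectral A))"
      using F by (simp add: represents_U_def)
    then show ?thesis
    proof eventually_elim
      case (elim t)
      show ?case
      proof
        assume t: "t \<in> ?S"
        then have "\<bar>t - t0\<bar> \<le> a" using \<rho> by auto
        moreover have "represents (\<lambda>x. F (t, x)) (schroedinger t (spectral A))" using elim t S(2) by blast
        ultimately show "ennreal (?D q) \<le> Lp_norm q lborel (\<lambda>x. ennreal (norm (F (t, x))))"
          unfolding P_def using \<rho> by (intro evolution_slice_lower_bound[OF A B _ _ q]) auto
      qed
    qed
  qed
  show "ennreal (?D q * (2 * \<rho>) powr recip p) \<le> U_mixed_norm p I q (spectral A)" if q: "1 \<le> q"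
    unfolding U_mixed_norm_def
    by (rule INF_greatest, rule Lp_norm_lower_bound[OF I(1) S D0 _ p]) (use slices q in auto)
  show "ennreal (?D p * (2 * \<rho>) powr recip p) \<le> U_Lp_norm p I (spectral A)"
    unfolding U_Lp_norm_def
    by (rule INF_greatest, rule Lp_norm_spacetime_lower_bound[OF _ I(1) S D0 p]) (use slices p in \<open>auto simp: represents_U_def\<close>)
qed

section \<open>Estimates from Bessel potential spaces\<close>

lemma bracket_powr_continuous: "continuous_on S (\<lambda>\<xi>::real^'n. (1 + (norm \<xi>)\<^sup>2) powr s)"
proof -
  have "1 + (norm \<xi>)\<^sup>2 \<noteq> 0" for \<xi> :: "real^'n" by (smt (verit) zero_le_power2)
  then show ?thesis by (intro continuous_intros) auto
qed

text \<open>For the function \<open>f = \<langle>D\<rangle>\<^sup>-\<^sup>s g\<close> with a Gaussian \<open>g\<close> the norm of \<open>f\<close> is the \<open>L\<^sup>r\<close> norm of \<open>g\<close>.\<close>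

lemma bessel_norm_gaussian:
  fixes \<eta> :: "real^'n::finite" and s :: real
  assumes w: "0 < Re w" and r: "1 \<le> r"
  defines "A \<equiv> (\<lambda>\<xi>. complex_of_real ((1 + (norm \<xi>)\<^sup>2) powr (- s / 2)) * gauss w \<eta> 0 \<xi>)"
  shows "spectral A \<in> bessel_space s r"
    and "bessel_norm s r (spectral A)
      \<le> ennreal ((2 * norm w) powr (- real CARD('n) / 2) * (4 * pi * (norm w)\<^sup>2 / Re w) powr (real CARD('n) / 2 * recip r))"
proof -
  let ?m = "\<lambda>\<xi>::real^'n. complex_of_real ((1 + (norm \<xi>)\<^sup>2) powr (s / 2))"
  have A: "A \<in> schwartz" unfolding A_def by (rule symbol_mult_gauss_schwartz[OF w symbols_powr])
  have w0: "w \<noteq> 0" using w by auto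
  have mA: "(\<lambda>\<xi>. ?m \<xi> * A \<xi>) = gauss w \<eta> 0"
  proof
    fix \<xi> :: "real^'n"
    have "1 + (norm \<xi>)\<^sup>2 \<noteq> 0" by (smt (verit) zero_le_power2)
    then have "(1 + (norm \<xi>)\<^sup>2) powr (s / 2) * (1 + (norm \<xi>)\<^sup>2) powr (- s / 2) = 1" by (simp flip: powr_add)
    then show "?m \<xi> * A \<xi> = gauss w \<eta> 0 \<xi>"
      unfolding A_def by (simp only: mult.assoc[symmetric] of_real_mult[symmetric]) simp
  qed
  obtain K k where K: "\<And>\<xi>. norm (?m \<xi>) \<le> K * (1 + norm \<xi>) ^ k"
    using symbols_growth[OF symbols_powr[of "s / 2"]] by blast
  have m: "?m \<in> borel_measurable borel"
    by (intro borel_measurable_continuous_onI continuous_intros bracket_powr_continuous)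
  have "represents (inv_fourier (gauss w \<eta> 0)) (bessel s (spectral A))"
    using represents_fourier_multiplier[OF A m K] integrable_gauss[OF w, of \<eta> 0] by (simp only: mA bessel_def)
  then have le: "bessel_norm s r (spectral A) \<le> Lp_norm r lborel (\<lambda>x. ennreal (norm (inv_fourier (gauss w \<eta> 0) x)))"
    unfolding bessel_norm_def distr_Lp_norm_def by (intro INF_lower) simp
  define b where "b = Re (1 / (4 * w))"
  have b_eq: "b = Re w / (4 * (norm w)\<^sup>2)"
    unfolding b_def by (rule Re_inverse_quadruple[OF w0])
  have b: "0 < b" using w w0 by (simp add: b_eq)
  have "norm (inv_fourier (gauss w \<eta> 0) x) = (2 * norm w) powr (- real CARD('n) / 2) * exp (- b * (norm (x - 0))\<^sup>2)" for x
    unfolding inv_fourier_gauss[OF w] norm_mult norm_gauss_const[OF w0] norm_gauss by (simp add: b_def)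
  from Lp_norm_gaussian_le[OF r b _ inv_fourier_measurable[OF integrable_gauss[OF w]] this]
  have "Lp_norm r lborel (\<lambda>x. ennreal (norm (inv_fourier (gauss w \<eta> 0) x)))
     \<le> ennreal ((2 * norm w) powr (- real CARD('n) / 2) * (pi / b) powr (real CARD('n) / 2 * recip r))"
    by simp
  also have "pi / b = 4 * pi * (norm w)\<^sup>2 / Re w" by (simp add: b_eq)
  finally show bound: "bessel_norm s r (spectral A)
      \<le> ennreal ((2 * norm w) powr (- real CARD('n) / 2) * (4 * pi * (norm w)\<^sup>2 / Re w) powr (real CARD('n) / 2 * recip r))"
    using le by (rule order_trans[rotated])
  show "spectral A \<in> bessel_space s r"
    using tempered_spectral[OF A] bound by (auto simp: bessel_space_def less_top intro: le_less_trans)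
qed

text \<open>The integral over the ball of radius \<open>1 / sqrt a\<close>, where the Gaussian is at least \<open>exp (- 1)\<close>.\<close>

lemma gaussian_mass_lower_bound:
  fixes \<eta> :: "real^'n"
  assumes a: "0 < a" and m: "0 \<le> m" "\<And>\<xi>. norm (\<xi> - \<eta>) \<le> 1 / sqrt a \<Longrightarrow> m \<le> B \<xi>"
    and B: "\<And>\<xi>. 0 \<le> B \<xi>" and int: "integrable lborel (\<lambda>\<xi>. B \<xi> * exp (- a * (norm (\<xi> - \<eta>))\<^sup>2))"
  shows "m * exp (- 1) * unit_ball_vol (real CARD('n)) * a powr (- real CARD('n) / 2)
    \<le> (LINT \<xi>|lborel. B \<xi> * exp (- a * (norm (\<xi> - \<eta>))\<^sup>2))"
proof -
  let ?R = "1 / sqrt a"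
  have R: "0 \<le> ?R" using a by simp
  have fin: "emeasure lborel (cball \<eta> ?R) < \<infinity>" by (rule emeasure_lborel_cball_finite)
  have "measure lborel (cball \<eta> ?R) = unit_ball_vol (real CARD('n)) * ?R ^ CARD('n)"
    using content_cball[OF R, of \<eta>] by simp
  also have "?R ^ CARD('n) = a powr (- real CARD('n) / 2)"
    using a by (simp add: powr_half_sqrt[symmetric] powr_realpow[symmetric] powr_powr powr_minus_divide[symmetric])
  finally have vol: "measure lborel (cball \<eta> ?R) = unit_ball_vol (real CARD('n)) * a powr (- real CARD('n) / 2)" .
  have "(LINT \<xi>|lborel. (m * exp (- 1)) * indicator (cball \<eta> ?R) \<xi>) \<le> (LINT \<xi>|lborel. B \<xi> * exp (- a * (norm (\<xi> - \<eta>))\<^sup>2))"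
  proof (rule integral_mono[OF _ int])
    show "integrable lborel (\<lambda>\<xi>. (m * exp (- 1)) * indicator (cball \<eta> ?R) \<xi>)"
      using fin by (intro integrable_mult_right integrable_real_indicator) auto
    fix \<xi> :: "real^'n"
    show "(m * exp (- 1)) * indicator (cball \<eta> ?R) \<xi> \<le> B \<xi> * exp (- a * (norm (\<xi> - \<eta>))\<^sup>2)"
    proof (cases "\<xi> \<in> cball \<eta> ?R")
      case True
      then have n: "norm (\<xi> - \<eta>) \<le> ?R" by (simp add: dist_norm norm_minus_commute)
      then have "(norm (\<xi> - \<eta>))\<^sup>2 \<le> ?R\<^sup>2" by (intro power_mono) auto
      then have "a * (norm (\<xi> - \<eta>))\<^sup>2 \<le> 1" using a by (simp add: power_divide field_simps)
      then have "m * exp (- 1) \<le> B \<xi> * exp (- a * (norm (\<xi> - \<eta>))\<^sup>2)"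
        using m n by (intro mult_mono) (auto intro: B)
      then show ?thesis using True by simp
    qed (simp add: B)
  qed
  also have "(LINT \<xi>|lborel. (m * exp (- 1)) * indicator (cball \<eta> ?R) \<xi>) = m * exp (- 1) * measure lborel (cball \<eta> ?R)"
    by simp
  finally show ?thesis by (simp add: vol mult_ac)
qed

text \<open>The constant of the next lemma in dimension \<open>d\<close>. A negative \<open>C\<close> counts as \<open>0\<close>, as it does in
  \<open>ennreal C\<close>.\<close>

definition gaussian_constant :: "real \<Rightarrow> ennreal \<Rightarrow> real \<Rightarrow> real" where
  "gaussian_constant C r d = max C 0 * (2 powr (- d / 2) * (4 * pi) powr (d / 2 * recip r))
     / ((8 * pi) powr (- d / 2) * (exp (- 1) * unit_ball_vol d))"

text \<open>The assumed estimate, applied to \<open>f\<close> such that \<open>\<langle>D\<rangle>\<^sup>s f\<close> has the Fourier transform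
  \<open>exp (- (a - i t0) |\<xi> - \<eta>|\<^sup>2)\<close>. If \<open>t0 = 0\<close> or \<open>\<eta> = 0\<close>, then this equals
  \<open>exp (i t0 |\<xi>|\<^sup>2) exp (- a |\<xi> - \<eta>|\<^sup>2)\<close>, as the lower bound for the solution requires. The number \<open>m\<close>
  bounds \<open>\<langle>\<xi>\<rangle>\<^sup>-\<^sup>s\<close> from below where the Gaussian is concentrated.\<close>

lemma bessel_estimate_gaussian:
  fixes p q r :: ennreal and \<eta> :: "real^'n::finite"
  assumes est: "\<forall>f :: 'n distr \<in> bessel_space s r. U_mixed_norm p I q f \<le> ennreal C * bessel_norm s r f"
    and pqr: "1 \<le> p" "1 \<le> q" "1 \<le> r" and I: "I \<in> sets lborel"
    and \<rho>: "0 < \<rho>" "\<rho> \<le> a" and sub: "{t0 - \<rho>..t0 + \<rho>} \<subseteq> I" and t0: "t0 = 0 \<or> \<eta> = 0"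
    and m: "0 \<le> m" "\<And>\<xi>. norm (\<xi> - \<eta>) \<le> 1 / sqrt (2 * a) \<Longrightarrow> m \<le> (1 + (norm \<xi>)\<^sup>2) powr (- s / 2)"
  shows "m * a powr (real CARD('n) / 2 * recip q) * (2 * \<rho>) powr recip p * (2 * a) powr (- real CARD('n) / 2)
    \<le> gaussian_constant C r (real CARD('n)) * (a\<^sup>2 + t0\<^sup>2) powr (- real CARD('n) / 4)
        * ((a\<^sup>2 + t0\<^sup>2) / a) powr (real CARD('n) / 2 * recip r)"
proof -
  let ?d = "real CARD('n)"
  define K1 where "K1 = (8 * pi) powr (- ?d / 2) * (exp (- 1) * unit_ball_vol ?d)"
  have K1: "0 < K1" by (simp add: K1_def)
  define K2 where "K2 = max C 0 * (2 powr (- ?d / 2) * (4 * pi) powr (?d / 2 * recip r))"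
  have a: "0 < a" using \<rho> by simp
  define w where "w = Complex a (- t0)"
  have w: "0 < Re w" "Re w = a" using a by (auto simp: w_def)
  define W where "W = a\<^sup>2 + t0\<^sup>2"
  have W0: "0 < W" using a by (simp add: W_def add_pos_nonneg)
  have nw: "(norm w)\<^sup>2 = W" "norm w = W powr (1/2)"
    using W0 by (auto simp: w_def cmod_def W_def powr_half_sqrt)
  define B where "B \<xi> = (1 + (norm \<xi>)\<^sup>2) powr (- s / 2) * exp (- a * (norm (\<xi> - \<eta>))\<^sup>2)" for \<xi> :: "real^'n"
  define A where "A \<xi> = complex_of_real ((1 + (norm \<xi>)\<^sup>2) powr (- s / 2)) * gauss w \<eta> 0 \<xi>" for \<xi> :: "real^'n"
  have A: "A \<in> schwartz" unfolding A_def[abs_def] by (rule symbol_mult_gauss_schwartz[OF w(1) symbols_powr])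
  have AB: "A \<xi> = cis (t0 * (norm \<xi>)\<^sup>2) * complex_of_real (B \<xi>)" for \<xi>
  proof -
    have "gauss w \<eta> 0 \<xi> = complex_of_real (exp (- a * (norm (\<xi> - \<eta>))\<^sup>2)) * cis (t0 * (norm (\<xi> - \<eta>))\<^sup>2)"
      by (simp add: gauss_def w_def exp_eq_polar)
    also have "cis (t0 * (norm (\<xi> - \<eta>))\<^sup>2) = cis (t0 * (norm \<xi>)\<^sup>2)" using t0 by auto
    finally show ?thesis by (simp add: A_def B_def mult_ac)
  qed
  have B0: "0 \<le> B \<xi>" for \<xi> by (simp add: B_def)
  define P where "P = (LINT \<xi>|lborel. B \<xi> * exp (- a * (norm (\<xi> - \<eta>))\<^sup>2))"
  have Peq: "(\<lambda>\<xi>. B \<xi> * exp (- a * (norm (\<xi> - \<eta>))\<^sup>2)) = (\<lambda>\<xi>. (1 + (norm \<xi>)\<^sup>2) powr (- s / 2) * exp (- (2 * a) * (norm (\<xi> - \<eta>))\<^sup>2))"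
    by (auto simp: B_def fun_eq_iff mult_exp_exp)
  have "integrable lborel (\<lambda>\<xi>. norm (complex_of_real ((1 + (norm \<xi>)\<^sup>2) powr (- s / 2)) * gauss (complex_of_real (2 * a)) \<eta> 0 \<xi>))"
    using a by (intro integrable_norm schwartz_integrable symbol_mult_gauss_schwartz symbols_powr) simp
  then have Pi: "integrable lborel (\<lambda>\<xi>. (1 + (norm \<xi>)\<^sup>2) powr (- s / 2) * exp (- (2 * a) * (norm (\<xi> - \<eta>))\<^sup>2))"
    by (simp add: norm_mult norm_gauss)
  have P: "m * exp (- 1) * unit_ball_vol ?d * (2 * a) powr (- ?d / 2) \<le> P"
    unfolding P_def Peq by (rule gaussian_mass_lower_bound[OF _ m _ Pi]) (use a in auto)
  let ?R = "(2 * norm w) powr (- ?d / 2) * (4 * pi * (norm w)\<^sup>2 / Re w) powr (?d / 2 * recip r)"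
  have "ennreal ((8 * pi) powr (- ?d / 2) * a powr (?d / 2 * recip q) * P * (2 * \<rho>) powr recip p) \<le> U_mixed_norm p I q (spectral A)"
    unfolding P_def by (rule U_mixed_norm_lower_bound[OF A AB B0 \<rho> I sub pqr(1,2)])
  also have "\<dots> \<le> ennreal C * bessel_norm s r (spectral A)"
    unfolding A_def[abs_def] by (rule bspec[OF est], rule bessel_norm_gaussian[OF w(1) pqr(3)])
  also have "\<dots> \<le> ennreal C * ennreal ?R"
    unfolding A_def[abs_def] by (intro mult_left_mono bessel_norm_gaussian[OF w(1) pqr(3)]) simp
  also have "\<dots> = ennreal (max C 0 * ?R)"
    by (cases "C \<ge> 0") (auto simp: ennreal_mult[symmetric] ennreal_neg)
  finally have "(8 * pi) powr (- ?d / 2) * a powr (?d / 2 * recip q) * P * (2 * \<rho>) powr recip p \<le> max C 0 * ?R"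
    by (subst (asm) ennreal_le_iff) auto
  moreover have "max C 0 * ?R = K2 * W powr (- ?d / 4) * (W / a) powr (?d / 2 * recip r)"
  proof -
    have "(2 * norm w) powr (- ?d / 2) = 2 powr (- ?d / 2) * W powr (- ?d / 4)"
      by (simp add: nw(2) powr_mult powr_powr)
    moreover have "(4 * pi * (norm w)\<^sup>2 / Re w) powr (?d / 2 * recip r) = (4 * pi) powr (?d / 2 * recip r) * (W / a) powr (?d / 2 * recip r)"
      using W0 a by (simp only: nw(1) w(2) times_divide_eq_right[symmetric] powr_mult)
    ultimately show ?thesis by (simp add: K2_def)
  qed
  moreover have "(8 * pi) powr (- ?d / 2) * a powr (?d / 2 * recip q) * (m * exp (- 1) * unit_ball_vol ?d * (2 * a) powr (- ?d / 2)) * (2 * \<rho>) powr recip p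
    \<le> (8 * pi) powr (- ?d / 2) * a powr (?d / 2 * recip q) * P * (2 * \<rho>) powr recip p"
    by (intro mult_right_mono mult_left_mono P) auto
  ultimately have "K1 * (m * a powr (?d / 2 * recip q) * (2 * \<rho>) powr recip p * (2 * a) powr (- ?d / 2))
     \<le> K2 * W powr (- ?d / 4) * (W / a) powr (?d / 2 * recip r)"
    unfolding K1_def by (simp add: mult_ac)
  then have "m * a powr (?d / 2 * recip q) * (2 * \<rho>) powr recip p * (2 * a) powr (- ?d / 2)
     \<le> (K2 / K1) * W powr (- ?d / 4) * (W / a) powr (?d / 2 * recip r)"
    using K1 by (simp add: field_simps)
  then show ?thesis by (simp only: W_def gaussian_constant_def K1_def K2_def)
qed

lemma exponent_le_of_bounded:
  assumes c: "0 < c" and bd: "\<And>N::real. 1 \<le> N \<Longrightarrow> c * N powr e \<le> K * N powr e'"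
  shows "e \<le> e'"
proof (rule ccontr)
  assume "\<not> e \<le> e'"
  then have e: "0 < e - e'" by simp
  define N where "N = max 1 ((K / c + 1) powr (1 / (e - e')))"
  have N: "1 \<le> N" by (simp add: N_def)
  have "0 < K" using bd[of 1] c by simp
  then have "K / c + 1 > 0" using c by (simp add: add_pos_pos)
  then have "K / c + 1 = ((K / c + 1) powr (1 / (e - e'))) powr (e - e')" using e by (simp add: powr_powr)
  also have "\<dots> \<le> N powr (e - e')" using e by (intro powr_mono2) (auto simp: N_def)
  finally have "c * (K / c + 1) \<le> c * N powr (e - e')" using c by (intro mult_left_mono) auto
  also have "\<dots> \<le> K" using bd[OF N] N by (simp add: powr_diff field_simps)
  finally show False using c by (simp add: algebra_simps)
qed

lemma bracket_lower_bound:
  fixes \<xi> :: "real^'n"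
  assumes "0 \<le> s" "norm \<xi> \<le> L" "1 \<le> L"
  shows "2 powr (- s / 2) * L powr (- s) \<le> (1 + (norm \<xi>)\<^sup>2) powr (- s / 2)"
proof -
  have "1 + (norm \<xi>)\<^sup>2 \<le> 1 + L\<^sup>2" using assms by (intro add_left_mono power_mono) auto
  also have "\<dots> \<le> 2 * L\<^sup>2" using assms(3) power_mono[of 1 L 2] by simp
  finally have "(2 * L\<^sup>2) powr (- s / 2) \<le> (1 + (norm \<xi>)\<^sup>2) powr (- s / 2)"
    using assms(1) by (intro powr_mono2') (auto simp: add_pos_nonneg)
  moreover have "(2 * L\<^sup>2) powr (- s / 2) = 2 powr (- s / 2) * L powr (- s)"
    using assms by (simp add: powr_mult powr_powr flip: powr_numeral)
  ultimately show ?thesis by simp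
qed

context
  fixes p q r :: ennreal and s C :: real and I :: "real set"
  assumes est: "\<forall>f :: 'n::finite distr \<in> bessel_space s r. U_mixed_norm p I q f \<le> ennreal C * bessel_norm s r f"
    and pqr: "1 \<le> p" "1 \<le> q" "1 \<le> r" and I: "I \<in> sets lborel" "{-1..1} \<subseteq> I"
begin

text \<open>High frequency: Gaussians centred at \<open>\<eta>\<close> with \<open>|\<eta>| \<rightarrow> \<infinity>\<close> on the Fourier side.\<close>

lemma bessel_estimate_regularity_nonneg: "0 \<le> s"
proof (rule ccontr)
  assume "\<not> 0 \<le> s"
  then have s: "s < 0" by simp
  let ?d = "real CARD('n)"
  let ?K = "gaussian_constant C r ?d"
  note K = bessel_estimate_gaussian[OF est pqr I(1)]
  have "(1/2) powr (?d / 2 * recip q) * N powr (- s) \<le> (?K * (1/4) powr (- ?d / 4) * (1/2) powr (?d / 2 * recip r)) * N powr 0" if N: "1 \<le> N" for N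
  proof -
    \<comment> \<open>any coordinate direction would do; \<open>N + 1\<close> leaves room for the unit ball around \<open>\<eta>\<close>\<close>
    define \<eta> :: "real^'n" where "\<eta> = (N + 1) *\<^sub>R axis undefined 1"
    have \<eta>: "norm \<eta> = N + 1" using N by (simp add: \<eta>_def)
    have "N powr (- s) \<le> (1 + (norm \<xi>)\<^sup>2) powr (- s / 2)" if "norm (\<xi> - \<eta>) \<le> 1 / sqrt (2 * (1/2))" for \<xi>
    proof -
      have "N \<le> norm \<xi>" using that \<eta> norm_triangle_ineq2[of \<eta> \<xi>] by (simp add: norm_minus_commute)
      then have "N\<^sup>2 \<le> (norm \<xi>)\<^sup>2" using N by (intro power_mono) auto
      then have "N\<^sup>2 \<le> 1 + (norm \<xi>)\<^sup>2" by linarith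
      then have "(N\<^sup>2) powr (- s / 2) \<le> (1 + (norm \<xi>)\<^sup>2) powr (- s / 2)" using s by (intro powr_mono2) auto
      then show ?thesis using N by (simp add: powr_powr flip: powr_numeral)
    qed
    note K' = K[of "1/2" "1/2" 0 \<eta> "N powr (- s)", OF _ _ _ _ _ this]
    have "{- (1 / 2)..1 / 2} \<subseteq> I" by (rule order_trans[OF _ I(2)]) auto
    with K' show ?thesis using N by (auto simp: power2_eq_square mult_ac)
  qed
  then have "- s \<le> 0" by (rule exponent_le_of_bounded[rotated]) auto
  with s show False by simp
qed

text \<open>Solutions that focus at the time \<open>1/2\<close> at the scale \<open>1/N\<close>.\<close>

lemma bessel_estimate_focusing:
  "real CARD('n) - real CARD('n) * recip q - 2 * recip p - real CARD('n) * recip r \<le> s"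
proof -
  let ?d = "real CARD('n)"
  let ?K = "gaussian_constant C r ?d"
  note K = bessel_estimate_gaussian[OF est pqr I(1)]
  have "(2 powr (- s / 2) * 2 powr (- (?d / 2 * recip q))) * N powr (?d - ?d * recip q - 2 * recip p - s)
     \<le> (max ?K 0 * (1/4) powr (- ?d / 4) * 2 powr (?d / 2 * recip r)) * N powr (?d * recip r)" if N: "1 \<le> N" for N
  proof -
    define a where "a = N powr (-2) / 2"
    have a: "0 < a" "a \<le> 1/2" using N powr_mono[of "-2" 0 N] by (auto simp: a_def)
    have sq: "1 / sqrt (2 * a) = N" using N by (simp add: a_def powr_minus real_sqrt_inverse powr_numeral inverse_eq_divide real_sqrt_divide)
    have m: "2 powr (- s / 2) * N powr (- s) \<le> (1 + (norm \<xi>)\<^sup>2) powr (- s / 2)" if "norm (\<xi> - 0) \<le> 1 / sqrt (2 * a)" for \<xi> :: "real^'n"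
      using bracket_lower_bound[of s \<xi> N] bessel_estimate_regularity_nonneg N that by (simp add: sq)
    have "{1/2 - a..1/2 + a} \<subseteq> I" using I(2) a by (auto simp: subset_iff)
    from K[of a a "1/2" 0, OF _ _ this _ _ m] a
    have "2 powr (- s / 2) * N powr (- s) * a powr (?d / 2 * recip q) * (2 * a) powr recip p * (2 * a) powr (- ?d / 2)
      \<le> ?K * (a\<^sup>2 + (1/2)\<^sup>2) powr (- ?d / 4) * ((a\<^sup>2 + (1/2)\<^sup>2) / a) powr (?d / 2 * recip r)" by auto
    also have "\<dots> \<le> max ?K 0 * (1/4) powr (- ?d / 4) * (1 / a) powr (?d / 2 * recip r)"
    proof (intro mult_mono)
      show "(a\<^sup>2 + (1/2)\<^sup>2) powr (- ?d / 4) \<le> (1/4) powr (- ?d / 4)"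
        by (intro powr_mono2') (auto simp: power2_eq_square)
      have "a\<^sup>2 \<le> (1/2)\<^sup>2" using a by (intro power_mono) auto
      then have "a\<^sup>2 + (1/2)\<^sup>2 \<le> 1" by (simp add: power2_eq_square)
      then show "((a\<^sup>2 + (1/2)\<^sup>2) / a) powr (?d / 2 * recip r) \<le> (1 / a) powr (?d / 2 * recip r)"
        using a by (intro powr_mono2 divide_right_mono) auto
    qed auto
    also have "(1 / a) powr (?d / 2 * recip r) = 2 powr (?d / 2 * recip r) * N powr (?d * recip r)"
    proof -
      have "1 / a = 2 * N powr 2" using N by (simp add: a_def powr_minus field_simps)
      then show ?thesis using N by (simp add: powr_mult powr_powr del: powr_numeral)
    qed
    finally have i: "2 powr (- s / 2) * N powr (- s) * a powr (?d / 2 * recip q) * (2 * a) powr recip p * (2 * a) powr (- ?d / 2)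
        \<le> max ?K 0 * (1/4) powr (- ?d / 4) * (2 powr (?d / 2 * recip r) * N powr (?d * recip r))" .
    have 1: "a powr (?d / 2 * recip q) = 2 powr (- (?d / 2 * recip q)) * N powr (- ?d * recip q)"
    proof -
      have e: "a = 2 powr (-1) * N powr (-2)" by (simp add: a_def powr_minus_divide)
      show ?thesis unfolding e using N by (simp add: powr_divide powr_powr powr_mult powr_minus_divide del: powr_numeral)
    qed
    have 2: "(2 * a) powr recip p = N powr (- 2 * recip p)" "(2 * a) powr (- ?d / 2) = N powr ?d"
      using N by (simp_all add: a_def powr_powr)
    have e: "N powr (- s) * N powr (- ?d * recip q) * N powr (- 2 * recip p) * N powr ?d = N powr (?d - ?d * recip q - 2 * recip p - s)"
      by (simp add: algebra_simps flip: powr_add)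
    show ?thesis using i unfolding 1 2 e[symmetric] by (simp only: mult_ac)
  qed
  then have "?d - ?d * recip q - 2 * recip p - s \<le> ?d * recip r"
    by (rule exponent_le_of_bounded[rotated]) auto
  then show ?thesis by simp
qed

text \<open>Gaussians of width \<open>N\<close>, which hardly change before the time \<open>N\<^sup>2\<close>, on a time interval of
  length \<open>N\<^sup>\<theta>\<close> with \<open>\<theta> \<le> 2\<close>.\<close>

lemma bessel_estimate_wide_gaussian:
  assumes \<theta>: "0 \<le> \<theta>" "\<theta> \<le> 2" "\<And>N::real. 1 \<le> N \<Longrightarrow> {- (N powr \<theta> / 2)..N powr \<theta> / 2} \<subseteq> I"
  shows "real CARD('n) * recip q + \<theta> * recip p \<le> real CARD('n) * recip r"
proof -
  let ?d = "real CARD('n)"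
  let ?K = "gaussian_constant C r ?d"
  note K = bessel_estimate_gaussian[OF est pqr I(1)]
  have "(2 powr (- s / 2) * 2 powr (- (?d / 2 * recip q))) * N powr (?d * recip q + \<theta> * recip p - ?d)
     \<le> (?K * 2 powr (?d / 2) * 2 powr (- (?d / 2 * recip r))) * N powr (?d * recip r - ?d)" if N: "1 \<le> N" for N
  proof -
    define a where "a = N powr 2 / 2"
    have a: "0 < a" using N by (simp add: a_def)
    have sq: "1 / sqrt (2 * a) \<le> 1" using N by (simp add: a_def powr_numeral)
    have m: "2 powr (- s / 2) \<le> (1 + (norm \<xi>)\<^sup>2) powr (- s / 2)" if "norm (\<xi> - 0) \<le> 1 / sqrt (2 * a)" for \<xi> :: "real^'n"
      using bracket_lower_bound[of s \<xi> 1] bessel_estimate_regularity_nonneg that sq by simp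
    have \<rho>: "N powr \<theta> / 2 \<le> a" using N \<theta> by (simp add: a_def powr_mono del: powr_numeral)
    have sub: "{0 - N powr \<theta> / 2..0 + N powr \<theta> / 2} \<subseteq> I" using \<theta>(3)[OF N] by simp
    from K[of "N powr \<theta> / 2" a 0 0, OF _ \<rho> sub _ _ m] N
    have i: "2 powr (- s / 2) * a powr (?d / 2 * recip q) * (2 * (N powr \<theta> / 2)) powr recip p * (2 * a) powr (- ?d / 2)
      \<le> ?K * (a\<^sup>2 + 0\<^sup>2) powr (- ?d / 4) * ((a\<^sup>2 + 0\<^sup>2) / a) powr (?d / 2 * recip r)" by auto
    have ap: "a powr e = 2 powr (- e) * N powr (2 * e)" for e
    proof -
      have e: "a = 2 powr (-1) * N powr 2" by (simp add: a_def powr_minus_divide del: powr_numeral)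
      show ?thesis unfolding e using N by (simp add: powr_divide powr_powr powr_mult powr_minus_divide del: powr_numeral)
    qed
    have 1: "(2 * (N powr \<theta> / 2)) powr recip p = N powr (\<theta> * recip p)" "(2 * a) powr (- ?d / 2) = N powr (- ?d)"
      using N by (simp_all add: a_def powr_powr del: powr_numeral)
    have 2: "(a\<^sup>2 + 0\<^sup>2) powr (- ?d / 4) = a powr (- ?d / 2)" "(a\<^sup>2 + 0\<^sup>2) / a = a"
    proof -
      have "a\<^sup>2 + 0\<^sup>2 = a powr 2" using a by simp
      then show "(a\<^sup>2 + 0\<^sup>2) powr (- ?d / 4) = a powr (- ?d / 2)"
        by (simp only: powr_powr) simp
      show "(a\<^sup>2 + 0\<^sup>2) / a = a" using a by (simp add: power2_eq_square)
    qed
    have e: "N powr (?d * recip q) * N powr (\<theta> * recip p) * N powr (- ?d) = N powr (?d * recip q + \<theta> * recip p - ?d)"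
      "N powr (- ?d) * N powr (?d * recip r) = N powr (?d * recip r - ?d)"
      by (simp_all add: algebra_simps flip: powr_add)
    show ?thesis using i unfolding 1 2 ap e[symmetric] by (simp add: mult_ac)
  qed
  then have "?d * recip q + \<theta> * recip p - ?d \<le> ?d * recip r - ?d"
    by (rule exponent_le_of_bounded[rotated]) auto
  then show ?thesis by simp
qed

lemma bessel_estimate_exponents_ordered: "r \<le> q"
proof -
  have "real CARD('n) * recip q + 0 * recip p \<le> real CARD('n) * recip r"
  proof (rule bessel_estimate_wide_gaussian)
    show "{- (N powr 0 / 2)..N powr 0 / 2} \<subseteq> I" if "1 \<le> N" for N using I(2) that by auto
  qed auto
  then have le: "recip q \<le> recip r" by simp
  show ?thesis
  proof (cases "q = top")
    case False
    have q: "1 \<le> enn2real q" using one_le_exponent[OF pqr(2) False] .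
    have "r \<noteq> top" using le q False by (auto simp: recip_finite)
    then have r: "1 \<le> enn2real r" "r = ennreal (enn2real r)" using one_le_exponent[OF pqr(3)] by (auto simp: less_top)
    have "enn2real r \<le> enn2real q" using le q r(1) False \<open>r \<noteq> top\<close> by (simp add: recip_finite field_simps)
    then have "ennreal (enn2real r) \<le> ennreal (enn2real q)" by (rule ennreal_leI)
    then show ?thesis using r(2) False by (simp add: less_top)
  qed simp
qed

lemma bessel_estimate_scaling:
  assumes "I = UNIV"
  shows "2 * recip p + real CARD('n) * recip q \<le> real CARD('n) * recip r"
  using bessel_estimate_wide_gaussian[of 2] assms by simp

end


section \<open>Estimates from modulation spaces\<close>

subsection \<open>Smooth functions of compact support\<close>

lemma iter_partial_complex_translate:
  fixes f :: "real^'n \<Rightarrow> real"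
  assumes f: "smooth f"
  shows "((\<lambda>x. complex_of_real (iter_partial is f (x - k))) has_derivative
      (\<lambda>h. complex_of_real (frechet_derivative (iter_partial is f) (at (x - k)) h))) (at x)"
    and "partial i (\<lambda>x. complex_of_real (iter_partial is f (x - k))) = (\<lambda>x. complex_of_real (iter_partial (i # is) f (x - k)))"
proof -
  have d: "((\<lambda>x. complex_of_real (iter_partial is f (x - k))) has_derivative
      (\<lambda>h. complex_of_real (frechet_derivative (iter_partial is f) (at (x - k)) h))) (at x)" for x
  proof (rule has_derivative_of_real)
    have "(iter_partial is f has_derivative frechet_derivative (iter_partial is f) (at (x - k))) (at (x - k))"
      using smooth_differentiable[OF f] frechet_derivative_works by blast
    moreover have "((\<lambda>x. x - k) has_derivative (\<lambda>h. h)) (at x)" by (auto intro!: derivative_eq_intros)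
    ultimately show "((\<lambda>x. iter_partial is f (x - k)) has_derivative frechet_derivative (iter_partial is f) (at (x - k))) (at x)"
      by (rule has_derivative_compose[rotated])
  qed
  show "((\<lambda>x. complex_of_real (iter_partial is f (x - k))) has_derivative
      (\<lambda>h. complex_of_real (frechet_derivative (iter_partial is f) (at (x - k)) h))) (at x)" by (rule d)
  show "partial i (\<lambda>x. complex_of_real (iter_partial is f (x - k))) = (\<lambda>x. complex_of_real (iter_partial (i # is) f (x - k)))"
    by (rule ext, subst partial_has_derivative[OF d]) (simp add: partial_def)
qed

lemma smooth_compact_support_schwartz:
  fixes f :: "real^'n \<Rightarrow> complex"
  assumes f: "smooth f" and supp: "\<And>x. r < norm x \<Longrightarrow> f x = 0"
  shows "f \<in> schwartz"
proof -
  have z: "iter_partial is f x = 0" if "x \<notin> cball 0 r" for "is" x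
    using that
  proof (induction "is" arbitrary: x)
    case Nil
    then show ?case using supp by simp
  next
    case (Cons i "is")
    then show ?case using partial_eq_0_outside_closed[of "cball 0 r" "iter_partial is f" x i] by auto
  qed
  have "bounded (range (\<lambda>x. (1 + norm x) ^ N *\<^sub>R iter_partial is f x))" for N "is"
  proof -
    have "compact ((\<lambda>x. (1 + norm x) ^ N *\<^sub>R iter_partial is f x) ` cball 0 r)"
      by (intro compact_continuous_image continuous_intros smooth_continuous f compact_cball)
    then have "bounded (insert 0 ((\<lambda>x. (1 + norm x) ^ N *\<^sub>R iter_partial is f x) ` cball 0 r))"
      by (simp add: compact_imp_bounded)
    then show ?thesis by (rule bounded_subset) (use z in force)
  qed
  then show ?thesis using f by (simp add: schwartz_def)
qed

text \<open>The algebra generated by the translates of \<open>f\<close> and of its partial derivatives, as complex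
  functions. The function \<open>0\<close> is added so that empty sums belong to it.\<close>

definition translate_algebra :: "(real^'n \<Rightarrow> real) \<Rightarrow> (real^'n \<Rightarrow> complex) set" where
  "translate_algebra f = generated_algebra (insert (\<lambda>x. 0) {\<lambda>x. complex_of_real (iter_partial is f (x - k)) |is k. True})"

lemma translate_algebra_smooth:
  fixes f :: "real^'n \<Rightarrow> real"
  assumes f: "smooth f" and g: "g \<in> translate_algebra f"
  shows "smooth g"
proof -
  have *: "(\<forall>x. g differentiable (at x)) \<and> (\<forall>i. partial i g \<in> translate_algebra f)" if "g \<in> translate_algebra f" for g
    using that unfolding translate_algebra_def
  proof (rule generated_algebra_partial)
    fix g :: "real^'n \<Rightarrow> complex" and x and i :: 'n assume "g \<in> insert (\<lambda>x. 0) {\<lambda>x. complex_of_real (iter_partial is f (x - k)) |is k. True}"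
    then consider "g = (\<lambda>x. 0)" | "is" k where "g = (\<lambda>x. complex_of_real (iter_partial is f (x - k)))" by auto
    note cases = this
    have zero: "partial i (\<lambda>x::real^'n. 0::complex) = (\<lambda>x. 0)"
      by (rule ext, subst partial_has_derivative[OF has_derivative_const]) simp
    from cases show "g differentiable (at x)"
      by cases (use iter_partial_complex_translate(1)[OF f] in \<open>auto intro: differentiableI\<close>)
    from cases show "partial i g \<in> generated_algebra (insert (\<lambda>x. 0) {\<lambda>x. complex_of_real (iter_partial is f (x - k)) |is k. True})"
    proof cases
      case 1
      then show ?thesis using zero by (auto intro: generated_algebra.base)
    next
      case (2 "is" k)
      then show ?thesis
        unfolding 2 iter_partial_complex_translate(2)[OF f] by (intro generated_algebra.base) blast
    qed
  qed
  show ?thesis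
    by (rule closed_under_partial_smooth(2)[of g "translate_algebra f"]) (use g * in auto)
qed

lemma translate_algebra_translate: "(\<lambda>x. complex_of_real (f (x - k))) \<in> translate_algebra f"
  unfolding translate_algebra_def
  by (rule generated_algebra.base) (auto intro!: exI[of _ "[]"])

lemma translate_algebra_mult:
  "g \<in> translate_algebra f \<Longrightarrow> h \<in> translate_algebra f \<Longrightarrow> (\<lambda>x. g x * h x) \<in> translate_algebra f"
  unfolding translate_algebra_def by (rule generated_algebra.mult)

lemma translate_algebra_sum:
  assumes "finite K" "\<And>k. k \<in> K \<Longrightarrow> g k \<in> translate_algebra f"
  shows "(\<lambda>x. \<Sum>k\<in>K. g k x) \<in> translate_algebra f"
  using assms
proof (induction K rule: finite_induct)
  case empty
  then show ?case by (auto simp: translate_algebra_def intro: generated_algebra.base)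
next
  case (insert k K)
  then show ?case by (auto simp: translate_algebra_def intro: generated_algebra.add)
qed

lemma inv_fourier_translate:
  fixes u :: "real^'n \<Rightarrow> complex"
  assumes u: "u \<in> borel_measurable borel"
  shows "inv_fourier (\<lambda>\<xi>. u (\<xi> - k)) x = cis (x \<bullet> k) * inv_fourier u x"
proof -
  have "(LINT \<xi>|lborel. cis (x \<bullet> \<xi>) * u (\<xi> - k)) = (LINT \<xi>|lborel. cis (x \<bullet> (k + \<xi>)) * u (k + \<xi> - k))"
    using u cis_inner_measurable[of x]
    by (intro integral_shift[symmetric] borel_measurable_times) (auto simp: inner_commute)
  also have "\<dots> = cis (x \<bullet> k) * (LINT \<xi>|lborel. cis (x \<bullet> \<xi>) * u \<xi>)"
    by (simp add: inner_add_right cis_mult[symmetric] mult.assoc flip: integral_mult_right_zero)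
  finally show ?thesis by (simp add: inv_fourier_def)
qed

lemma
  fixes S :: "'a set"
  assumes "finite S"
  shows finite_vec: "finite {k :: 'a^'n. \<forall>i. k $ i \<in> S}"
    and card_vec: "card {k :: 'a^'n. \<forall>i. k $ i \<in> S} = card S ^ CARD('n)"
proof -
  have inj: "inj_on ($) {k :: 'a^'n. \<forall>i. k $ i \<in> S}" by (auto simp: inj_on_def vec_eq_iff)
  have img: "($) ` {k :: 'a^'n. \<forall>i. k $ i \<in> S} = (UNIV \<rightarrow>\<^sub>E S)"
  proof (intro equalityI subsetI)
    fix f :: "'n \<Rightarrow> 'a" assume "f \<in> UNIV \<rightarrow>\<^sub>E S"
    then have "($) (\<chi> i. f i) = f" "\<forall>i. (\<chi> i. f i) $ i \<in> S" by auto
    then show "f \<in> ($) ` {k :: 'a^'n. \<forall>i. k $ i \<in> S}" by (intro image_eqI[of _ _ "\<chi> i. f i"]) auto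
  qed auto
  have "bij_betw ($) {k :: 'a^'n. \<forall>i. k $ i \<in> S} (UNIV \<rightarrow>\<^sub>E S)"
    using inj img by (simp add: bij_betw_def)
  then show "finite {k :: 'a^'n. \<forall>i. k $ i \<in> S}" "card {k :: 'a^'n. \<forall>i. k $ i \<in> S} = card S ^ CARD('n)"
    using assms by (auto simp: bij_betw_finite bij_betw_same_card card_funcsetE finite_PiE)
qed

lemma
  assumes "0 \<le> (N::real)"
  shows finite_int_interval: "finite {x \<in> \<int>. \<bar>x\<bar> \<le> N}"
    and card_int_interval: "card {x \<in> \<int>. \<bar>x\<bar> \<le> N} = 2 * nat \<lfloor>N\<rfloor> + 1"
proof -
  have eq: "{x \<in> \<int>. \<bar>x\<bar> \<le> N} = real_of_int ` {-\<lfloor>N\<rfloor>..\<lfloor>N\<rfloor>}"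
  proof (intro equalityI subsetI)
    fix x assume "x \<in> {x \<in> \<int>. \<bar>x\<bar> \<le> N}"
    then obtain z where "x = real_of_int z" "\<bar>real_of_int z\<bar> \<le> N" by (auto elim: Ints_cases)
    moreover from this have "z \<le> \<lfloor>N\<rfloor>" "- z \<le> \<lfloor>N\<rfloor>" by (auto simp: le_floor_iff)
    ultimately show "x \<in> real_of_int ` {-\<lfloor>N\<rfloor>..\<lfloor>N\<rfloor>}" by auto
  next
    fix x assume "x \<in> real_of_int ` {-\<lfloor>N\<rfloor>..\<lfloor>N\<rfloor>}"
    then obtain z where "x = real_of_int z" "- z \<le> \<lfloor>N\<rfloor>" "z \<le> \<lfloor>N\<rfloor>" by auto
    then show "x \<in> {x \<in> \<int>. \<bar>x\<bar> \<le> N}" by (auto simp: le_floor_iff)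
  qed
  show "finite {x \<in> \<int>. \<bar>x\<bar> \<le> N}" unfolding eq by simp
  show "card {x \<in> \<int>. \<bar>x\<bar> \<le> N} = 2 * nat \<lfloor>N\<rfloor> + 1"
    unfolding eq using assms by (subst card_image) (auto simp: inj_on_def nat_add_distrib nat_mult_distrib)
qed

text \<open>The lattice points in the closed cube with half side \<open>N\<close>.\<close>

definition lattice_cube :: "real \<Rightarrow> (real^'n) set" where
  "lattice_cube N = {k \<in> int_lattice. \<forall>i. \<bar>k $ i\<bar> \<le> N}"

lemma lattice_cube_eq: "lattice_cube N = {k. \<forall>i. k $ i \<in> {x \<in> \<int>. \<bar>x\<bar> \<le> N}}"
  by (auto simp: lattice_cube_def int_lattice_def)

lemma finite_lattice_cube: "0 \<le> N \<Longrightarrow> finite (lattice_cube N :: (real^'n) set)"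
  unfolding lattice_cube_eq by (intro finite_vec finite_int_interval)

lemma card_lattice_cube:
  assumes "0 \<le> N"
  shows "card (lattice_cube N :: (real^'n) set) = (2 * nat \<lfloor>N\<rfloor> + 1) ^ CARD('n)"
  unfolding lattice_cube_eq by (simp only: card_vec[OF finite_int_interval[OF assms]] card_int_interval[OF assms])

lemma norm_le_of_components:
  fixes x :: "real^'n"
  assumes "\<And>i. \<bar>x $ i\<bar> \<le> L"
  shows "norm x \<le> real CARD('n) * L"
proof -
  have "norm x \<le> (\<Sum>i\<in>UNIV. \<bar>x $ i\<bar>)" by (rule norm_le_l1_cart)
  also have "\<dots> \<le> real CARD('n) * L" by (rule sum_bounded_above) (use assms in auto)
  finally show ?thesis .
qed

text \<open>The bound \<open>V\<close> is uniform for all functions with the same bound on their decay.\<close>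

lemma Lp_norm_decay_bounded:
  fixes p :: ennreal
  assumes p: "1 \<le> p" and C: "0 \<le> C"
  obtains V where "0 \<le> V" "\<And>g :: real^'n \<Rightarrow> complex. \<lbrakk>g \<in> borel_measurable borel; \<And>x. (1 + norm x) ^ (2 * CARD('n)) * norm (g x) \<le> C\<rbrakk>
    \<Longrightarrow> Lp_norm p lborel (\<lambda>x. ennreal (norm (g x))) \<le> ennreal V"
proof (cases "p = top")
  case True
  show ?thesis
  proof (rule that[OF C])
    fix g :: "real^'n \<Rightarrow> complex" assume g: "g \<in> borel_measurable borel" "\<And>x. (1 + norm x) ^ (2 * CARD('n)) * norm (g x) \<le> C"
    have "norm (g x) \<le> C" for x
    proof -
      have "1 * norm (g x) \<le> (1 + norm x) ^ (2 * CARD('n)) * norm (g x)" by (intro mult_right_mono one_le_power) auto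
      then show ?thesis using g(2)[of x] by simp
    qed
    then show "Lp_norm p lborel (\<lambda>x. ennreal (norm (g x))) \<le> ennreal C"
      using True g(1) by (auto simp: Lp_norm_top intro!: esssup_I ennreal_leI)
  qed
next
  case False
  define a where "a = enn2real p"
  have a: "1 \<le> a" using one_le_exponent[OF p False] by (simp add: a_def)
  have ra: "recip p = 1 / a" using False by (simp add: recip_finite a_def)
  let ?w = "\<lambda>x::real^'n. 1 / (1 + norm x) ^ (2 * CARD('n))"
  define M where "M = (LINT x|lborel. ?w x)"
  have M: "0 \<le> M" by (simp add: M_def)
  show ?thesis
  proof (rule that[of "(C powr a * M) powr (1 / a)"])
    fix g :: "real^'n \<Rightarrow> complex" assume g: "g \<in> borel_measurable borel" "\<And>x. (1 + norm x) ^ (2 * CARD('n)) * norm (g x) \<le> C"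
    have "norm (g x) powr a \<le> C powr a * ?w x" for x
    proof -
      have w: "0 < ?w x" "?w x \<le> 1" by (auto simp: add_pos_nonneg)
      have "norm (g x) \<le> C * ?w x" using g(2)[of x] by (simp add: field_simps add_pos_nonneg)
      then have "norm (g x) powr a \<le> (C * ?w x) powr a" using a by (intro powr_mono2) auto
      also have "\<dots> = C powr a * ?w x powr a" using w C by (intro powr_mult)
      also have "\<dots> \<le> C powr a * ?w x powr 1" using a w by (intro mult_left_mono powr_mono') auto
      finally show ?thesis using w by simp
    qed
    then have "(\<integral>\<^sup>+x. ennreal (norm (g x) powr a) \<partial>lborel) \<le> (\<integral>\<^sup>+x. ennreal (C powr a * ?w x) \<partial>lborel)"
      by (intro nn_integral_mono ennreal_leI)
    also have "\<dots> = ennreal (LINT x|lborel. C powr a * ?w x)"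
      by (intro nn_integral_eq_integral integrable_mult_right integrable_decay) auto
    also have "(LINT x|lborel. C powr a * ?w x) = C powr a * M"
      unfolding M_def by (rule integral_mult_right_zero)
    finally have "ennpowr (\<integral>\<^sup>+x. ennreal (norm (g x) powr a) \<partial>lborel) (1 / a) \<le> ennpowr (ennreal (C powr a * M)) (1 / a)"
      using a by (intro ennpowr_mono) auto
    then show "Lp_norm p lborel (\<lambda>x. ennreal (norm (g x))) \<le> ennreal ((C powr a * M) powr (1 / a))"
      using M by (simp add: Lp_norm_finite[OF False] ra ennpowr_ennreal flip: a_def)
  qed simp
qed

subsection \<open>Sums of frequency blocks\<close>

lemma cube_partition_support:
  fixes \<sigma> :: "real^'n \<Rightarrow> real"
  assumes "cube_partition \<sigma>"
  obtains L where "0 \<le> L" "\<And>\<xi> i. \<sigma> \<xi> \<noteq> 0 \<Longrightarrow> \<bar>\<xi> $ i\<bar> \<le> L"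
proof -
  obtain R where R: "{\<xi>. \<sigma> \<xi> \<noteq> 0} \<subseteq> (*\<^sub>R) R ` unit_cube 0"
    using assms by (auto simp: cube_partition_def)
  have "\<bar>\<xi> $ i\<bar> \<le> \<bar>R\<bar>" if \<xi>: "\<sigma> \<xi> \<noteq> 0" for \<xi> :: "real^'n" and i
  proof -
    obtain z where z: "z \<in> unit_cube 0" "\<xi> = R *\<^sub>R z" using R \<xi> by blast
    have "\<bar>z $ i\<bar> \<le> 1" using z(1) by (auto simp: unit_cube_def abs_le_iff) (smt (verit) field_sum_of_halves)+
    then show ?thesis by (simp add: z(2) abs_mult mult_left_le)
  qed
  then show ?thesis using that[of "\<bar>R\<bar>"] by auto
qed

lemma cube_partition_integral_pos:
  fixes \<sigma> :: "real^'n \<Rightarrow> real"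
  assumes \<sigma>: "cube_partition \<sigma>" and int: "integrable lborel \<sigma>"
  shows "0 < (LINT \<xi>|lborel. \<sigma> \<xi>)"
proof -
  have nonneg: "0 \<le> \<sigma> \<xi>" for \<xi> using \<sigma> by (simp add: cube_partition_def)
  have "\<exists>\<xi>. \<sigma> \<xi> \<noteq> 0"
  proof (rule ccontr)
    assume "\<nexists>\<xi>. \<sigma> \<xi> \<noteq> 0"
    then have "((\<lambda>k. 0) has_sum (1::real)) (int_lattice :: (real^'n) set)"
      using \<sigma> by (auto simp: cube_partition_def)
    then show False using has_sum_unique[OF has_sum_0[of int_lattice "\<lambda>_. 0::real"]] by fastforce
  qed
  then obtain \<xi>0 where \<xi>0: "0 < \<sigma> \<xi>0" using nonneg by (metis less_eq_real_def)
  have "smooth \<sigma>" using \<sigma> by (simp add: cube_partition_def)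
  then have "continuous_on UNIV \<sigma>" using smooth_continuous[of \<sigma> UNIV "[]"] by simp
  then have "open (\<sigma> -` {\<sigma> \<xi>0 / 2<..})" by (intro open_vimage) auto
  then obtain e where e: "0 < e" "ball \<xi>0 e \<subseteq> \<sigma> -` {\<sigma> \<xi>0 / 2<..}"
    by (rule openE[of _ \<xi>0]) (use \<xi>0 in auto)
  have "0 < \<sigma> \<xi>0 / 2 * measure lborel (ball \<xi>0 e)" using \<xi>0 content_ball_pos[OF e(1)] by simp
  also have "\<dots> = (LINT \<xi>|lborel. \<sigma> \<xi>0 / 2 * indicator (ball \<xi>0 e) \<xi>)" by simp
  also have "\<dots> \<le> (LINT \<xi>|lborel. \<sigma> \<xi>)"
  proof (rule integral_mono[OF _ int])
    show "integrable lborel (\<lambda>\<xi>. \<sigma> \<xi>0 / 2 * indicator (ball \<xi>0 e) \<xi>)"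
      using emeasure_lborel_ball_finite[of \<xi>0 e] by (intro integrable_mult_right integrable_real_indicator) auto
    show "\<sigma> \<xi>0 / 2 * indicator (ball \<xi>0 e) \<xi> \<le> \<sigma> \<xi>" for \<xi>
      using e(2) nonneg[of \<xi>] by (auto simp: indicator_def less_imp_le)
  qed
  finally show ?thesis .
qed

text \<open>The sum of the functions \<open>\<sigma>\<^sub>k\<close> over \<open>k \<in> K\<close>, only meant for finite \<open>K\<close>.\<close>

definition block_sum :: "(real^'n \<Rightarrow> real) \<Rightarrow> (real^'n) set \<Rightarrow> real^'n \<Rightarrow> complex" where
  "block_sum \<sigma> K \<xi> = (\<Sum>k\<in>K. complex_of_real (\<sigma> (\<xi> - k)))"

text \<open>The centres of the blocks that may overlap one of the blocks with centre in \<open>K\<close>, if \<open>\<sigma>\<close>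
  is supported in the cube with half side \<open>L\<close>.\<close>

definition neighbours :: "real \<Rightarrow> (real^'n) set \<Rightarrow> (real^'n) set" where
  "neighbours L K = {k \<in> int_lattice. \<exists>j\<in>K. j - k \<in> lattice_cube (2 * L)}"

context
  fixes \<sigma> :: "real^'n::finite \<Rightarrow> real" and L :: real
  assumes \<sigma>: "cube_partition \<sigma>" and L: "0 \<le> L" "\<And>\<xi> i. \<sigma> \<xi> \<noteq> 0 \<Longrightarrow> \<bar>\<xi> $ i\<bar> \<le> L"
begin

lemma block_smooth: "smooth \<sigma>" and block_nonneg: "0 \<le> \<sigma> \<xi>"
  using \<sigma> by (auto simp: cube_partition_def)

lemma block_support: "\<sigma> (\<xi> - k) \<noteq> 0 \<Longrightarrow> norm (\<xi> - k) \<le> real CARD('n) * L"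
  by (rule norm_le_of_components) (rule L(2))

lemma block_translate_schwartz: "(\<lambda>\<xi>. complex_of_real (\<sigma> (\<xi> - k))) \<in> schwartz"
proof (rule smooth_compact_support_schwartz)
  show "smooth (\<lambda>\<xi>. complex_of_real (\<sigma> (\<xi> - k)))"
    by (rule translate_algebra_smooth[OF block_smooth translate_algebra_translate])
  fix \<xi> :: "real^'n" assume "norm k + real CARD('n) * L < norm \<xi>"
  then have "\<not> norm (\<xi> - k) \<le> real CARD('n) * L" using norm_triangle_sub[of \<xi> k] by linarith
  then show "complex_of_real (\<sigma> (\<xi> - k)) = 0" using block_support by auto
qed

lemma block_integrable: "integrable lborel \<sigma>"
  using schwartz_integrable[OF block_translate_schwartz[of 0]] by (simp only: complex_of_real_integrable_eq diff_zero)

lemma block_integral_pos: "0 < (LINT \<xi>|lborel. \<sigma> \<xi>)"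
  by (rule cube_partition_integral_pos[OF \<sigma> block_integrable])

lemma block_sum_schwartz:
  assumes K: "finite K"
  shows "block_sum \<sigma> K \<in> schwartz"
proof (rule smooth_compact_support_schwartz)
  show "smooth (block_sum \<sigma> K)" unfolding block_sum_def[abs_def]
    by (rule translate_algebra_smooth[OF block_smooth], rule translate_algebra_sum[OF K], rule translate_algebra_translate)
  fix \<xi> :: "real^'n" assume *: "(\<Sum>k\<in>K. norm k) + real CARD('n) * L < norm \<xi>"
  have "\<sigma> (\<xi> - k) = 0" if "k \<in> K" for k :: "real^'n"
  proof -
    have "norm k \<le> (\<Sum>k\<in>K. norm k)" using K that by (intro member_le_sum) auto
    then have "\<not> norm (\<xi> - k) \<le> real CARD('n) * L" using * norm_triangle_sub[of \<xi> k] by linarith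
    then show ?thesis using block_support by blast
  qed
  then show "block_sum \<sigma> K \<xi> = 0" by (simp add: block_sum_def)
qed

lemma block_product_schwartz: "(\<lambda>\<xi>. complex_of_real (\<sigma> (\<xi> - 0)) * complex_of_real (\<sigma> (\<xi> - l))) \<in> schwartz"
proof (rule smooth_compact_support_schwartz)
  show "smooth (\<lambda>\<xi>. complex_of_real (\<sigma> (\<xi> - 0)) * complex_of_real (\<sigma> (\<xi> - l)))"
    by (rule translate_algebra_smooth[OF block_smooth], rule translate_algebra_mult; rule translate_algebra_translate)
  fix \<xi> :: "real^'n" assume "real CARD('n) * L < norm \<xi>"
  then show "complex_of_real (\<sigma> (\<xi> - 0)) * complex_of_real (\<sigma> (\<xi> - l)) = 0"
    using block_support[of \<xi> 0] by fastforce
qed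

text \<open>Two blocks overlap only if the difference of their centres lies in \<open>lattice_cube (2 * L)\<close>.\<close>

lemma block_overlap:
  assumes "\<sigma> (\<xi> - k) * \<sigma> (\<xi> - j) \<noteq> 0" "k \<in> int_lattice" "j \<in> int_lattice"
  shows "j - k \<in> lattice_cube (2 * L)"
proof -
  have "\<bar>(j - k) $ i\<bar> \<le> 2 * L" for i
    using L(2)[of "\<xi> - k" i] L(2)[of "\<xi> - j" i] assms(1) by auto
  moreover have "j - k \<in> int_lattice" using assms(2,3) by (auto simp: int_lattice_def)
  ultimately show ?thesis by (simp add: lattice_cube_def)
qed

text \<open>The transform of \<open>box \<sigma> k f\<close> is the sum of the products \<open>\<sigma>\<^sub>k \<sigma>\<^sub>j\<close> over \<open>j \<in> K\<close>. Such a product is a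
  translate of the function \<open>H (j - k)\<close> below, and only finitely many of these do not vanish. Hence the
  bound does not depend on \<open>k\<close> and \<open>K\<close>.\<close>

lemma box_block_sum_bound:
  fixes p :: ennreal
  assumes p: "1 \<le> p"
  obtains V where "0 \<le> V"
    "\<And>K k. \<lbrakk>finite K; K \<subseteq> int_lattice; k \<in> int_lattice\<rbrakk> \<Longrightarrow> distr_Lp_norm p (box \<sigma> k (spectral (block_sum \<sigma> K))) \<le> ennreal V"
    "\<And>K k. \<lbrakk>finite K; K \<subseteq> int_lattice; k \<in> int_lattice; k \<notin> neighbours L K\<rbrakk>
      \<Longrightarrow> distr_Lp_norm p (box \<sigma> k (spectral (block_sum \<sigma> K))) = 0"
proof -
  let ?D = "lattice_cube (2 * L) :: (real^'n) set"
  have D: "finite ?D" using L(1) by (intro finite_lattice_cube) simp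
  define H where "H l \<xi> = complex_of_real (\<sigma> (\<xi> - 0)) * complex_of_real (\<sigma> (\<xi> - l))" for l \<xi>
  have H: "H l \<in> schwartz" for l unfolding H_def[abs_def] by (rule block_product_schwartz)
  have "\<exists>C. \<forall>x. (1 + norm x) ^ (2 * CARD('n)) * norm (inv_fourier (H l) x) \<le> C" for l
    using schwartz_inv_fourier_decay[OF H[of l]] by metis
  then obtain C where C: "\<And>l x. (1 + norm x) ^ (2 * CARD('n)) * norm (inv_fourier (H l) x) \<le> C l" by metis
  have C0: "0 \<le> C l" for l using order_trans[OF _ C[of 0 l]] by simp
  obtain V where V: "0 \<le> V" "\<And>g :: real^'n \<Rightarrow> complex. \<lbrakk>g \<in> borel_measurable borel; \<And>x. (1 + norm x) ^ (2 * CARD('n)) * norm (g x) \<le> (\<Sum>l\<in>?D. C l)\<rbrakk>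
    \<Longrightarrow> Lp_norm p lborel (\<lambda>x. ennreal (norm (g x))) \<le> ennreal V"
    using Lp_norm_decay_bounded[OF p, of "\<Sum>l\<in>?D. C l"] C0 by (metis sum_nonneg)
  have main: "distr_Lp_norm p (box \<sigma> k (spectral (block_sum \<sigma> K))) \<le> ennreal V \<and>
      (k \<notin> neighbours L K \<longrightarrow> distr_Lp_norm p (box \<sigma> k (spectral (block_sum \<sigma> K))) = 0)"
    if K: "finite K" "K \<subseteq> int_lattice" and k: "k \<in> int_lattice" for K k
  proof -
    let ?m = "\<lambda>\<xi>. complex_of_real (\<sigma> (\<xi> - k))"
    let ?J = "{j \<in> K. j - k \<in> ?D}"
    define G where "G = (\<lambda>\<xi>. ?m \<xi> * block_sum \<sigma> K \<xi>)"
    have G_eq: "G = (\<lambda>\<xi>. \<Sum>j\<in>?J. H (j - k) (\<xi> - k))"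
    proof
      fix \<xi>
      have "G \<xi> = (\<Sum>j\<in>K. H (j - k) (\<xi> - k))"
        by (simp add: G_def block_sum_def H_def sum_distrib_left)
      also have "\<dots> = (\<Sum>j\<in>?J. H (j - k) (\<xi> - k))"
      proof (rule sum.mono_neutral_right)
        show "\<forall>j\<in>K - ?J. H (j - k) (\<xi> - k) = 0"
        proof
          fix j assume j: "j \<in> K - ?J"
          then have "\<sigma> (\<xi> - k) * \<sigma> (\<xi> - j) = 0" using block_overlap[of \<xi> k j] k K(2) by blast
          then show "H (j - k) (\<xi> - k) = 0" by (auto simp: H_def)
        qed
      qed (use K in auto)
      finally show "G \<xi> = (\<Sum>j\<in>?J. H (j - k) (\<xi> - k))" .
    qed
    have Hi: "integrable lborel (\<lambda>\<xi>. H l (\<xi> - k))" for l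
      using integrable_shift[OF schwartz_integrable[OF H[of l]], of "- k"] by simp
    have Gi: "integrable lborel G" unfolding G_eq by (intro Bochner_Integration.integrable_sum Hi)
    have mb: "norm (?m \<xi>) \<le> schwartz_norm 0 ?m * (1 + norm \<xi>) ^ 0" for \<xi>
      using norm_le_schwartz_norm[OF block_translate_schwartz[of k]] by simp
    have rep: "represents (inv_fourier G) (box \<sigma> k (spectral (block_sum \<sigma> K)))"
      unfolding box_def G_def
      by (rule represents_fourier_multiplier[OF block_sum_schwartz[OF K(1)] schwartz_measurable[OF block_translate_schwartz] mb])
         (use Gi in \<open>simp add: G_def\<close>)
    then have le: "distr_Lp_norm p (box \<sigma> k (spectral (block_sum \<sigma> K))) \<le> Lp_norm p lborel (\<lambda>x. ennreal (norm (inv_fourier G x)))"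
      unfolding distr_Lp_norm_def by (intro INF_lower) simp
    have inv: "inv_fourier G x = (\<Sum>j\<in>?J. cis (x \<bullet> k) * inv_fourier (H (j - k)) x)" for x
    proof -
      have "inv_fourier G x = (\<Sum>j\<in>?J. inv_fourier (\<lambda>\<xi>. H (j - k) (\<xi> - k)) x)"
        unfolding inv_fourier_def G_eq sum_distrib_left
      proof (subst Bochner_Integration.integral_sum)
        show "integrable lborel (\<lambda>\<xi>. cis (x \<bullet> \<xi>) * H (j - k) (\<xi> - k))" for j
          using integrable_cis_mult[OF Hi, of x "j - k"] by (simp add: inner_commute)
      qed (simp add: scaleR_sum_right)
      then show ?thesis by (simp add: inv_fourier_translate[OF schwartz_measurable[OF H]])
    qed
    have "(1 + norm x) ^ (2 * CARD('n)) * norm (inv_fourier G x) \<le> (\<Sum>l\<in>?D. C l)" for x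
    proof -
      have "norm (inv_fourier G x) \<le> (\<Sum>j\<in>?J. norm (inv_fourier (H (j - k)) x))"
        unfolding inv by (rule order_trans[OF norm_sum]) (simp add: norm_mult)
      then have "(1 + norm x) ^ (2 * CARD('n)) * norm (inv_fourier G x) \<le> (1 + norm x) ^ (2 * CARD('n)) * (\<Sum>j\<in>?J. norm (inv_fourier (H (j - k)) x))"
        by (rule mult_left_mono) simp
      also have "\<dots> \<le> (\<Sum>j\<in>?J. C (j - k))" unfolding sum_distrib_left by (intro sum_mono C)
      also have "\<dots> = (\<Sum>l\<in>(\<lambda>j. j - k) ` ?J. C l)" by (subst sum.reindex) (auto simp: inj_on_def)
      also have "\<dots> \<le> (\<Sum>l\<in>?D. C l)" by (rule sum_mono2[OF D]) (auto simp: C0)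
      finally show ?thesis .
    qed
    with V(2)[OF inv_fourier_measurable[OF Gi]] le have "distr_Lp_norm p (box \<sigma> k (spectral (block_sum \<sigma> K))) \<le> ennreal V"
      by (meson order_trans)
    moreover have "distr_Lp_norm p (box \<sigma> k (spectral (block_sum \<sigma> K))) = 0" if none: "k \<notin> neighbours L K"
    proof -
      have "?J = {}" using none k by (auto simp: neighbours_def)
      then have z: "norm (inv_fourier G x) = 0" for x by (simp only: inv sum.empty norm_zero)
      have "Lp_norm p lborel (\<lambda>x::real^'n. ennreal (norm (0::complex))) = 0"
      proof (cases "p = top")
        case True
        have "esssup lborel (\<lambda>x::real^'n. 0::ennreal) \<le> 0" by (rule esssup_I) auto
        then show ?thesis using True by (simp add: Lp_norm_top)
      next
        case False
        then show ?thesis using one_le_exponent[OF p False] by (simp add: Lp_norm_finite ennpowr_def)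
      qed
      then show ?thesis using le by (simp add: z)
    qed
    ultimately show ?thesis by blast
  qed
  show ?thesis by (rule that[OF V(1)]) (use main in blast)+
qed

text \<open>In the norm of \<open>block_sum \<sigma> K\<close> at most \<open>n\<close> terms do not vanish, with weights at most \<open>T\<close>.\<close>

lemma modulation_norm_block_sum:
  fixes p q :: ennreal and s :: real
  assumes p: "1 \<le> p" and q: "1 \<le> q"
  obtains V where "0 \<le> V" "\<And>K T n. \<lbrakk>finite K; K \<subseteq> int_lattice; 0 \<le> T; 0 < n;
      \<And>k. k \<in> neighbours L K \<Longrightarrow> japanese k powr s \<le> T; real (card (neighbours L K)) \<le> n\<rbrakk> \<Longrightarrow>
      spectral (block_sum \<sigma> K) \<in> modulation_space \<sigma> s p q \<and>
      modulation_norm \<sigma> s p q (spectral (block_sum \<sigma> K)) \<le> ennreal (V * T * n powr recip q)"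
proof -
  obtain V where V: "0 \<le> V"
    "\<And>K k. \<lbrakk>finite K; K \<subseteq> int_lattice; k \<in> int_lattice\<rbrakk> \<Longrightarrow> distr_Lp_norm p (box \<sigma> k (spectral (block_sum \<sigma> K))) \<le> ennreal V"
    "\<And>K k. \<lbrakk>finite K; K \<subseteq> int_lattice; k \<in> int_lattice; k \<notin> neighbours L K\<rbrakk>
      \<Longrightarrow> distr_Lp_norm p (box \<sigma> k (spectral (block_sum \<sigma> K))) = 0"
    using box_block_sum_bound[OF p] by metis
  show ?thesis
  proof (rule that[OF V(1)])
    fix K :: "(real^'n) set" and T n :: real
    assume K: "finite K" "K \<subseteq> int_lattice" and T0: "0 \<le> T" and n0: "0 < n"
      and T: "\<And>k. k \<in> neighbours L K \<Longrightarrow> japanese k powr s \<le> T"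
      and n: "real (card (neighbours L K)) \<le> n"
    let ?f = "spectral (block_sum \<sigma> K)"
    let ?K' = "neighbours L K"
    have "?K' \<subseteq> (\<lambda>(j, l). j - l) ` (K \<times> lattice_cube (2 * L))"
    proof
      fix k assume "k \<in> ?K'"
      then obtain j where "j \<in> K" "j - k \<in> lattice_cube (2 * L)" by (auto simp: neighbours_def)
      moreover have "k = j - (j - k)" by simp
      ultimately show "k \<in> (\<lambda>(j, l). j - l) ` (K \<times> lattice_cube (2 * L))" by force
    qed
    then have K': "finite ?K'"
      by (rule finite_subset) (intro finite_imageI finite_cartesian_product finite_lattice_cube K(1), use L(1) in simp)
    have "modulation_norm \<sigma> s p q ?f \<le> ennreal (V * T * n powr recip q)"
    proof (cases "q = top")
      case True
      have "ennreal (japanese k powr s) * distr_Lp_norm p (box \<sigma> k ?f) \<le> ennreal (V * T)" if k: "k \<in> int_lattice" for k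
      proof (cases "k \<in> ?K'")
        case True
        then have "ennreal (japanese k powr s) * distr_Lp_norm p (box \<sigma> k ?f) \<le> ennreal T * ennreal V"
          using T K k by (intro mult_mono ennreal_leI V) auto
        then show ?thesis using T0 V(1) by (simp add: ennreal_mult mult.commute)
      next
        case False
        then have "distr_Lp_norm p (box \<sigma> k ?f) = 0" by (rule V(3)[OF K k])
        then show ?thesis by simp
      qed
      then show ?thesis using True n0 by (auto simp: modulation_norm_def intro!: SUP_least)
    next
      case False
      define b where "b = enn2real q"
      have b: "1 \<le> b" using one_le_exponent[OF q False] by (simp add: b_def)
      have rb: "recip q = 1 / b" using False by (simp add: recip_finite b_def)
      let ?g = "\<lambda>k. ennreal (japanese k powr (b * s)) * ennpowr (distr_Lp_norm p (box \<sigma> k ?f)) b"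
      have "(\<integral>\<^sup>+k. ?g k \<partial>count_space int_lattice) = (\<Sum>k\<in>?K'. ?g k)"
      proof (rule nn_integral_count_space')
        show "?g k = 0" if "k \<in> int_lattice" "k \<notin> ?K'" for k
        proof -
          have "distr_Lp_norm p (box \<sigma> k ?f) = 0" using that by (rule V(3)[OF K])
          then show ?thesis using b by (simp add: ennpowr_def)
        qed
      qed (use K' in \<open>auto simp: neighbours_def\<close>)
      also have "\<dots> \<le> (\<Sum>k\<in>?K'. ennreal (T powr b * V powr b))"
      proof (rule sum_mono)
        fix k assume k: "k \<in> ?K'"
        have "japanese k powr (b * s) = (japanese k powr s) powr b" by (simp add: powr_powr mult.commute)
        also have "\<dots> \<le> T powr b" using T[of k] k b by (intro powr_mono2) auto
        finally have "ennreal (japanese k powr (b * s)) \<le> ennreal (T powr b)" by (rule ennreal_leI)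
        moreover have "ennpowr (distr_Lp_norm p (box \<sigma> k ?f)) b \<le> ennpowr (ennreal V) b"
          using V(2)[OF K] k b by (intro ennpowr_mono) (auto simp: neighbours_def)
        ultimately have "?g k \<le> ennreal (T powr b) * ennreal (V powr b)"
          using V(1) by (intro mult_mono) (auto simp: ennpowr_ennreal)
        then show "?g k \<le> ennreal (T powr b * V powr b)" by (simp add: ennreal_mult)
      qed
      also have "\<dots> = ennreal (real (card ?K') * (T powr b * V powr b))"
        by (simp add: ennreal_of_nat_eq_real_of_nat ennreal_mult)
      also have "\<dots> \<le> ennreal (n * (T powr b * V powr b))"
        by (intro ennreal_leI mult_right_mono n) auto
      finally have "modulation_norm \<sigma> s p q ?f \<le> ennpowr (ennreal (n * (T powr b * V powr b))) (1 / b)"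
        using False b by (simp add: modulation_norm_def b_def[symmetric] ennpowr_mono)
      also have "\<dots> = ennreal (V * T * n powr recip q)"
        using n0 T0 V(1) b by (simp add: ennpowr_ennreal powr_mult powr_powr rb mult_ac)
      finally show ?thesis .
    qed
    moreover have "tempered ?f" by (intro tempered_spectral block_sum_schwartz K)
    ultimately show "?f \<in> modulation_space \<sigma> s p q \<and> modulation_norm \<sigma> s p q ?f \<le> ennreal (V * T * n powr recip q)"
      by (auto simp: modulation_space_def intro: le_less_trans)
  qed
qed

lemma block_sum_mass_lower_bound:
  assumes K: "finite K" and a: "0 < a" and \<Lambda>: "\<And>k \<xi>. k \<in> K \<Longrightarrow> \<sigma> (\<xi> - k) \<noteq> 0 \<Longrightarrow> norm (\<xi> - \<eta>) \<le> \<Lambda>"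
  shows "real (card K) * exp (- a * \<Lambda>\<^sup>2) * (LINT \<xi>|lborel. \<sigma> \<xi>)
    \<le> (LINT \<xi>|lborel. (\<Sum>k\<in>K. \<sigma> (\<xi> - k)) * exp (- a * (norm (\<xi> - \<eta>))\<^sup>2))"
proof -
  have si: "integrable lborel (\<lambda>\<xi>. \<sigma> (\<xi> - k))" for k
    using integrable_shift[OF block_integrable, of "- k"] by simp
  have se: "(LINT \<xi>|lborel. \<sigma> (\<xi> - k)) = (LINT \<xi>|lborel. \<sigma> \<xi>)" for k
    using integral_shift[of \<sigma> "- k"] borel_measurable_integrable[OF block_integrable] by simp
  have gi: "integrable lborel (\<lambda>\<xi>. (\<Sum>k\<in>K. \<sigma> (\<xi> - k)) * exp (- a * (norm (\<xi> - \<eta>))\<^sup>2))"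
  proof (rule Bochner_Integration.integrable_bound)
    show i: "integrable lborel (\<lambda>\<xi>. \<Sum>k\<in>K. \<sigma> (\<xi> - k))" by (intro Bochner_Integration.integrable_sum si)
    have "(\<lambda>\<xi>. exp (- a * (norm (\<xi> - \<eta>))\<^sup>2)) \<in> borel_measurable borel"
      by (intro borel_measurable_continuous_onI continuous_intros)
    then show "(\<lambda>\<xi>. (\<Sum>k\<in>K. \<sigma> (\<xi> - k)) * exp (- a * (norm (\<xi> - \<eta>))\<^sup>2)) \<in> borel_measurable lborel"
      using borel_measurable_integrable[OF i] by (intro borel_measurable_times) auto
    show "AE \<xi> in lborel. norm ((\<Sum>k\<in>K. \<sigma> (\<xi> - k)) * exp (- a * (norm (\<xi> - \<eta>))\<^sup>2)) \<le> norm (\<Sum>k\<in>K. \<sigma> (\<xi> - k))"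
      using a by (intro AE_I2) (auto simp: abs_mult mult_left_le)
  qed
  have "(LINT \<xi>|lborel. exp (- a * \<Lambda>\<^sup>2) * (\<Sum>k\<in>K. \<sigma> (\<xi> - k))) \<le> (LINT \<xi>|lborel. (\<Sum>k\<in>K. \<sigma> (\<xi> - k)) * exp (- a * (norm (\<xi> - \<eta>))\<^sup>2))"
  proof (rule integral_mono[OF _ gi])
    show "integrable lborel (\<lambda>\<xi>. exp (- a * \<Lambda>\<^sup>2) * (\<Sum>k\<in>K. \<sigma> (\<xi> - k)))"
      by (intro integrable_mult_right Bochner_Integration.integrable_sum si)
    show "exp (- a * \<Lambda>\<^sup>2) * (\<Sum>k\<in>K. \<sigma> (\<xi> - k)) \<le> (\<Sum>k\<in>K. \<sigma> (\<xi> - k)) * exp (- a * (norm (\<xi> - \<eta>))\<^sup>2)" for \<xi>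
      unfolding sum_distrib_left sum_distrib_right
    proof (rule sum_mono)
      fix k assume k: "k \<in> K"
      show "exp (- a * \<Lambda>\<^sup>2) * \<sigma> (\<xi> - k) \<le> \<sigma> (\<xi> - k) * exp (- a * (norm (\<xi> - \<eta>))\<^sup>2)"
      proof (cases "\<sigma> (\<xi> - k) = 0")
        case False
        then have "(norm (\<xi> - \<eta>))\<^sup>2 \<le> \<Lambda>\<^sup>2" using \<Lambda>[OF k] by (intro power_mono) auto
        then have "exp (- a * \<Lambda>\<^sup>2) \<le> exp (- a * (norm (\<xi> - \<eta>))\<^sup>2)" using a by simp
        then show ?thesis using block_nonneg[of "\<xi> - k"] by (simp add: mult.commute mult_left_mono)
      qed simp
    qed
  qed
  moreover have "(LINT \<xi>|lborel. exp (- a * \<Lambda>\<^sup>2) * (\<Sum>k\<in>K. \<sigma> (\<xi> - k))) = real (card K) * exp (- a * \<Lambda>\<^sup>2) * (LINT \<xi>|lborel. \<sigma> \<xi>)"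
    by (simp add: Bochner_Integration.integral_sum[OF si] se)
  ultimately show ?thesis by (simp add: mult_ac)
qed

context
  fixes p q :: ennreal and s C :: real
  assumes est: "\<forall>f\<in>modulation_space \<sigma> s p q. U_Lp_norm p {-1..1} f \<le> ennreal C * modulation_norm \<sigma> s p q f"
    and pq: "1 \<le> p" "1 \<le> q"
begin

lemma modulation_estimate_block_sum:
  obtains M where "\<And>a K \<eta> \<Lambda> T n. \<lbrakk>0 < a; a \<le> 1; finite K; K \<subseteq> int_lattice; 0 \<le> T; 0 < n;
      \<And>k \<xi>. k \<in> K \<Longrightarrow> \<sigma> (\<xi> - k) \<noteq> 0 \<Longrightarrow> norm (\<xi> - \<eta>) \<le> \<Lambda>;
      \<And>k. k \<in> neighbours L K \<Longrightarrow> japanese k powr s \<le> T; real (card (neighbours L K)) \<le> n\<rbrakk> \<Longrightarrow>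
      a powr (real CARD('n) / 2 * recip p) * (2 * a) powr recip p * (real (card K) * exp (- a * \<Lambda>\<^sup>2))
      \<le> M * T * n powr recip q"
proof -
  let ?d = "real CARD('n)"
  obtain V where V: "0 \<le> V" "\<And>K T n. \<lbrakk>finite K; K \<subseteq> int_lattice; 0 \<le> T; 0 < n;
      \<And>k. k \<in> neighbours L K \<Longrightarrow> japanese k powr s \<le> T; real (card (neighbours L K)) \<le> n\<rbrakk> \<Longrightarrow>
      spectral (block_sum \<sigma> K) \<in> modulation_space \<sigma> s p q \<and>
      modulation_norm \<sigma> s p q (spectral (block_sum \<sigma> K)) \<le> ennreal (V * T * n powr recip q)"
    by (rule modulation_norm_block_sum[OF pq]) blast
  define J where "J = (LINT \<xi>|lborel. \<sigma> \<xi>)"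
  define c where "c = (8 * pi) powr (- ?d / 2) * J"
  have c: "0 < c" using block_integral_pos by (simp add: c_def J_def)
  show ?thesis
  proof (rule that[of "max C 0 * V / c"])
    fix a \<Lambda> T n :: real and K :: "(real^'n) set" and \<eta> :: "real^'n"
    assume a: "0 < a" "a \<le> 1" and K: "finite K" "K \<subseteq> int_lattice" and T0: "0 \<le> T" and n0: "0 < n"
      and \<Lambda>: "\<And>k \<xi>. k \<in> K \<Longrightarrow> \<sigma> (\<xi> - k) \<noteq> 0 \<Longrightarrow> norm (\<xi> - \<eta>) \<le> \<Lambda>"
      and T: "\<And>k. k \<in> neighbours L K \<Longrightarrow> japanese k powr s \<le> T"
      and n: "real (card (neighbours L K)) \<le> n"
    let ?f = "spectral (block_sum \<sigma> K)"
    define P where "P = (LINT \<xi>|lborel. (\<Sum>k\<in>K. \<sigma> (\<xi> - k)) * exp (- a * (norm (\<xi> - \<eta>))\<^sup>2))"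
    have P: "real (card K) * exp (- a * \<Lambda>\<^sup>2) * J \<le> P"
      unfolding P_def J_def by (rule block_sum_mass_lower_bound[OF K(1) a(1) \<Lambda>])
    have "ennreal ((8 * pi) powr (- ?d / 2) * a powr (?d / 2 * recip p) * P * (2 * a) powr recip p) \<le> U_Lp_norm p {-1..1} ?f"
      unfolding P_def
      by (rule U_Lp_norm_lower_bound[OF block_sum_schwartz[OF K(1)], of 0])
         (use a pq in \<open>auto simp: block_sum_def block_nonneg sum_nonneg\<close>)
    also have "\<dots> \<le> ennreal C * modulation_norm \<sigma> s p q ?f"
      using V(2)[OF K T0 n0 T n] by (intro bspec[OF est]) blast
    also have "\<dots> \<le> ennreal C * ennreal (V * T * n powr recip q)"
      using V(2)[OF K T0 n0 T n] by (intro mult_left_mono) auto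
    also have "\<dots> = ennreal (max C 0 * (V * T * n powr recip q))"
      using V(1) T0 by (cases "C \<ge> 0") (auto simp: ennreal_mult[symmetric] ennreal_neg)
    finally have "(8 * pi) powr (- ?d / 2) * a powr (?d / 2 * recip p) * P * (2 * a) powr recip p \<le> max C 0 * (V * T * n powr recip q)"
      using V(1) T0 by (subst (asm) ennreal_le_iff) auto
    moreover have "(8 * pi) powr (- ?d / 2) * a powr (?d / 2 * recip p) * (real (card K) * exp (- a * \<Lambda>\<^sup>2) * J) * (2 * a) powr recip p
       \<le> (8 * pi) powr (- ?d / 2) * a powr (?d / 2 * recip p) * P * (2 * a) powr recip p"
      by (intro mult_right_mono mult_left_mono P) auto
    ultimately have "c * (a powr (?d / 2 * recip p) * (2 * a) powr recip p * (real (card K) * exp (- a * \<Lambda>\<^sup>2))) \<le> max C 0 * V * T * n powr recip q"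
      by (simp add: c_def mult_ac)
    then show "a powr (?d / 2 * recip p) * (2 * a) powr recip p * (real (card K) * exp (- a * \<Lambda>\<^sup>2)) \<le> max C 0 * V / c * T * n powr recip q"
      using c by (simp add: field_simps)
  qed
qed

text \<open>A single block of high frequency.\<close>

lemma modulation_estimate_regularity_nonneg: "0 \<le> s"
proof (rule ccontr)
  assume "\<not> 0 \<le> s"
  then have s: "s < 0" by simp
  let ?d = "real CARD('n)"
  obtain M where M: "\<And>a K \<eta> \<Lambda> T n. \<lbrakk>0 < a; a \<le> 1; finite K; K \<subseteq> int_lattice; 0 \<le> T; 0 < n;
      \<And>k \<xi>. k \<in> K \<Longrightarrow> \<sigma> (\<xi> - k) \<noteq> 0 \<Longrightarrow> norm (\<xi> - \<eta>) \<le> \<Lambda>;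
      \<And>k. k \<in> neighbours L K \<Longrightarrow> japanese k powr s \<le> T; real (card (neighbours L K)) \<le> n\<rbrakk> \<Longrightarrow>
      a powr (?d / 2 * recip p) * (2 * a) powr recip p * (real (card K) * exp (- a * \<Lambda>\<^sup>2))
      \<le> M * T * n powr recip q"
    using modulation_estimate_block_sum by blast
  define D where "D = (lattice_cube (2 * L) :: (real^'n) set)"
  have D: "finite D" unfolding D_def using L(1) by (intro finite_lattice_cube) simp
  have "0 \<in> D" using L(1) by (simp add: D_def lattice_cube_def int_lattice_def)
  then have cD: "0 < real (card D)" using D by (auto simp: card_gt_0_iff)
  define \<kappa> where "\<kappa> = (1/2) powr (?d / 2 * recip p) * (2 * (1/2)) powr recip p * (real 1 * exp (- (1/2) * (?d * L)\<^sup>2))"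
  have "\<kappa> * N powr 0 \<le> (M * real (card D) powr recip q) * N powr s" if N: "1 \<le> N" for N
  proof -
    define m where "m = nat \<lceil>N + ?d * (2 * L)\<rceil>"
    have m: "N + ?d * (2 * L) \<le> real m" unfolding m_def by linarith
    \<comment> \<open>all neighbours of \<open>k0\<close> have norm at least \<open>N\<close>\<close>
    define k0 :: "real^'n" where "k0 = real m *\<^sub>R axis undefined 1"
    have k0: "k0 \<in> int_lattice" "norm k0 = real m"
      using norm_axis_1[of "undefined :: 'n"] by (simp_all add: k0_def) (simp add: int_lattice_def axis_def)
    have T: "japanese k powr s \<le> N powr s" if "k \<in> neighbours L {k0}" for k
    proof -
      have "norm (k0 - k) \<le> ?d * (2 * L)" using that by (intro norm_le_of_components) (auto simp: neighbours_def lattice_cube_def)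
      then have "N \<le> norm k" using norm_triangle_ineq2[of k0 k] k0(2) m by linarith
      also have "norm k \<le> japanese k" unfolding japanese_def by (rule real_le_rsqrt) simp
      finally show ?thesis using s N by (intro powr_mono2') auto
    qed
    have "neighbours L {k0} \<subseteq> (\<lambda>l. k0 - l) ` D"
    proof
      fix k assume "k \<in> neighbours L {k0}"
      then have "k0 - k \<in> D" by (simp add: D_def neighbours_def)
      then show "k \<in> (\<lambda>l. k0 - l) ` D" by (rule rev_image_eqI) simp
    qed
    then have n: "card (neighbours L {k0}) \<le> card D"
      using D by (meson card_image_le card_mono finite_imageI order_trans)
    have "\<kappa> * N powr 0 \<le> M * N powr s * real (card D) powr recip q"
      using M[of "1/2" "{k0}" "N powr s" "real (card D)" k0 "?d * L"] T n k0 cD block_support N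
      unfolding \<kappa>_def by auto
    then show ?thesis by (simp only: mult_ac)
  qed
  then have "0 \<le> s" by (rule exponent_le_of_bounded[rotated]) (auto simp: \<kappa>_def)
  with s show False by simp
qed

text \<open>All blocks with frequency up to \<open>N\<close>, which focus at the time \<open>0\<close> at the scale \<open>1/N\<close>.\<close>

lemma modulation_estimate_focusing:
  "real CARD('n) - (real CARD('n) + 2) * recip p - real CARD('n) * recip q \<le> s"
proof -
  let ?d = "real CARD('n)"
  obtain M where M: "\<And>a K \<eta> \<Lambda> T n. \<lbrakk>0 < a; a \<le> 1; finite K; K \<subseteq> int_lattice; 0 \<le> T; 0 < n;
      \<And>k \<xi>. k \<in> K \<Longrightarrow> \<sigma> (\<xi> - k) \<noteq> 0 \<Longrightarrow> norm (\<xi> - \<eta>) \<le> \<Lambda>;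
      \<And>k. k \<in> neighbours L K \<Longrightarrow> japanese k powr s \<le> T; real (card (neighbours L K)) \<le> n\<rbrakk> \<Longrightarrow>
      a powr (?d / 2 * recip p) * (2 * a) powr recip p * (real (card K) * exp (- a * \<Lambda>\<^sup>2))
      \<le> M * T * n powr recip q"
    using modulation_estimate_block_sum by blast
  note s = modulation_estimate_regularity_nonneg
  define \<beta> where "\<beta> = 1 + 2 * L"
  have \<beta>: "1 \<le> \<beta>" using L(1) by (simp add: \<beta>_def)
  define E where "E = exp (- (?d * \<beta>)\<^sup>2)"
  define B where "B = (1 + ?d * \<beta>) powr s * ((3 * \<beta>) powr ?d) powr recip q"
  have bound: "2 powr recip p * E * N powr (?d - (?d + 2) * recip p) \<le> max M 0 * B * N powr (s + ?d * recip q)" if N: "1 \<le> N" for N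
  proof -
    let ?K = "lattice_cube N :: (real^'n) set"
    define a where "a = N powr (-2)"
    have a: "0 < a" "a \<le> 1" using N powr_mono[of "-2" 0 N] by (auto simp: a_def)
    have \<beta>N: "N + 2 * L \<le> \<beta> * N" "L \<le> 2 * L * N"
    proof -
      have "2 * L * 1 \<le> 2 * L * N" using N L(1) by (intro mult_left_mono) auto
      then show "N + 2 * L \<le> \<beta> * N" "L \<le> 2 * L * N" using L(1) by (auto simp: \<beta>_def algebra_simps)
    qed
    have near: "\<bar>k $ i\<bar> \<le> \<beta> * N" if k: "k \<in> neighbours L ?K" for k :: "real^'n" and i
    proof -
      obtain j where "j \<in> ?K" "j - k \<in> lattice_cube (2 * L)" using k by (auto simp: neighbours_def)
      then have "\<bar>j $ i\<bar> \<le> N" "\<bar>(j - k) $ i\<bar> \<le> 2 * L" by (auto simp: lattice_cube_def)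
      then show ?thesis using \<beta>N(1) unfolding vector_minus_component by linarith
    qed
    have T: "japanese k powr s \<le> ((1 + ?d * \<beta>) * N) powr s" if "k \<in> neighbours L ?K" for k :: "real^'n"
    proof -
      have "norm k \<le> ?d * (\<beta> * N)" using near[OF that] by (rule norm_le_of_components)
      moreover have "japanese k \<le> 1 + norm k"
        unfolding japanese_def by (rule real_le_lsqrt) (auto simp: power2_sum)
      ultimately have "japanese k \<le> (1 + ?d * \<beta>) * N" using N by (simp add: algebra_simps)
      then show ?thesis using s by (intro powr_mono2) (auto simp: japanese_def)
    qed
    have n: "real (card (neighbours L ?K)) \<le> (3 * \<beta> * N) powr ?d"
    proof -
      have bn: "1 \<le> \<beta> * N" using \<beta> N mult_mono[of 1 \<beta> 1 N] by simp
      have "neighbours L ?K \<subseteq> (lattice_cube (\<beta> * N) :: (real^'n) set)"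
        using near by (auto simp: lattice_cube_def neighbours_def)
      then have "card (neighbours L ?K) \<le> card (lattice_cube (\<beta> * N) :: (real^'n) set)"
        using bn by (intro card_mono finite_lattice_cube) auto
      also have "\<dots> = (2 * nat \<lfloor>\<beta> * N\<rfloor> + 1) ^ CARD('n)" using bn by (intro card_lattice_cube) simp
      finally have "real (card (neighbours L ?K)) \<le> real (2 * nat \<lfloor>\<beta> * N\<rfloor> + 1) ^ CARD('n)"
        by (simp only: of_nat_le_iff flip: of_nat_power)
      also have "\<dots> \<le> (3 * \<beta> * N) ^ CARD('n)"
      proof (rule power_mono)
        have "real (nat \<lfloor>\<beta> * N\<rfloor>) \<le> \<beta> * N" using bn by linarith
        moreover have "real (2 * nat \<lfloor>\<beta> * N\<rfloor> + 1) = 2 * real (nat \<lfloor>\<beta> * N\<rfloor>) + 1" by simp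
        ultimately show "real (2 * nat \<lfloor>\<beta> * N\<rfloor> + 1) \<le> 3 * \<beta> * N" using bn by linarith
      qed simp
      also have "\<dots> = (3 * \<beta> * N) powr ?d" using \<beta> N by (simp add: powr_realpow)
      finally show ?thesis .
    qed
    have \<Lambda>: "norm (\<xi> - 0) \<le> ?d * \<beta> * N" if "k \<in> ?K" "\<sigma> (\<xi> - k) \<noteq> 0" for k \<xi> :: "real^'n"
    proof -
      have "\<bar>\<xi> $ i\<bar> \<le> \<beta> * N" for i
      proof -
        have "\<bar>k $ i\<bar> \<le> N" using that(1) by (simp add: lattice_cube_def)
        then show ?thesis using L(2)[OF that(2), of i] \<beta>N(1) L(1) unfolding vector_minus_component by linarith
      qed
      then have "norm \<xi> \<le> ?d * (\<beta> * N)" by (rule norm_le_of_components)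
      then show ?thesis by (simp add: mult.assoc)
    qed
    have cK: "N powr ?d \<le> real (card ?K)"
    proof -
      have "N \<le> real (2 * nat \<lfloor>N\<rfloor> + 1)" using N by linarith
      then have "N ^ CARD('n) \<le> real (2 * nat \<lfloor>N\<rfloor> + 1) ^ CARD('n)" using N by (intro power_mono) auto
      then show ?thesis using N by (simp add: card_lattice_cube powr_realpow)
    qed
    have aE: "exp (- a * (?d * \<beta> * N)\<^sup>2) = E"
    proof -
      have "a * N\<^sup>2 = 1" using N by (simp add: a_def powr_minus field_simps)
      then have "a * (?d * \<beta> * N)\<^sup>2 = (?d * \<beta>)\<^sup>2" by (simp add: power_mult_distrib)
      then show ?thesis by (simp add: E_def)
    qed
    have "a powr (?d / 2 * recip p) * (2 * a) powr recip p * (N powr ?d * E)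
       \<le> a powr (?d / 2 * recip p) * (2 * a) powr recip p * (real (card ?K) * exp (- a * (?d * \<beta> * N)\<^sup>2))"
      unfolding aE by (intro mult_left_mono mult_right_mono cK) (auto simp: E_def)
    also have "\<dots> \<le> M * ((1 + ?d * \<beta>) * N) powr s * ((3 * \<beta> * N) powr ?d) powr recip q"
    proof (rule M[OF a, where \<eta> = 0])
      show "finite ?K" using N by (intro finite_lattice_cube) simp
      show "?K \<subseteq> int_lattice" by (auto simp: lattice_cube_def)
      show "0 < (3 * \<beta> * N) powr ?d" using \<beta> N by simp
    qed (use T n \<Lambda> in auto)
    also have "\<dots> \<le> max M 0 * ((1 + ?d * \<beta>) * N) powr s * ((3 * \<beta> * N) powr ?d) powr recip q"
      by (intro mult_right_mono) auto
    finally have i: "a powr (?d / 2 * recip p) * (2 * a) powr recip p * (N powr ?d * E) \<le> max M 0 * ((1 + ?d * \<beta>) * N) powr s * ((3 * \<beta> * N) powr ?d) powr recip q" .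
    have 1: "a powr (?d / 2 * recip p) = N powr (- ?d * recip p)" using N by (simp add: a_def powr_powr)
    have 2: "(2 * a) powr recip p = 2 powr recip p * N powr (- 2 * recip p)" using N by (simp add: a_def powr_powr powr_mult)
    have 3: "((1 + ?d * \<beta>) * N) powr s = (1 + ?d * \<beta>) powr s * N powr s" using \<beta> N by (simp add: powr_mult)
    have 4: "((3 * \<beta> * N) powr ?d) powr recip q = ((3 * \<beta>) powr ?d) powr recip q * N powr (?d * recip q)"
      using \<beta> N by (simp add: powr_mult powr_powr)
    have 5: "N powr (- ?d * recip p) * N powr (- 2 * recip p) * N powr ?d = N powr (?d - (?d + 2) * recip p)"
      "N powr s * N powr (?d * recip q) = N powr (s + ?d * recip q)"
      by (simp_all add: algebra_simps flip: powr_add)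
    show ?thesis using i unfolding 1 2 3 4 5[symmetric] B_def by (simp only: mult_ac)
  qed
  have "?d - (?d + 2) * recip p \<le> s + ?d * recip q"
    by (rule exponent_le_of_bounded[OF _ bound]) (auto simp: E_def)
  then show ?thesis by simp
qed

end

end

section \<open>The necessary conditions\<close>

theorem proposition1p2:
  fixes p q r :: ennreal and s :: real
  assumes "2 \<le> p" and "1 \<le> q" and "1 \<le> r"
  shows "(\<forall>\<sigma> :: real^'n::finite \<Rightarrow> real. cube_partition \<sigma> \<longrightarrow>
            (\<exists>C::real. \<forall>f\<in>modulation_space \<sigma> s p q.
               U_Lp_norm p {-1..1} f \<le> ennreal C * modulation_norm \<sigma> s p q f) \<longrightarrow>
            s \<ge> max 0 (real CARD('n) - (real CARD('n) + 2) * recip p - real CARD('n) * recip q))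
       \<and> ((\<exists>C::real. \<forall>f :: 'n distr \<in> bessel_space s r.
               U_mixed_norm p {-1..1} q f \<le> ennreal C * bessel_norm s r f) \<longrightarrow>
            s \<ge> max 0 (real CARD('n) - real CARD('n) * recip q - 2 * recip p
                         - real CARD('n) * recip r) \<and> q \<ge> r)
       \<and> ((\<exists>C::real. \<forall>f :: 'n distr \<in> bessel_space s r.
               U_mixed_norm p UNIV q f \<le> ennreal C * bessel_norm s r f) \<longrightarrow>
            s \<ge> max 0 (real CARD('n) - real CARD('n) * recip q - 2 * recip p
                         - real CARD('n) * recip r) \<and> q \<ge> r \<and>
            2 * recip p + real CARD('n) * recip q \<le> real CARD('n) * recip r)"
proof -
  have p: "1 \<le> p" using assms(1) by (rule order_trans[rotated]) simp
  note pqr = p assms(2,3)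
  show ?thesis
  proof (intro conjI allI impI; (elim exE)?)
    fix \<sigma> :: "real^'n \<Rightarrow> real" and C :: real
    assume \<sigma>: "cube_partition \<sigma>"
      and est: "\<forall>f\<in>modulation_space \<sigma> s p q. U_Lp_norm p {-1..1} f \<le> ennreal C * modulation_norm \<sigma> s p q f"
    obtain L where L: "0 \<le> L" "\<And>\<xi> i. \<sigma> \<xi> \<noteq> 0 \<Longrightarrow> \<bar>\<xi> $ i\<bar> \<le> L" using cube_partition_support[OF \<sigma>] by metis
    show "s \<ge> max 0 (real CARD('n) - (real CARD('n) + 2) * recip p - real CARD('n) * recip q)"
      using modulation_estimate_regularity_nonneg[OF \<sigma> L est pqr(1,2)]
        modulation_estimate_focusing[OF \<sigma> L est pqr(1,2)] by simp
  next
    fix C :: real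
    assume est: "\<forall>f :: 'n distr \<in> bessel_space s r. U_mixed_norm p {-1..1} q f \<le> ennreal C * bessel_norm s r f"
    note E = est pqr _ order_refl
    show "s \<ge> max 0 (real CARD('n) - real CARD('n) * recip q - 2 * recip p - real CARD('n) * recip r)"
      using bessel_estimate_regularity_nonneg[OF E] bessel_estimate_focusing[OF E] by simp
    show "q \<ge> r" using bessel_estimate_exponents_ordered[OF E] by simp
  next
    fix C :: real
    assume est: "\<forall>f :: 'n distr \<in> bessel_space s r. U_mixed_norm p UNIV q f \<le> ennreal C * bessel_norm s r f"
    note E = est pqr _ subset_UNIV
    show "s \<ge> max 0 (real CARD('n) - real CARD('n) * recip q - 2 * recip p - real CARD('n) * recip r)"
      using bessel_estimate_regularity_nonneg[OF E] bessel_estimate_focusing[OF E] by simp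
    show "q \<ge> r" using bessel_estimate_exponents_ordered[OF E] by simp
    show "2 * recip p + real CARD('n) * recip q \<le> real CARD('n) * recip r"
      using bessel_estimate_scaling[OF E refl] by simp
  qed
qed

end
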